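(* Let $(W,S)$ be a Coxeter system with $S$ finite. If $\mathcal{E}=\Phi_{\mathrm{sph}}^+$ then $\Gamma=\widetilde{S}=L$, and so $\Gamma$ is a Garside shadow.
   Context: $\ell$ is the length function, and $x\preccurlyeq y$ means $\ell(x^{-1}y)=\ell(y)-\ell(x)$ (right weak order, for which every bounded subset $X$ has a least upper bound, the join $\bigvee X$). An element $u$ is a suffix of $w$ if $\ell(w)=\ell(wu^{-1})+\ell(u)$. Root system: $V$ is the real vector space with basis $\{\alpha_s\mid s\in S\}$ and symmetric bilinear form $\langle\alpha_s,\alpha_t\rangle=-\cos(\pi/m_{s,t})$, with $m_{s,t}$ the order of $st$ (value $-1$ if $m_{s,t}=\infty$); $W$ acts by $s\lambda=\lambda-2\langle\lambda,\alpha_s\rangle\alpha_s$; $\Phi=\{w\alpha_s\mid w\in W,s\in S\}$; $\Phi^+$ is the set of roots that are non-negative combinations of the $\alpha_s$, and $\alpha<0$ means $-\alpha\in\Phi^+$. For $\beta=w\alpha_s$, $s_\beta=wsw^{-1}$. The inversion set is $\Phi(w)=\{\alpha\in\Phi^+\mid w^{-1}\alpha<0\}$. Elementary roots: $\beta\in\Phi^+$ dominates $\alpha\in\Phi^+$ if for all $w\in W$, $w^{-1}\beta<0$ implies $w^{-1}\alpha<0$. $\mathcal{E}$ is the set of $\beta\in\Phi^+$ that dominate no $\alpha\in\Phi^+\setminus\{\beta\}$. Spherical roots: $J\subseteq S$ is spherical if $\langle J\rangle$ is finite; $\Phi_{\mathrm{sph}}^+$ is the set of $\alpha=\sum_s c_s\alpha_s\in\Phi^+$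 whose support $\{s\mid c_s\neq0\}$ is contained in a spherical subset of $S$. Low elements: $\Phi^1(w)=\{\beta\in\Phi^+\mid\ell(s_\beta w)=\ell(w)-1\}$, and $L=\{w\in W\mid\Phi^1(w)\subseteq\mathcal{E}\}$ (equivalently, $\Phi(w)$ is the set of roots in $\Phi^+$ that are non-negative linear combinations of some set $A\subseteq\mathcal{E}$). Garside shadows: $B\subseteq W$ is a Garside shadow if $S\subseteq B$, $B$ contains $\bigvee X$ for every $X\subseteq B$ that is bounded in $(W,\preccurlyeq)$, and $B$ contains every suffix of each of its elements. $\widetilde{S}$ is the smallest Garside shadow (the intersection of all Garside shadows). Gates: the cone type of $x$ is $T(x)=\{y\in W\mid\ell(xy)=\ell(x)+\ell(y)\}$. For each cone type $T$ the set $X_T=\{w\in W\mid T(w^{-1})=T\}$ has a unique element $g_T$ of minimal length (and $g_T\preccurlyeq x$ for all $x\in X_T$). $\Gamma=\{g_T\mid T\text{ a cone type}\}$. *)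

theory Defs
  imports Complex_Main "HOL-Algebra.Lattice" "HOL-Algebra.Generated_Groups"
    "HOL-Algebra.Multiplicative_Group"
begin

section \<open>Coxeter systems\<close>

definition word_eval :: "('a, 'b) monoid_scheme \<Rightarrow> 'a list \<Rightarrow> 'a" where
  "word_eval G ws = foldr (\<otimes>\<^bsub>G\<^esub>) ws \<one>\<^bsub>G\<^esub>"

text \<open>The order of \<open>s t\<close>, with the library convention that \<open>0\<close> stands for infinite order.\<close>

definition cox_order :: "('a, 'b) monoid_scheme \<Rightarrow> 'a \<Rightarrow> 'a \<Rightarrow> nat" where
  "cox_order G s t = group.ord G (s \<otimes>\<^bsub>G\<^esub> t)"

text \<open>One application of a relation \<open>(s t)\<^sup>m = 1\<close> with \<open>m = m(s,t)\<close> finite.\<close>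

inductive cox_step :: "('a, 'b) monoid_scheme \<Rightarrow> 'a set \<Rightarrow> 'a list \<Rightarrow> 'a list \<Rightarrow> bool"
  for G S where
  "\<lbrakk>s \<in> S; t \<in> S; cox_order G s t \<noteq> 0; us \<in> lists S; vs \<in> lists S\<rbrakk> \<Longrightarrow>
    cox_step G S (us @ concat (replicate (cox_order G s t) [s, t]) @ vs) (us @ vs)"

text \<open>
  The axiom \<open>presentation\<close> says that \<open>W\<close> is the quotient of the free monoid on \<open>S\<close> by the
  congruence generated by the relations \<open>(s t)\<^sup>m = 1\<close>, \<open>m = m(s,t) < \<infinity>\<close>. Since the relations
  with \<open>s = t\<close> read \<open>s\<^sup>2 = 1\<close>, this monoid is also the group with that presentation.
\<close>

locale coxeter_system = group G for G (structure) +
  fixes S :: "'a set"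
  assumes gens_closed: "S \<subseteq> carrier G"
    and gens_generate: "generate G S = carrier G"
    and gens_order_two: "s \<in> S \<Longrightarrow> ord s = 2"
    and presentation: "\<lbrakk>us \<in> lists S; vs \<in> lists S\<rbrakk> \<Longrightarrow>
      word_eval G us = word_eval G vs \<longleftrightarrow> equivclp (cox_step G S) us vs"

definition cox_length :: "('a, 'b) monoid_scheme \<Rightarrow> 'a set \<Rightarrow> 'a \<Rightarrow> nat" where
  "cox_length G S w = (LEAST n. \<exists>ws \<in> lists S. length ws = n \<and> word_eval G ws = w)"


section \<open>Weak order, suffixes and Garside shadows\<close>

definition weak_order :: "('a, 'b) monoid_scheme \<Rightarrow> 'a set \<Rightarrow> 'a gorder" where
  "weak_order G S = \<lparr>carrier = carrier G, eq = (=),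
     le = (\<lambda>x y. int (cox_length G S (inv\<^bsub>G\<^esub> x \<otimes>\<^bsub>G\<^esub> y)) =
                 int (cox_length G S y) - int (cox_length G S x))\<rparr>"

definition is_suffix :: "('a, 'b) monoid_scheme \<Rightarrow> 'a set \<Rightarrow> 'a \<Rightarrow> 'a \<Rightarrow> bool" where
  "is_suffix G S u w \<longleftrightarrow>
     cox_length G S w = cox_length G S (w \<otimes>\<^bsub>G\<^esub> inv\<^bsub>G\<^esub> u) + cox_length G S u"

text \<open>
  The subset \<open>A\<close> may be empty; its join is then the identity, so every Garside shadow contains
  the identity even when \<open>S\<close> is empty.
\<close>

definition garside_shadow :: "('a, 'b) monoid_scheme \<Rightarrow> 'a set \<Rightarrow> 'a set \<Rightarrow> bool" where
  "garside_shadow G S B \<longleftrightarrow>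
     B \<subseteq> carrier G \<and> S \<subseteq> B \<and>
     (\<forall>A \<subseteq> B. Upper (weak_order G S) A \<noteq> {} \<longrightarrow> \<Squnion>\<^bsub>weak_order G S\<^esub> A \<in> B) \<and>
     (\<forall>w \<in> B. \<forall>u \<in> carrier G. is_suffix G S u w \<longrightarrow> u \<in> B)"

definition smallest_garside_shadow :: "('a, 'b) monoid_scheme \<Rightarrow> 'a set \<Rightarrow> 'a set" where
  "smallest_garside_shadow G S = \<Inter> {B. garside_shadow G S B}"


section \<open>Cone types and gates\<close>

definition cone_type :: "('a, 'b) monoid_scheme \<Rightarrow> 'a set \<Rightarrow> 'a \<Rightarrow> 'a set" where
  "cone_type G S x =
     {y \<in> carrier G. cox_length G S (x \<otimes>\<^bsub>G\<^esub> y) = cox_length G S x + cox_length G S y}"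

definition cone_types :: "('a, 'b) monoid_scheme \<Rightarrow> 'a set \<Rightarrow> 'a set set" where
  "cone_types G S = cone_type G S ` carrier G"

definition cone_class :: "('a, 'b) monoid_scheme \<Rightarrow> 'a set \<Rightarrow> 'a set \<Rightarrow> 'a set" where
  "cone_class G S T = {w \<in> carrier G. cone_type G S (inv\<^bsub>G\<^esub> w) = T}"

definition gate :: "('a, 'b) monoid_scheme \<Rightarrow> 'a set \<Rightarrow> 'a set \<Rightarrow> 'a" where
  "gate G S T = arg_min_on (cox_length G S) (cone_class G S T)"

definition gates :: "('a, 'b) monoid_scheme \<Rightarrow> 'a set \<Rightarrow> 'a set" where
  "gates G S = gate G S ` cone_types G S"


section \<open>The root system\<close>

text \<open>
  For finite \<open>S\<close>, the vector \<open>\<Sum>\<^sub>s c\<^sub>s \<alpha>\<^sub>s\<close> of \<open>V\<close> is represented by its coefficient function \<open>c\<close>,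
  extended by \<open>0\<close> outside \<open>S\<close>.
\<close>

type_synonym 'a root_vec = "'a \<Rightarrow> real"

definition simple_root :: "'a \<Rightarrow> 'a root_vec" where
  "simple_root s = (\<lambda>t. if t = s then 1 else 0)"

definition cox_form :: "('a, 'b) monoid_scheme \<Rightarrow> 'a set \<Rightarrow> 'a root_vec \<Rightarrow> 'a root_vec \<Rightarrow> real" where
  "cox_form G S u v = (\<Sum>s\<in>S. \<Sum>t\<in>S. u s * v t *
     (if cox_order G s t = 0 then - 1 else - cos (pi / real (cox_order G s t))))"

definition simple_refl :: "('a, 'b) monoid_scheme \<Rightarrow> 'a set \<Rightarrow> 'a \<Rightarrow> 'a root_vec \<Rightarrow> 'a root_vec" where
  "simple_refl G S s v = (\<lambda>t. v t - 2 * cox_form G S v (simple_root s) * simple_root s t)"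

text \<open>
  The action of \<open>w\<close> is the composite of the simple reflections along a word for \<open>w\<close>. It does not
  depend on the word, because the simple reflections satisfy the defining relations.
\<close>

definition root_act :: "('a, 'b) monoid_scheme \<Rightarrow> 'a set \<Rightarrow> 'a \<Rightarrow> 'a root_vec \<Rightarrow> 'a root_vec" where
  "root_act G S w v =
     foldr (simple_refl G S) (SOME ws. ws \<in> lists S \<and> word_eval G ws = w) v"

definition roots :: "('a, 'b) monoid_scheme \<Rightarrow> 'a set \<Rightarrow> 'a root_vec set" where
  "roots G S = {root_act G S w (simple_root s) | w s. w \<in> carrier G \<and> s \<in> S}"

definition pos_roots :: "('a, 'b) monoid_scheme \<Rightarrow> 'a set \<Rightarrow> 'a root_vec set" where
  "pos_roots G S = {\<beta> \<in> roots G S. \<forall>s \<in> S. 0 \<le> \<beta> s}"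

definition is_neg_root :: "('a, 'b) monoid_scheme \<Rightarrow> 'a set \<Rightarrow> 'a root_vec \<Rightarrow> bool" where
  "is_neg_root G S \<alpha> \<longleftrightarrow> (\<lambda>s. - \<alpha> s) \<in> pos_roots G S"

text \<open>The element \<open>w s w\<^sup>-\<^sup>1\<close> does not depend on the choice of \<open>w\<close> and \<open>s\<close> with \<open>\<beta> = w \<alpha>\<^sub>s\<close>.\<close>

definition root_reflection :: "('a, 'b) monoid_scheme \<Rightarrow> 'a set \<Rightarrow> 'a root_vec \<Rightarrow> 'a" where
  "root_reflection G S \<beta> = (THE r. \<exists>w \<in> carrier G. \<exists>s \<in> S.
     \<beta> = root_act G S w (simple_root s) \<and> r = w \<otimes>\<^bsub>G\<^esub> s \<otimes>\<^bsub>G\<^esub> inv\<^bsub>G\<^esub> w)"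


section \<open>Elementary roots, spherical roots and low elements\<close>

definition dominates :: "('a, 'b) monoid_scheme \<Rightarrow> 'a set \<Rightarrow> 'a root_vec \<Rightarrow> 'a root_vec \<Rightarrow> bool" where
  "dominates G S \<beta> \<alpha> \<longleftrightarrow> (\<forall>w \<in> carrier G.
     is_neg_root G S (root_act G S (inv\<^bsub>G\<^esub> w) \<beta>) \<longrightarrow>
     is_neg_root G S (root_act G S (inv\<^bsub>G\<^esub> w) \<alpha>))"

definition elementary_roots :: "('a, 'b) monoid_scheme \<Rightarrow> 'a set \<Rightarrow> 'a root_vec set" where
  "elementary_roots G S =
     {\<beta> \<in> pos_roots G S. \<not> (\<exists>\<alpha> \<in> pos_roots G S - {\<beta>}. dominates G S \<beta> \<alpha>)}"

definition spherical_subset :: "('a, 'b) monoid_scheme \<Rightarrow> 'a set \<Rightarrow> 'a set \<Rightarrow> bool" where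
  "spherical_subset G S J \<longleftrightarrow> J \<subseteq> S \<and> finite (generate G J)"

definition spherical_roots :: "('a, 'b) monoid_scheme \<Rightarrow> 'a set \<Rightarrow> 'a root_vec set" where
  "spherical_roots G S =
     {\<alpha> \<in> pos_roots G S. \<exists>J. spherical_subset G S J \<and> {s \<in> S. \<alpha> s \<noteq> 0} \<subseteq> J}"

definition short_inversions :: "('a, 'b) monoid_scheme \<Rightarrow> 'a set \<Rightarrow> 'a \<Rightarrow> 'a root_vec set" where
  "short_inversions G S w = {\<beta> \<in> pos_roots G S.
     int (cox_length G S (root_reflection G S \<beta> \<otimes>\<^bsub>G\<^esub> w)) = int (cox_length G S w) - 1}"

definition low_elements :: "('a, 'b) monoid_scheme \<Rightarrow> 'a set \<Rightarrow> 'a set" where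
  "low_elements G S = {w \<in> carrier G. short_inversions G S w \<subseteq> elementary_roots G S}"

end

theory Submission
  imports Defs
begin

text \<open>
  Write \<open>\<Phi>(w)\<close> for the inversion set of \<open>w\<close>, \<open>\<E>\<close> for the elementary roots and \<open>M\<close> for the set of
  elements \<open>w\<close> all of whose final roots \<open>- w \<alpha>\<^sub>s\<close> (\<open>s\<close> a right descent) are spherical. Under
  \<open>\<E> = \<Phi>\<^sub>s\<^sub>p\<^sub>h\<close> the inclusions \<open>\<Gamma> \<subseteq> S~ \<subseteq> M \<subseteq> L \<subseteq> \<Gamma>\<close> close up.

  \<open>\<Gamma> \<subseteq> B\<close> for every Garside shadow \<open>B\<close>, because the projection of \<open>w\<close> to the largest element of \<open>B\<close>
  below \<open>w\<close> preserves the cone type of \<open>w\<^sup>-\<^sup>1\<close>.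

  \<open>M \<subseteq> L\<close>: a short inversion \<open>\<beta>\<close> of \<open>w\<close> that is not simple is a positive combination of another short
  inversion and a root outside \<open>\<Phi>(w)\<close>. Iterating this for \<open>w = x\<^sup>-\<^sup>1\<close> shows that the support of a
  short inversion of \<open>x\<close> lies in the support of a final root of \<open>x\<close>, and sphericity passes to
  smaller supports.

  \<open>M\<close> is a Garside shadow: dominance can be translated from a suffix to the whole element, and a
  final root of a join is a short inversion of one of the joined elements.

  \<open>L \<subseteq> \<Gamma>\<close>: if \<open>x\<close> and \<open>g\<close> have the same cone type and \<open>\<beta>\<close> is a spherical root in \<open>\<Phi>(x)\<close> but not in
  \<open>\<Phi>(g)\<close>, some \<open>z\<close> in a finite parabolic subgroup has \<open>\<beta> \<in> \<Phi>(z)\<close> and \<open>\<Phi>(z) \<inter> \<Phi>(g) = {}\<close>, so \<open>z\<close> separates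
  the cone types. Hence the short inversions of \<open>x \<in> L\<close>, and with them \<open>\<Phi>(x)\<close>, lie in \<open>\<Phi>(g)\<close>.
\<close>

section \<open>Words and length\<close>

locale finite_coxeter_system = coxeter_system +
  assumes finite_gens: "finite S"
begin

abbreviation len :: "'a \<Rightarrow> nat" where "len \<equiv> cox_length G S"
abbreviation act :: "'a \<Rightarrow> 'a root_vec \<Rightarrow> 'a root_vec" where "act \<equiv> root_act G S"
abbreviation form :: "'a root_vec \<Rightarrow> 'a root_vec \<Rightarrow> real" where "form \<equiv> cox_form G S"

lemma gen_closed [simp]: "s \<in> S \<Longrightarrow> s \<in> carrier G"
  using gens_closed by auto

lemma gen_square [simp]: "s \<in> S \<Longrightarrow> s \<otimes> s = \<one>"
  using pow_ord_eq_1[of s] gens_order_two[of s] by (simp add: numeral_2_eq_2)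

lemma gen_inv [simp]: "s \<in> S \<Longrightarrow> inv s = s"
  by (rule inv_equality) auto

lemma gen_neq_one: "s \<in> S \<Longrightarrow> s \<noteq> \<one>"
  using gens_order_two[of s] ord_eq_1[of s] by auto

lemma gen_cancel_left [simp]: "s \<in> S \<Longrightarrow> x \<in> carrier G \<Longrightarrow> s \<otimes> (s \<otimes> x) = x"
  by (simp flip: m_assoc)

lemma gen_cancel_right [simp]: "s \<in> S \<Longrightarrow> x \<in> carrier G \<Longrightarrow> x \<otimes> s \<otimes> s = x"
  by (simp add: m_assoc)

lemma word_eval_Nil [simp]: "word_eval G [] = \<one>"
  by (simp add: word_eval_def)

lemma word_eval_Cons [simp]: "word_eval G (s # ws) = s \<otimes> word_eval G ws"
  by (simp add: word_eval_def)

lemma word_eval_closed [simp]: "ws \<in> lists S \<Longrightarrow> word_eval G ws \<in> carrier G"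
  by (induction ws) auto

lemma word_eval_append:
  "us \<in> lists S \<Longrightarrow> vs \<in> lists S \<Longrightarrow> word_eval G (us @ vs) = word_eval G us \<otimes> word_eval G vs"
  by (induction us) (auto simp: m_assoc)

lemma word_eval_rev: "ws \<in> lists S \<Longrightarrow> word_eval G (rev ws) = inv (word_eval G ws)"
proof (induction ws)
  case (Cons s ws)
  then have "s \<in> S" "ws \<in> lists S" "rev ws \<in> lists S" by auto
  then show ?case
    using Cons.IH word_eval_closed[of ws] by (simp add: word_eval_append[of "rev ws" "[s]"] inv_mult_group)
qed simp

lemma generate_word:
  assumes "J \<subseteq> S" "w \<in> generate G J"
  shows "\<exists>ws \<in> lists J. word_eval G ws = w"
  using assms(2)
proof induction
  case one
  show ?case by (rule bexI[of _ "[]"]) auto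
next
  case (incl h)
  then show ?case using assms(1) by (intro bexI[of _ "[h]"]) auto
next
  case (inv h)
  then show ?case using assms(1) by (intro bexI[of _ "[h]"]) (auto simp: subset_iff)
next
  case (eng h1 h2)
  then obtain us vs where "us \<in> lists J" "vs \<in> lists J" "word_eval G us = h1" "word_eval G vs = h2"
    by auto
  then show ?case using assms(1)
    by (intro bexI[of _ "us @ vs"]) (auto simp: word_eval_append subset_iff in_lists_conv_set)
qed

lemma word_exists: "w \<in> carrier G \<Longrightarrow> \<exists>ws \<in> lists S. word_eval G ws = w"
  using generate_word[of S w] gens_generate by auto

lemma len_word_eval: "ws \<in> lists S \<Longrightarrow> len (word_eval G ws) \<le> length ws"
  unfolding cox_length_def by (rule Least_le) auto

lemma reduced_word:
  assumes "w \<in> carrier G"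
  obtains ws where "ws \<in> lists S" "length ws = len w" "word_eval G ws = w"
proof -
  have "\<exists>n. \<exists>ws\<in>lists S. length ws = n \<and> word_eval G ws = w"
    using word_exists[OF assms] by auto
  from LeastI_ex[OF this] show ?thesis
    unfolding cox_length_def[symmetric] using that by blast
qed

lemma len_one [simp]: "len \<one> = 0"
  using len_word_eval[of "[]"] by simp

lemma len_eq_0_iff: "w \<in> carrier G \<Longrightarrow> len w = 0 \<longleftrightarrow> w = \<one>"
  by (metis len_one length_0_conv reduced_word word_eval_Nil)

lemma len_mult_le:
  assumes "x \<in> carrier G" "y \<in> carrier G"
  shows "len (x \<otimes> y) \<le> len x + len y"
proof -
  obtain us where us: "us \<in> lists S" "length us = len x" "word_eval G us = x"
    using reduced_word[OF assms(1)] .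
  obtain vs where vs: "vs \<in> lists S" "length vs = len y" "word_eval G vs = y"
    using reduced_word[OF assms(2)] .
  show ?thesis
    using len_word_eval[of "us @ vs"] us vs by (simp add: word_eval_append)
qed

lemma len_inv_le: "x \<in> carrier G \<Longrightarrow> len (inv x) \<le> len x"
  by (metis word_eval_rev reduced_word len_word_eval length_rev in_lists_conv_set set_rev)

lemma len_inv [simp]: "x \<in> carrier G \<Longrightarrow> len (inv x) = len x"
  by (metis antisym inv_closed inv_inv len_inv_le)

section \<open>Parity of the length and descents\<close>

lemma equivclp_invariant:
  assumes "equivclp r a b" and "\<And>x y. r x y \<Longrightarrow> f x = f y"
  shows "f a = f b"
  using assms(1) by (induction rule: equivclp_induct) (auto dest: assms(2))

text \<open>Every relator has even length, so the parity of a word's length is constant on the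
  classes of the presentation. Multiplication by a generator therefore always changes the
  length.\<close>

lemma even_len_word_eval:
  assumes "ws \<in> lists S"
  shows "even (len (word_eval G ws)) \<longleftrightarrow> even (length ws)"
proof -
  obtain us where us: "us \<in> lists S" "length us = len (word_eval G ws)" "word_eval G us = word_eval G ws"
    using reduced_word[of "word_eval G ws"] assms by auto
  then have "equivclp (cox_step G S) us ws"
    using presentation[of us ws] assms by simp
  then have "even (length us) = even (length ws)"
    by (rule equivclp_invariant) (auto elim!: cox_step.cases simp: length_concat sum_list_replicate)
  then show ?thesis using us by simp
qed

lemma even_len_mult:
  assumes "x \<in> carrier G" "y \<in> carrier G"
  shows "even (len (x \<otimes> y)) \<longleftrightarrow> even (len x + len y)"
proof -
  obtain us where us: "us \<in> lists S" "length us = len x" "word_eval G us = x"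
    using reduced_word[OF assms(1)] .
  obtain vs where vs: "vs \<in> lists S" "length vs = len y" "word_eval G vs = y"
    using reduced_word[OF assms(2)] .
  show ?thesis
    using even_len_word_eval[of "us @ vs"] us vs by (simp add: word_eval_append)
qed

lemma len_gen [simp]:
  assumes "s \<in> S"
  shows "len s = 1"
proof -
  have "len s \<le> 1" using len_word_eval[of "[s]"] assms by simp
  moreover have "len s \<noteq> 0" using len_eq_0_iff[of s] gen_neq_one[OF assms] assms by simp
  ultimately show ?thesis by simp
qed

lemma len_gen_mult_cases:
  assumes "s \<in> S" "w \<in> carrier G"
  shows "len (s \<otimes> w) = len w + 1 \<or> len w = len (s \<otimes> w) + 1"
proof -
  have "len (s \<otimes> w) \<le> 1 + len w" using len_mult_le[of s w] assms by simp
  moreover have "len w \<le> 1 + len (s \<otimes> w)" using len_mult_le[of s "s \<otimes> w"] assms by simp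
  moreover have "even (len (s \<otimes> w)) \<longleftrightarrow> even (1 + len w)" using even_len_mult[of s w] assms by simp
  ultimately show ?thesis by presburger
qed

lemma len_mult_gen: "s \<in> S \<Longrightarrow> w \<in> carrier G \<Longrightarrow> len (w \<otimes> s) = len (s \<otimes> inv w)"
  using len_inv[of "w \<otimes> s"] by (simp add: inv_mult_group)

lemma len_mult_gen_cases:
  assumes "s \<in> S" "w \<in> carrier G"
  shows "len (w \<otimes> s) = len w + 1 \<or> len w = len (w \<otimes> s) + 1"
  using len_gen_mult_cases[of s "inv w"] assms by (simp add: len_mult_gen)

lemma left_descent_exists:
  assumes "w \<in> carrier G" "w \<noteq> \<one>"
  obtains s where "s \<in> S" "len w = len (s \<otimes> w) + 1"
proof -
  obtain ws where ws: "ws \<in> lists S" "length ws = len w" "word_eval G ws = w"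
    using reduced_word[OF assms(1)] .
  with assms(2) obtain s vs where vs: "ws = s # vs" by (cases ws) auto
  with ws have "s \<in> S" "vs \<in> lists S" "w = s \<otimes> word_eval G vs" by auto
  then have "s \<in> S" "s \<otimes> w = word_eval G vs" "vs \<in> lists S" using word_eval_closed[of vs] by simp_all
  moreover have "len (s \<otimes> w) \<le> length vs"
    using len_word_eval[of vs] calculation by simp
  ultimately show ?thesis
    using that[of s] len_gen_mult_cases[of s w] assms(1) ws(2) vs by auto
qed

lemma right_descent_exists:
  assumes "w \<in> carrier G" "w \<noteq> \<one>"
  obtains s where "s \<in> S" "len w = len (w \<otimes> s) + 1"
proof -
  have "inv w \<noteq> \<one>"
    using assms inv_eq_1_iff by blast
  then obtain s where "s \<in> S" "len (inv w) = len (s \<otimes> inv w) + 1"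
    using left_descent_exists[of "inv w"] assms(1) inv_closed by blast
  then show ?thesis
    using that[of s] assms(1) by (simp add: len_mult_gen)
qed


section \<open>The reflection representation\<close>

lemma cox_order_commute: "s \<in> S \<Longrightarrow> t \<in> S \<Longrightarrow> cox_order G s t = cox_order G t s"
  unfolding cox_order_def using ord_inv[of "s \<otimes> t"] by (simp add: inv_mult_group)

lemma cox_order_self [simp]: "s \<in> S \<Longrightarrow> cox_order G s s = 1"
  by (simp add: cox_order_def)

lemma cox_order_neq_1:
  assumes "s \<in> S" "t \<in> S" "s \<noteq> t"
  shows "cox_order G s t \<noteq> 1"
proof
  assume "cox_order G s t = 1"
  then have "s \<otimes> t = \<one>" using assms ord_eq_1[of "s \<otimes> t"] by (simp add: cox_order_def)
  then have "inv t = s" using assms by (intro inv_equality) auto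
  then show False using assms gen_inv[of t] by simp
qed

definition gram :: "'a \<Rightarrow> 'a \<Rightarrow> real" where
  "gram s t = (if cox_order G s t = 0 then - 1 else - cos (pi / real (cox_order G s t)))"

lemma form_gram: "form u v = (\<Sum>s\<in>S. \<Sum>t\<in>S. u s * v t * gram s t)"
  by (simp add: cox_form_def gram_def)

lemma gram_commute: "s \<in> S \<Longrightarrow> t \<in> S \<Longrightarrow> gram s t = gram t s"
  by (simp add: gram_def cox_order_commute)

lemma gram_self [simp]: "s \<in> S \<Longrightarrow> gram s s = 1"
  by (simp add: gram_def)

lemma gram_nonpos:
  assumes "s \<in> S" "t \<in> S" "s \<noteq> t"
  shows "gram s t \<le> 0"
proof (cases "cox_order G s t = 0")
  case True
  then show ?thesis by (simp add: gram_def)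
next
  case False
  then have "cox_order G s t \<ge> 2" using cox_order_neq_1[OF assms] by simp
  then have "pi / real (cox_order G s t) \<le> pi / 2" by (intro divide_left_mono) auto
  moreover have "0 \<le> pi / real (cox_order G s t)" by simp
  ultimately have "0 \<le> cos (pi / real (cox_order G s t))"
    by (intro cos_ge_zero) linarith+
  then show ?thesis using False by (simp add: gram_def)
qed

lemma form_commute: "form u v = form v u"
proof -
  have "form u v = (\<Sum>t\<in>S. \<Sum>s\<in>S. u s * v t * gram s t)"
    unfolding form_gram by (rule sum.swap)
  also have "\<dots> = form v u"
    unfolding form_gram by (intro sum.cong refl) (simp add: gram_commute)
  finally show ?thesis .
qed

lemma form_lincomb_left: "form (\<lambda>t. a * u t + b * v t) x = a * form u x + b * form v x"
  by (simp add: form_gram algebra_simps sum.distrib sum_distrib_left)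

lemma form_lincomb_right: "form x (\<lambda>t. a * u t + b * v t) = a * form x u + b * form x v"
  by (simp add: form_gram algebra_simps sum.distrib sum_distrib_left)

lemma form_simple_right: "t \<in> S \<Longrightarrow> form v (simple_root t) = (\<Sum>s\<in>S. v s * gram s t)"
  unfolding form_gram simple_root_def
  by (intro sum.cong refl) (simp add: finite_gens if_distrib[of "\<lambda>x. x * _"] if_distrib[of "\<lambda>x. _ * x"] cong: if_cong)

lemma form_simple_simple: "s \<in> S \<Longrightarrow> t \<in> S \<Longrightarrow> form (simple_root s) (simple_root t) = gram s t"
  by (simp add: form_simple_right)
     (simp add: simple_root_def finite_gens if_distrib[of "\<lambda>x. x * _"] cong: if_cong)

lemma form_expand: "form u v = (\<Sum>s\<in>S. u s * form v (simple_root s))"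
proof -
  have "form u v = form v u" by (rule form_commute)
  also have "\<dots> = (\<Sum>t\<in>S. \<Sum>s\<in>S. v s * u t * gram s t)"
    unfolding form_gram by (rule sum.swap)
  also have "\<dots> = (\<Sum>t\<in>S. u t * form v (simple_root t))"
    by (intro sum.cong refl) (simp add: form_simple_right sum_distrib_left algebra_simps)
  finally show ?thesis .
qed

section \<open>Simple reflections and the defining relations\<close>

abbreviation srefl :: "'a \<Rightarrow> 'a root_vec \<Rightarrow> 'a root_vec" where "srefl \<equiv> simple_refl G S"

lemma srefl_lincomb: "srefl s (\<lambda>t. a * u t + b * v t) = (\<lambda>t. a * srefl s u t + b * srefl s v t)"
  by (rule ext) (simp add: simple_refl_def form_lincomb_left algebra_simps)

lemma form_srefl_srefl:
  assumes "s \<in> S"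
  shows "form (srefl s u) (srefl s v) = form u v"
proof -
  have r: "srefl s u = (\<lambda>t. 1 * u t + (- 2 * form u (simple_root s)) * simple_root s t)" for u
    by (simp add: simple_refl_def fun_eq_iff)
  show ?thesis
    unfolding r form_lincomb_left form_lincomb_right
    using form_commute[of "simple_root s" v] by (simp add: form_simple_simple assms)
qed

lemma form_srefl_self: "s \<in> S \<Longrightarrow> form (srefl s v) (simple_root s) = - form v (simple_root s)"
proof -
  assume s: "s \<in> S"
  have r: "srefl s v = (\<lambda>t. 1 * v t + (- 2 * form v (simple_root s)) * simple_root s t)"
    by (simp add: simple_refl_def fun_eq_iff)
  show ?thesis unfolding r form_lincomb_left by (simp add: s form_simple_simple)
qed

lemma srefl_srefl [simp]:
  assumes "s \<in> S"
  shows "srefl s (srefl s v) = v"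
proof
  fix t
  have "srefl s (srefl s v) t = srefl s v t + 2 * form v (simple_root s) * simple_root s t"
    unfolding simple_refl_def[of G S s "srefl s v"] form_srefl_self[OF assms] by simp
  also have "\<dots> = v t" by (simp add: simple_refl_def)
  finally show "srefl s (srefl s v) t = v t" .
qed

text \<open>
  The vector \<open>v\<close> splits as a part orthogonal to \<open>\<alpha>\<^sub>s, \<alpha>\<^sub>t\<close>, which is fixed, and a part in their
  plane, on which \<open>s t\<close> rotates by \<open>2 \<pi> / m\<close>.
\<close>

lemma srefl_braid_power:
  assumes s: "s \<in> S" and t: "t \<in> S" and m: "cox_order G s t \<noteq> 0"
  shows "((srefl s \<circ> srefl t) ^^ cox_order G s t) v = v"
proof (cases "s = t")
  case True
  then show ?thesis using s by simp
next
  case False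
  define m where "m = cox_order G s t"
  define \<theta> where "\<theta> = pi / real m"
  define c where "c = cos \<theta>"
  have m2: "real m \<ge> 2" using m cox_order_neq_1[OF s t False] by (simp add: m_def)
  have "0 < \<theta>" "\<theta> < pi" using m2 by (auto simp: \<theta>_def field_simps)
  then have s0: "sin \<theta> > 0" by (rule sin_gt_zero)
  have sc: "1 - c\<^sup>2 = (sin \<theta>)\<^sup>2" by (simp add: c_def sin_squared_eq)
  have nz: "1 - c\<^sup>2 \<noteq> 0" using s0 sc by simp
  have g: "gram s t = - c" "gram t s = - c"
    using m gram_commute[OF s t] by (auto simp: gram_def m_def \<theta>_def c_def)
  let ?a = "form v (simple_root s)" and ?b = "form v (simple_root t)"
  \<comment> \<open>\<open>p\<close> and \<open>q\<close> are the coordinates of the orthogonal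
    projection of \<open>v\<close> to the plane of the two simple roots, as \<open>ab\<close>
    confirms. The Gram determinant \<open>1 - c\<^sup>2\<close> of that plane is nonzero.\<close>
  define p q where "p = (?a + c * ?b) / (1 - c\<^sup>2)" and "q = (?b + c * ?a) / (1 - c\<^sup>2)"
  define comb where "comb P Q = (\<lambda>x. v x + P * simple_root s x + Q * simple_root t x)" for P Q
  have comb_alt: "comb P Q = (\<lambda>x. 1 * v x + 1 * (P * simple_root s x + Q * simple_root t x))" for P Q
    by (simp add: comb_def fun_eq_iff)
  have fs: "form (comb P Q) (simple_root s) = ?a + P - c * Q"
    and ft: "form (comb P Q) (simple_root t) = ?b - c * P + Q" for P Q
    unfolding comb_alt form_lincomb_left by (simp_all add: form_simple_simple s t g)
  have rs: "srefl s (comb P Q) = comb (- P + 2 * c * Q - 2 * ?a) Q" for P Q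
    by (rule ext) (simp add: simple_refl_def fs, simp add: comb_def algebra_simps)
  have rt: "srefl t (comb P Q) = comb P (- Q + 2 * c * P - 2 * ?b)" for P Q
    by (rule ext) (simp add: simple_refl_def ft, simp add: comb_def algebra_simps)
  have ab: "?a = p - c * q" "?b = q - c * p"
  proof -
    have "p * (1 - c\<^sup>2) = ?a + c * ?b" "q * (1 - c\<^sup>2) = ?b + c * ?a"
      using nz by (simp_all add: p_def q_def)
    then have "?a * (1 - c\<^sup>2) = (p - c * q) * (1 - c\<^sup>2)" "?b * (1 - c\<^sup>2) = (q - c * p) * (1 - c\<^sup>2)"
      by (simp_all only: left_diff_distrib mult.assoc) (simp_all add: algebra_simps power2_eq_square)
    then show "?a = p - c * q" "?b = q - c * p" using nz by simp_all
  qed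
  \<comment> \<open>The coordinates of this projection after \<open>k\<close> applications of
    \<open>s t\<close>, which rotates by 2 \<theta>.\<close>
  define PP QQ where
    "PP k = (p * sin (2 * real k * \<theta> + \<theta>) - q * sin (2 * real k * \<theta>)) / sin \<theta>" and
    "QQ k = (p * sin (2 * real k * \<theta>) - q * sin (2 * real k * \<theta> - \<theta>)) / sin \<theta>" for k
  have T: "((srefl s \<circ> srefl t) ^^ k) v = comb (PP k - p) (QQ k - q)" for k
  proof (induction k)
    case 0
    then show ?case using s0 by (simp add: comb_def PP_def QQ_def)
  next
    case (Suc k)
    define x where "x = 2 * real k * \<theta>"
    have tri: "sin (y + \<theta>) = 2 * c * sin y - sin (y - \<theta>)" for y
      by (simp add: c_def sin_add sin_diff)
    have e1: "sin (x + 2 * \<theta>) = 2 * c * sin (x + \<theta>) - sin x"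
      using tri[of "x + \<theta>"] by (simp add: algebra_simps)
    have e2: "sin (x + 3 * \<theta>) = 2 * c * sin (x + 2 * \<theta>) - sin (x + \<theta>)"
      using tri[of "x + 2 * \<theta>"] by (simp add: algebra_simps)
    note e3 = tri[of x]
    have SP: "PP (Suc k) = (p * sin (x + 3 * \<theta>) - q * sin (x + 2 * \<theta>)) / sin \<theta>"
      and SQ: "QQ (Suc k) = (p * sin (x + 2 * \<theta>) - q * sin (x + \<theta>)) / sin \<theta>"
      by (simp_all add: PP_def QQ_def x_def algebra_simps)
    have Pk: "PP k = (p * sin (x + \<theta>) - q * sin x) / sin \<theta>"
      and Qk: "QQ k = (p * sin x - q * sin (x - \<theta>)) / sin \<theta>"
      by (simp_all add: PP_def QQ_def x_def)
    have Q': "QQ (Suc k) = 2 * c * PP k - QQ k"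
      unfolding SQ Pk Qk e1 e3 by (simp add: diff_divide_distrib add_divide_distrib algebra_simps)
    have "2 * c * QQ (Suc k) - PP k = PP (Suc k)"
      unfolding SP SQ Pk e2 e1 by (simp add: diff_divide_distrib add_divide_distrib algebra_simps)
    note P' = this[symmetric]
    have "((srefl s \<circ> srefl t) ^^ Suc k) v = srefl s (srefl t (comb (PP k - p) (QQ k - q)))"
      by (simp only: funpow.simps o_apply Suc.IH)
    also have "\<dots> = comb (PP (Suc k) - p) (QQ (Suc k) - q)"
      unfolding rs rt P' Q' ab by (simp add: algebra_simps)
    finally show ?case .
  qed
  \<comment> \<open>After \<open>m\<close> steps the rotation is a full turn.\<close>
  have m\<theta>: "2 * real m * \<theta> = 2 * pi" using m2 by (simp add: \<theta>_def)
  have "PP m = p" "QQ m = q"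
    unfolding PP_def QQ_def m\<theta> using s0 by (simp_all add: sin_add sin_diff)
  then show ?thesis using T[of m] by (simp add: comb_def m_def)
qed

text \<open>A relator acts trivially by \<open>srefl_braid_power\<close>, so deleting it leaves the
  composite unchanged. This makes \<open>root_act\<close> independent of the chosen word.\<close>

lemma foldr_srefl_cox_step:
  assumes "cox_step G S us vs"
  shows "foldr srefl us = foldr srefl vs"
  using assms
proof cases
  case (1 s t xs ys)
  have "foldr srefl (concat (replicate n [s, t])) v = ((srefl s \<circ> srefl t) ^^ n) v" for n v
    by (induction n) auto
  then have "foldr srefl (concat (replicate (cox_order G s t) [s, t])) v = v" for v
    using srefl_braid_power[OF 1(3-5)] by simp
  then have "foldr srefl us v = foldr srefl vs v" for v
    by (simp add: 1(1,2))
  then show ?thesis by (rule ext)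
qed

section \<open>The linear action of the group\<close>

lemma act_word_eval:
  assumes "ws \<in> lists S"
  shows "act (word_eval G ws) v = foldr srefl ws v"
proof -
  let ?us = "SOME us. us \<in> lists S \<and> word_eval G us = word_eval G ws"
  have us: "?us \<in> lists S \<and> word_eval G ?us = word_eval G ws"
    by (rule someI[of _ ws]) (use assms in auto)
  then have "equivclp (cox_step G S) ?us ws"
    using presentation[of ?us ws] assms by simp
  then have "foldr srefl ?us = foldr srefl ws"
    by (rule equivclp_invariant) (rule foldr_srefl_cox_step)
  then show ?thesis by (simp add: root_act_def)
qed

lemma act_one [simp]: "act \<one> v = v"
  using act_word_eval[of "[]"] by simp

lemma act_gen: "s \<in> S \<Longrightarrow> act s v = srefl s v"
  using act_word_eval[of "[s]"] by simp

lemma act_mult: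
  assumes "x \<in> carrier G" "y \<in> carrier G"
  shows "act (x \<otimes> y) v = act x (act y v)"
proof -
  obtain us where "us \<in> lists S" "word_eval G us = x" using word_exists[OF assms(1)] by auto
  moreover obtain vs where "vs \<in> lists S" "word_eval G vs = y" using word_exists[OF assms(2)] by auto
  ultimately show ?thesis
    using act_word_eval[of "us @ vs" v] act_word_eval[of us] act_word_eval[of vs]
    by (auto simp: word_eval_append)
qed

lemma act_inv_act [simp]: "x \<in> carrier G \<Longrightarrow> act (inv x) (act x v) = v"
  by (simp flip: act_mult)

lemma act_act_inv [simp]: "x \<in> carrier G \<Longrightarrow> act x (act (inv x) v) = v"
  by (simp flip: act_mult)

lemma act_lincomb:
  assumes "w \<in> carrier G"
  shows "act w (\<lambda>t. a * u t + b * v t) = (\<lambda>t. a * act w u t + b * act w v t)"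
proof -
  obtain ws where ws: "ws \<in> lists S" "word_eval G ws = w" using word_exists[OF assms] by auto
  have "foldr srefl ws (\<lambda>t. a * u t + b * v t) = (\<lambda>t. a * foldr srefl ws u t + b * foldr srefl ws v t)"
    using ws(1) by (induction ws) (auto simp: srefl_lincomb)
  then show ?thesis using act_word_eval[OF ws(1)] ws(2) by simp
qed

lemma act_uminus: "w \<in> carrier G \<Longrightarrow> act w (\<lambda>t. - v t) = (\<lambda>t. - act w v t)"
  using act_lincomb[of w "-1" v 0 v] by simp

lemma act_zero: "w \<in> carrier G \<Longrightarrow> act w (\<lambda>t. 0) = (\<lambda>t. 0)"
  using act_lincomb[of w 0 "\<lambda>t. 0" 0 "\<lambda>t. 0"] by simp

lemma act_sum:
  assumes "w \<in> carrier G" "finite I"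
  shows "act w (\<lambda>t. \<Sum>i\<in>I. c i * v i t) = (\<lambda>t. \<Sum>i\<in>I. c i * act w (v i) t)"
  using assms(2)
proof (induction rule: finite_induct)
  case empty
  then show ?case using act_zero[OF assms(1)] by simp
next
  case (insert i I)
  have "act w (\<lambda>t. \<Sum>i\<in>insert i I. c i * v i t) = act w (\<lambda>t. c i * v i t + 1 * (\<Sum>i\<in>I. c i * v i t))"
    using insert by simp
  also have "\<dots> = (\<lambda>t. \<Sum>i\<in>insert i I. c i * act w (v i) t)"
    unfolding act_lincomb[OF assms(1)] using insert by simp
  finally show ?case .
qed

lemma form_act_act:
  assumes "w \<in> carrier G"
  shows "form (act w u) (act w v) = form u v"
proof -
  obtain ws where ws: "ws \<in> lists S" "word_eval G ws = w" using word_exists[OF assms] by auto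
  have "form (foldr srefl ws u) (foldr srefl ws v) = form u v"
    using ws(1) by (induction ws) (auto simp: form_srefl_srefl)
  then show ?thesis using act_word_eval[OF ws(1)] ws(2) by simp
qed

lemma form_act_left: "w \<in> carrier G \<Longrightarrow> form (act w u) v = form u (act (inv w) v)"
  using form_act_act[of "inv w" "act w u" v] by simp

section \<open>Positive and negative roots\<close>

text \<open>A linear functional that is positive on positive roots and negative on negative ones.
  The sign of a root thus becomes the sign of one number.\<close>

definition height :: "'a root_vec \<Rightarrow> real" where
  "height v = (\<Sum>s\<in>S. v s)"

lemma height_lincomb: "height (\<lambda>t. a * u t + b * v t) = a * height u + b * height v"
  by (simp add: height_def sum.distrib sum_distrib_left)

lemma height_uminus [simp]: "height (\<lambda>t. - v t) = - height v"
  by (simp add: height_def sum_negf)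

lemma height_simple [simp]: "s \<in> S \<Longrightarrow> height (simple_root s) = 1"
  by (simp add: height_def simple_root_def finite_gens)

lemma height_act_lincomb:
  "w \<in> carrier G \<Longrightarrow>
    height (act w (\<lambda>t. a * u t + b * v t)) = a * height (act w u) + b * height (act w v)"
  by (simp add: act_lincomb height_lincomb)

lemma form_zero: "(\<And>s. s \<in> S \<Longrightarrow> v s = 0) \<Longrightarrow> form v v = 0"
  by (simp add: form_gram)

text \<open>A simple reflection changes only its own coordinate.\<close>

lemma act_off_subset:
  assumes J: "J \<subseteq> S" and w: "w \<in> generate G J" and t: "t \<notin> J"
  shows "act w v t = v t"
proof -
  obtain ws where ws: "ws \<in> lists J" "word_eval G ws = w" using generate_word[OF J w] by auto
  have "foldr srefl ws v t = v t" using ws(1)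
    by (induction ws) (use t in \<open>auto simp: simple_refl_def simple_root_def\<close>)
  moreover have "ws \<in> lists S" using ws(1) J by auto
  ultimately show ?thesis using act_word_eval[of ws v] ws(2) by simp
qed

lemma act_off: "w \<in> carrier G \<Longrightarrow> t \<notin> S \<Longrightarrow> act w v t = v t"
  by (rule act_off_subset[of S]) (auto simp: gens_generate)

lemma simple_root_nonneg [simp]: "0 \<le> simple_root s t"
  by (simp add: simple_root_def)

lemma srefl_self: "s \<in> S \<Longrightarrow> srefl s (simple_root s) = (\<lambda>x. - simple_root s x)"
  by (rule ext) (simp add: simple_refl_def form_simple_simple)

lemma srefl_simple:
  "s \<in> S \<Longrightarrow> t \<in> S \<Longrightarrow> srefl s (simple_root t) = (\<lambda>x. simple_root t x - 2 * gram t s * simple_root s x)"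
  by (rule ext) (simp add: simple_refl_def form_simple_simple)

end

section \<open>Alternating words and dihedral subgroups\<close>

text \<open>The alternating word of length \<open>n\<close> in \<open>s, t\<close> that ends in \<open>t\<close>.\<close>

primrec alt_word :: "'a \<Rightarrow> 'a \<Rightarrow> nat \<Rightarrow> 'a list" where
  "alt_word s t 0 = []"
| "alt_word s t (Suc n) = (if even n then t else s) # alt_word s t n"

lemma length_alt_word [simp]: "length (alt_word s t n) = n"
  by (induction n) auto

lemma alt_word_in_lists: "s \<in> S \<Longrightarrow> t \<in> S \<Longrightarrow> alt_word s t n \<in> lists S"
  by (induction n) auto

lemma alt_word_Suc_append: "alt_word s t (Suc n) = alt_word t s n @ [t]"
  by (induction n) auto

lemma alt_word_split: "\<exists>us. alt_word s t (k + n) = us @ alt_word s t n"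
  by (induction k) auto

text \<open>Chebyshev recursion: the coefficients of \<open>w \<alpha>\<^sub>s\<close> for alternating \<open>w\<close>, where \<open>g = \<langle>\<alpha>\<^sub>s, \<alpha>\<^sub>t\<rangle>\<close>.\<close>

fun dihedral_coeff :: "real \<Rightarrow> nat \<Rightarrow> real" where
  "dihedral_coeff g 0 = 0"
| "dihedral_coeff g (Suc 0) = 1"
| "dihedral_coeff g (Suc (Suc n)) = - 2 * g * dihedral_coeff g (Suc n) - dihedral_coeff g n"

lemma dihedral_coeff_infinite: "dihedral_coeff (- 1) n = real n"
  by (induction "- 1 :: real" n rule: dihedral_coeff.induct) auto

text \<open>The values \<open>sin (n * \<theta>)\<close> obey the same three-term recursion.\<close>

lemma dihedral_coeff_finite:
  assumes "sin \<theta> \<noteq> 0"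
  shows "dihedral_coeff (- cos \<theta>) n = sin (real n * \<theta>) / sin \<theta>"
proof (induction "- cos \<theta>" n rule: dihedral_coeff.induct)
  case (3 n)
  define y where "y = real (Suc n) * \<theta>"
  have "sin (y + \<theta>) = 2 * cos \<theta> * sin y - sin (y - \<theta>)" by (simp add: sin_add sin_diff)
  moreover have "y + \<theta> = real (Suc (Suc n)) * \<theta>" "y - \<theta> = real n * \<theta>"
    by (simp_all add: y_def algebra_simps)
  ultimately have "sin (real (Suc (Suc n)) * \<theta>) = 2 * cos \<theta> * sin (real (Suc n) * \<theta>) - sin (real n * \<theta>)"
    by (simp add: y_def)
  then show ?case using 3 by (simp only: dihedral_coeff.simps) (simp add: diff_divide_distrib)
qed (use assms in auto)

context finite_coxeter_system
begin

text \<open>For finite order \<open>m\<close> and \<open>n \<le> m\<close> the angle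
  \<open>n * pi / m\<close> stays in the interval from 0 to \<open>pi\<close>, where the sine is
  nonnegative. For infinite order the coefficient is \<open>n\<close>.\<close>

lemma dihedral_coeff_nonneg:
  assumes "s \<in> S" "t \<in> S" "s \<noteq> t" "cox_order G s t = 0 \<or> n \<le> cox_order G s t"
  shows "0 \<le> dihedral_coeff (gram s t) n"
proof (cases "cox_order G s t = 0")
  case True
  then show ?thesis by (simp add: gram_def dihedral_coeff_infinite)
next
  case False
  define m where "m = cox_order G s t"
  define \<theta> where "\<theta> = pi / real m"
  have m: "2 \<le> m" using False cox_order_neq_1[OF assms(1-3)] by (simp add: m_def)
  then have "0 < \<theta>" "\<theta> < pi" by (auto simp: \<theta>_def field_simps)
  then have s0: "sin \<theta> > 0" by (rule sin_gt_zero)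
  have "real n * \<theta> \<le> real m * \<theta>"
    using False assms(4) \<open>0 < \<theta>\<close> by (intro mult_right_mono) (auto simp: m_def)
  also have "real m * \<theta> = pi" using m by (simp add: \<theta>_def)
  finally have "0 \<le> sin (real n * \<theta>)" using \<open>0 < \<theta>\<close> by (intro sin_ge_zero) auto
  then show ?thesis
    using s0 False by (simp add: gram_def dihedral_coeff_finite flip: m_def \<theta>_def)
qed

text \<open>Prepending a letter keeps the coefficient of index \<open>n + 1\<close> and replaces
  that of index \<open>n\<close> by the one of index \<open>n + 2\<close>; the parity of
  \<open>n\<close> tells which simple root carries which.\<close>

lemma foldr_alt_word:
  assumes s: "s \<in> S" and t: "t \<in> S"
  shows "foldr srefl (alt_word s t n) (simple_root s) = (\<lambda>x.
    dihedral_coeff (gram s t) (Suc n) * simple_root (if even n then s else t) x +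
    dihedral_coeff (gram s t) n * simple_root (if even n then t else s) x)"
proof (induction n)
  case 0
  then show ?case by simp
next
  case (Suc n)
  have step: "srefl b (\<lambda>x. p * simple_root a x + q * simple_root b x) =
      (\<lambda>x. (- 2 * gram s t * p - q) * simple_root b x + p * simple_root a x)"
    if "a = s \<and> b = t \<or> a = t \<and> b = s" for a b p q
    unfolding srefl_lincomb using that s t gram_commute[OF s t]
    by (auto simp: srefl_self srefl_simple algebra_simps)
  show ?case
    by (cases "even n") (simp_all only: alt_word.simps foldr_Cons o_apply Suc.IH even_Suc if_True if_False
      not_True_eq_False not_False_eq_True dihedral_coeff.simps step[OF disjI1, simplified] step[OF disjI2, simplified],
      simp_all)
qed

lemma pow_conjugate:
  assumes "s \<in> S" "t \<in> S"
  shows "t \<otimes> (s \<otimes> t) [^] (n::nat) \<otimes> s = (t \<otimes> s) [^] Suc n"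
proof (induction n)
  case 0
  then show ?case using assms by simp
next
  case (Suc n)
  have "t \<otimes> (s \<otimes> t) [^] Suc n \<otimes> s = (t \<otimes> (s \<otimes> t) [^] n \<otimes> s) \<otimes> (t \<otimes> s)"
    using assms by (simp add: m_assoc)
  also have "\<dots> = (t \<otimes> s) [^] Suc (Suc n)" unfolding Suc using assms by simp
  finally show ?case .
qed

text \<open>Passing to \<open>n + 1\<close> puts one generator in front and the other behind. By
  \<open>pow_conjugate\<close> this exchanges \<open>s\<close> and \<open>t\<close> and raises the
  exponent. At the order of \<open>s t\<close> the power is trivial, which gives the braid
  relation.\<close>

lemma alt_word_quotient:
  assumes s: "s \<in> S" and t: "t \<in> S"
  shows "word_eval G (alt_word s t n) \<otimes> inv (word_eval G (alt_word t s n)) =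
    (if even n then (s \<otimes> t) [^] n else (t \<otimes> s) [^] n)"
proof (induction n)
  case 0
  then show ?case by simp
next
  case (Suc n)
  define p q where "p = word_eval G (alt_word s t n)" and "q = word_eval G (alt_word t s n)"
  have c: "p \<in> carrier G" "q \<in> carrier G"
    using alt_word_in_lists[OF s t] alt_word_in_lists[OF t s] by (auto simp: p_def q_def)
  have "a \<otimes> p \<otimes> inv (b \<otimes> q) = a \<otimes> (p \<otimes> inv q) \<otimes> b" if "a \<in> S" "b \<in> S" for a b
    using that c by (simp add: inv_mult_group m_assoc)
  then show ?case
    using Suc s t pow_conjugate[OF s t, of n] pow_conjugate[OF t s, of n]
    by (cases "even n") (simp_all flip: p_def q_def)
qed

lemma alt_word_braid:
  assumes s: "s \<in> S" and t: "t \<in> S"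
  shows "word_eval G (alt_word s t (cox_order G s t)) = word_eval G (alt_word t s (cox_order G s t))"
proof -
  have "(s \<otimes> t) [^] cox_order G s t = \<one>" "(t \<otimes> s) [^] cox_order G s t = \<one>"
    using s t cox_order_commute[OF s t] by (simp_all add: cox_order_def pow_ord_eq_1)
      (metis cox_order_def gen_closed m_closed pow_ord_eq_1)
  then have "word_eval G (alt_word s t (cox_order G s t)) \<otimes>
      inv (word_eval G (alt_word t s (cox_order G s t))) = \<one>"
    using alt_word_quotient[OF s t, of "cox_order G s t"] by presburger
  moreover have "word_eval G (alt_word s t n) \<in> carrier G" "word_eval G (alt_word t s n) \<in> carrier G" for n
    using alt_word_in_lists[OF s t] alt_word_in_lists[OF t s] by auto
  ultimately show ?thesis using inv_equality inv_inv by (metis inv_closed)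
qed

text \<open>
  The maximal alternating suffix reduces \<open>w \<alpha>\<^sub>s \<ge> 0\<close> to a shorter element and a rank two computation.
\<close>

theorem act_simple_nonneg:
  assumes "w \<in> carrier G" "s \<in> S" "len (w \<otimes> s) = len w + 1" "r \<in> S"
  shows "0 \<le> act w (simple_root s) r"
  using assms
proof (induction "len w" arbitrary: w s rule: less_induct)
  case less
  note w = less.prems(1) and s = less.prems(2) and up = less.prems(3)
  show ?case
  proof (cases "w = \<one>")
    case True
    then show ?thesis by simp
  next
    case False
    then obtain t where t: "t \<in> S" and down: "len w = len (w \<otimes> t) + 1"
      using right_descent_exists[OF w] by blast
    have st: "s \<noteq> t" using up down by auto
    have alts: "alt_word s t n \<in> lists S" "alt_word t s n \<in> lists S" for n
      using alt_word_in_lists[OF s t] alt_word_in_lists[OF t s] by auto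
    \<comment> \<open>\<open>P n\<close> splits off an alternating suffix of length \<open>n\<close>
      with lengths adding. The word ends in the right descent \<open>t\<close>, so
      \<open>P 1\<close> holds; the largest such \<open>n\<close> is used.\<close>
    define P where "P n \<longleftrightarrow> (\<exists>v\<in>carrier G. w = v \<otimes> word_eval G (alt_word s t n) \<and> len w = len v + n)" for n
    have P1: "P 1" unfolding P_def
      by (rule bexI[of _ "w \<otimes> t"]) (use w t down in auto)
    have bound: "P n \<Longrightarrow> n \<le> len w" for n by (auto simp: P_def)
    define n where "n = (GREATEST n. P n)"
    have Pn: "P n" unfolding n_def by (rule GreatestI_nat[of P, OF P1]) (rule bound)
    have n_max: "P k \<Longrightarrow> k \<le> n" for k unfolding n_def by (rule Greatest_le_nat) (auto intro: bound)
    have n1: "1 \<le> n" using n_max[OF P1] .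
    obtain v where v: "v \<in> carrier G" and wv: "w = v \<otimes> word_eval G (alt_word s t n)" and lv: "len w = len v + n"
      using Pn by (auto simp: P_def)
    \<comment> \<open>\<open>x\<close> is the letter that would prolong the alternating suffix,
      \<open>y\<close> its first letter. Both lengthen \<open>v\<close>: for \<open>x\<close> by
      maximality of \<open>n\<close>, for \<open>y\<close> because otherwise \<open>w\<close> would
      have too short a word. Induction thus applies to \<open>v\<close> with either letter.\<close>
    define x where "x = (if even n then t else s)"
    define y where "y = (if even n then s else t)"
    have xy: "x \<in> S" "y \<in> S" using s t by (auto simp: x_def y_def)
    have "len (v \<otimes> x) = len v + 1"
    proof (rule ccontr)
      assume "len (v \<otimes> x) \<noteq> len v + 1"
      then have "len v = len (v \<otimes> x) + 1" using len_mult_gen_cases[OF xy(1) v] by simp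
      moreover have "w = (v \<otimes> x) \<otimes> word_eval G (alt_word s t (Suc n))"
        using wv v xy alts word_eval_closed[OF alts(1)] by (simp add: m_assoc flip: x_def)
      ultimately have "P (Suc n)" unfolding P_def using lv v xy by (intro bexI[of _ "v \<otimes> x"]) auto
      then show False using n_max by force
    qed
    then have vx: "0 \<le> act v (simple_root x) r"
      using less.hyps[of v x] lv n1 v xy less.prems(4) by simp
    have "len (v \<otimes> y) = len v + 1"
    proof (rule ccontr)
      assume "len (v \<otimes> y) \<noteq> len v + 1"
      then have l: "len v = len (v \<otimes> y) + 1" using len_mult_gen_cases[OF xy(2) v] by simp
      obtain k where k: "n = Suc k" using n1 by (cases n) auto
      then have "alt_word s t n = y # alt_word s t k" by (auto simp: y_def)
      then have "w = (v \<otimes> y) \<otimes> word_eval G (alt_word s t k)"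
        using wv v xy alts word_eval_closed[OF alts(1)] by (simp add: m_assoc)
      then have "len w \<le> len (v \<otimes> y) + k"
        using len_mult_le[of "v \<otimes> y" "word_eval G (alt_word s t k)"] len_word_eval[OF alts(1)[of k]] v xy alts
        by simp
      then show False using lv l k by simp
    qed
    then have vy: "0 \<le> act v (simple_root y) r"
      using less.hyps[of v y] lv n1 v xy less.prems(4) by simp
    \<comment> \<open>An alternating suffix as long as the order of \<open>s t\<close> could be
      rewritten to end in \<open>s\<close>, and then \<open>w \<otimes> s\<close> would be shorter
      than \<open>w\<close>.\<close>
    have n_small: "cox_order G s t = 0 \<or> n < cox_order G s t"
    proof (rule ccontr)
      assume "\<not> ?thesis"
      then obtain k m where m: "cox_order G s t = Suc m" and k: "n = k + Suc m"
        by (metis add.commute le_Suc_ex not_less not0_implies_Suc)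
      have "\<exists>us. alt_word s t n = us @ alt_word s t (Suc m)" unfolding k by (rule alt_word_split)
      then obtain us where us: "alt_word s t n = us @ alt_word s t (Suc m)" ..
      have usl: "us \<in> lists S" using alts(1)[of n] by (simp add: us)
      have lus: "length us = k" using arg_cong[OF us, of length] k by simp
      have "word_eval G (alt_word s t (Suc m)) = word_eval G (alt_word s t m) \<otimes> s"
        using alt_word_braid[OF s t] alts s by (simp add: m alt_word_Suc_append[of t s] word_eval_append del: alt_word.simps)
      then have "w \<otimes> s = v \<otimes> word_eval G (us @ alt_word s t m)"
        unfolding wv us using usl alts s v word_eval_closed[OF alts(1)[of m]] word_eval_closed[OF usl]
        by (simp add: word_eval_append m_assoc del: alt_word.simps)
      moreover have "len (word_eval G (us @ alt_word s t m)) \<le> k + m"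
        using len_word_eval[of "us @ alt_word s t m"] usl alts by (simp add: lus)
      ultimately have "len (w \<otimes> s) \<le> len v + (k + m)"
        using len_mult_le[OF v, of "word_eval G (us @ alt_word s t m)"] usl alts by simp
      then show False using up lv k by simp
    qed
    have "act w (simple_root s) = act v (\<lambda>x'. dihedral_coeff (gram s t) (Suc n) * simple_root y x' +
        dihedral_coeff (gram s t) n * simple_root x x')"
      unfolding wv using alts v s t by (simp add: act_mult act_word_eval foldr_alt_word x_def y_def)
    also have "\<dots> = (\<lambda>x'. dihedral_coeff (gram s t) (Suc n) * act v (simple_root y) x' +
        dihedral_coeff (gram s t) n * act v (simple_root x) x')"
      by (rule act_lincomb[OF v])
    finally have "act w (simple_root s) r = dihedral_coeff (gram s t) (Suc n) * act v (simple_root y) r +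
        dihedral_coeff (gram s t) n * act v (simple_root x) r"
      by simp
    moreover have "0 \<le> dihedral_coeff (gram s t) (Suc n)" "0 \<le> dihedral_coeff (gram s t) n"
      using n_small s t st by (auto intro!: dihedral_coeff_nonneg)
    ultimately show ?thesis using vx vy by simp
  qed
qed

section \<open>Roots and their signs\<close>

lemma rootI: "w \<in> carrier G \<Longrightarrow> s \<in> S \<Longrightarrow> act w (simple_root s) \<in> roots G S"
  by (auto simp: roots_def)

lemma rootE:
  assumes "\<beta> \<in> roots G S"
  obtains w s where "w \<in> carrier G" "s \<in> S" "\<beta> = act w (simple_root s)"
  using assms by (auto simp: roots_def)

lemma simple_in_roots: "s \<in> S \<Longrightarrow> simple_root s \<in> roots G S"
  using rootI[of \<one> s] by simp

lemma act_root:
  assumes "\<beta> \<in> roots G S" "w \<in> carrier G"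
  shows "act w \<beta> \<in> roots G S"
proof -
  obtain v s where "v \<in> carrier G" "s \<in> S" "\<beta> = act v (simple_root s)" using assms(1) by (rule rootE)
  then show ?thesis using rootI[of "w \<otimes> v" s] assms(2) by (simp add: act_mult)
qed

lemma act_descent:
  assumes "w \<in> carrier G" "s \<in> S"
  shows "act (w \<otimes> s) (simple_root s) = (\<lambda>t. - act w (simple_root s) t)"
  using assms by (simp add: act_mult act_gen srefl_self act_uminus)

lemma uminus_root:
  assumes "\<beta> \<in> roots G S"
  shows "(\<lambda>t. - \<beta> t) \<in> roots G S"
proof -
  obtain w s where "w \<in> carrier G" "s \<in> S" "\<beta> = act w (simple_root s)" using assms by (rule rootE)
  then show ?thesis using act_descent[of w s] rootI[of "w \<otimes> s" s] by simp
qed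

lemma root_off: "\<beta> \<in> roots G S \<Longrightarrow> t \<notin> S \<Longrightarrow> \<beta> t = 0"
  by (erule rootE) (auto simp: act_off simple_root_def)

lemma root_form: "\<beta> \<in> roots G S \<Longrightarrow> form \<beta> \<beta> = 1"
  by (erule rootE) (simp add: form_act_act form_simple_simple)

text \<open>One of \<open>w\<close> and \<open>w \<otimes> s\<close> is lengthened by
  \<open>s\<close>, and the roots they make from \<open>\<alpha>\<^sub>s\<close> are opposite, so
  \<open>act_simple_nonneg\<close> settles both cases.\<close>

lemma root_sign:
  assumes "\<beta> \<in> roots G S"
  shows "(\<forall>s\<in>S. 0 \<le> \<beta> s) \<or> (\<forall>s\<in>S. \<beta> s \<le> 0)"
proof -
  obtain w s where w: "w \<in> carrier G" "s \<in> S" "\<beta> = act w (simple_root s)" using assms by (rule rootE)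
  show ?thesis
  proof (cases "len (w \<otimes> s) = len w + 1")
    case True
    then show ?thesis using act_simple_nonneg[OF w(1,2)] w(3) by simp
  next
    case False
    then have "len (w \<otimes> s \<otimes> s) = len (w \<otimes> s) + 1" using len_mult_gen_cases[OF w(2,1)] w by simp
    then have "0 \<le> act (w \<otimes> s) (simple_root s) r" if "r \<in> S" for r
      using act_simple_nonneg[of "w \<otimes> s" s r] w that by simp
    then show ?thesis using act_descent[OF w(1,2)] w(3) by simp
  qed
qed

text \<open>Coefficients of one sign with sum zero all vanish, but a root has norm 1.\<close>

lemma root_height_nonzero:
  assumes "\<beta> \<in> roots G S"
  shows "height \<beta> \<noteq> 0"
proof
  assume h: "height \<beta> = 0"
  have "\<beta> s = 0" if "s \<in> S" for s
  proof (cases "\<forall>s\<in>S. 0 \<le> \<beta> s")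
    case True
    then show ?thesis using h that by (simp add: height_def finite_gens sum_nonneg_eq_0_iff)
  next
    case False
    then have "\<forall>s\<in>S. 0 \<le> - \<beta> s" using root_sign[OF assms] by auto
    moreover have "(\<Sum>s\<in>S. - \<beta> s) = 0" using h by (simp add: height_def sum_negf)
    ultimately show ?thesis using that finite_gens sum_nonneg_eq_0_iff[of S "\<lambda>s. - \<beta> s"] by simp
  qed
  then show False using form_zero[of \<beta>] root_form[OF assms] by simp
qed

lemma pos_root_iff: "\<beta> \<in> pos_roots G S \<longleftrightarrow> \<beta> \<in> roots G S \<and> 0 < height \<beta>"
proof
  assume "\<beta> \<in> pos_roots G S"
  then have "\<beta> \<in> roots G S" "0 \<le> height \<beta>" by (auto simp: pos_roots_def height_def intro: sum_nonneg)
  then show "\<beta> \<in> roots G S \<and> 0 < height \<beta>" using root_height_nonzero[of \<beta>] by simp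
next
  assume b: "\<beta> \<in> roots G S \<and> 0 < height \<beta>"
  then have "\<not> (\<forall>s\<in>S. \<beta> s \<le> 0)" unfolding height_def by (meson not_less sum_nonpos)
  then show "\<beta> \<in> pos_roots G S" using b root_sign[of \<beta>] by (auto simp: pos_roots_def)
qed

lemma neg_root_iff: "is_neg_root G S \<beta> \<longleftrightarrow> \<beta> \<in> roots G S \<and> height \<beta> < 0"
  using uminus_root[of "\<lambda>t. - \<beta> t"] uminus_root[of \<beta>] by (auto simp: is_neg_root_def pos_root_iff)

lemma pos_root_root: "\<beta> \<in> pos_roots G S \<Longrightarrow> \<beta> \<in> roots G S"
  and pos_root_height: "\<beta> \<in> pos_roots G S \<Longrightarrow> 0 < height \<beta>"
  by (simp_all add: pos_root_iff)

lemma pos_root_nonneg: "\<beta> \<in> pos_roots G S \<Longrightarrow> 0 \<le> \<beta> t"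
  by (cases "t \<in> S") (auto simp: pos_roots_def root_off)

lemma pos_root_posI:
  assumes "\<beta> \<in> roots G S" "t \<in> S" "0 < \<beta> t"
  shows "\<beta> \<in> pos_roots G S"
  using root_sign[OF assms(1)] assms by (auto simp: pos_roots_def dest: bspec[of _ _ t])

lemma simple_pos_root: "s \<in> S \<Longrightarrow> simple_root s \<in> pos_roots G S"
  by (simp add: pos_root_iff simple_in_roots)

text \<open>All roots have norm 1, so \<open>c * c = 1\<close>, and the positive heights exclude
  \<open>c = - 1\<close>.\<close>

lemma pos_root_proportional:
  assumes "\<beta> \<in> pos_roots G S" "\<gamma> \<in> pos_roots G S" "\<And>t. t \<in> S \<Longrightarrow> \<beta> t = c * \<gamma> t"
  shows "\<beta> = \<gamma>"
proof -
  have e: "\<beta> = (\<lambda>t. c * \<gamma> t + 0 * \<gamma> t)"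
    using assms root_off[OF pos_root_root] by (intro ext) (metis add.right_neutral mult_zero_left mult_zero_right)
  have "height \<beta> = c * height \<gamma>" using arg_cong[OF e, of height] height_lincomb[of c \<gamma> 0 \<gamma>] by simp
  then have "0 < c" using assms(1,2) by (metis pos_root_height zero_less_mult_pos2)
  have "form \<beta> \<beta> = c * (c * form \<gamma> \<gamma>)"
    using arg_cong[OF e, of "\<lambda>v. form v v"] form_lincomb_left[of c \<gamma> 0 \<gamma>] form_lincomb_right[of _ c \<gamma> 0 \<gamma>]
    by simp
  then have "c * c = 1" using root_form[OF pos_root_root] assms(1,2) by simp
  then have "c = 1" using \<open>0 < c\<close> using power2_eq_1_iff[of c] by (simp add: power2_eq_square)
  then show ?thesis using e by simp
qed

lemma pos_root_other_coeff:
  assumes "\<beta> \<in> pos_roots G S" "s \<in> S" "\<beta> \<noteq> simple_root s"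
  obtains t where "t \<in> S" "t \<noteq> s" "0 < \<beta> t"
proof -
  have "\<exists>t\<in>S. t \<noteq> s \<and> 0 < \<beta> t"
  proof (rule ccontr)
    assume "\<not> ?thesis"
    then have "\<beta> t = 0" if "t \<in> S" "t \<noteq> s" for t
      using pos_root_nonneg[OF assms(1), of t] that by force
    then have "\<beta> = simple_root s"
      by (intro pos_root_proportional[where c = "\<beta> s"])
        (use assms simple_pos_root in \<open>auto simp: simple_root_def\<close>)
    with assms(3) show False by simp
  qed
  with that show ?thesis by blast
qed

text \<open>The reflection alters only the coefficient at \<open>s\<close>. Some other coefficient
  is positive, survives, and decides the sign.\<close>

lemma gen_permutes_pos_roots:
  assumes "\<beta> \<in> pos_roots G S" "s \<in> S" "\<beta> \<noteq> simple_root s"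
  shows "act s \<beta> \<in> pos_roots G S"
proof -
  obtain t where t: "t \<in> S" "t \<noteq> s" "0 < \<beta> t" using pos_root_other_coeff[OF assms] .
  then have "0 < act s \<beta> t"
    using assms(2) by (simp add: act_gen simple_refl_def simple_root_def)
  then show ?thesis
    using pos_root_posI[OF act_root[OF pos_root_root[OF assms(1)]] t(1)] assms(2) by simp
qed


section \<open>Inversion sets\<close>

definition inversions :: "'a \<Rightarrow> 'a root_vec set" where
  "inversions w = {\<beta> \<in> pos_roots G S. height (act (inv w) \<beta>) < 0}"

lemma inversionsI: "\<beta> \<in> pos_roots G S \<Longrightarrow> height (act (inv w) \<beta>) < 0 \<Longrightarrow> \<beta> \<in> inversions w"
  and inversions_pos: "\<beta> \<in> inversions w \<Longrightarrow> \<beta> \<in> pos_roots G S"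
  and inversions_height: "\<beta> \<in> inversions w \<Longrightarrow> height (act (inv w) \<beta>) < 0"
  by (auto simp: inversions_def)

lemma not_inversion_height:
  assumes "\<beta> \<in> pos_roots G S" "w \<in> carrier G" "\<beta> \<notin> inversions w"
  shows "0 < height (act (inv w) \<beta>)"
  using assms root_height_nonzero[OF act_root[OF pos_root_root[OF assms(1)], of "inv w"]]
  by (force simp: inversions_def)

lemma inversions_iff:
  "\<beta> \<in> pos_roots G S \<Longrightarrow> \<beta> \<in> inversions w \<longleftrightarrow> height (act (inv w) \<beta>) < 0"
  by (auto simp: inversions_def)

lemma neg_root_inversions:
  assumes "\<beta> \<in> pos_roots G S" "w \<in> carrier G"
  shows "is_neg_root G S (act (inv w) \<beta>) \<longleftrightarrow> \<beta> \<in> inversions w"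
  using assms act_root[OF pos_root_root[OF assms(1)], of "inv w"] by (simp add: neg_root_iff inversions_iff)

lemma inversions_one [simp]: "inversions \<one> = {}"
  using pos_root_height by (force simp: inversions_def)

text \<open>\<open>act_simple_nonneg\<close> treats the case that \<open>s\<close> lengthens
  \<open>w\<close>; otherwise it applies to \<open>w \<otimes> s\<close>, which gives the opposite
  root.\<close>

lemma height_act_simple:
  assumes "w \<in> carrier G" "s \<in> S"
  shows "height (act w (simple_root s)) < 0 \<longleftrightarrow> len (w \<otimes> s) < len w"
proof -
  have pos: "0 < height (act w (simple_root s))" if "len (w \<otimes> s) = len w + 1" "w \<in> carrier G" for w
  proof -
    have "act w (simple_root s) \<in> pos_roots G S"
      using act_simple_nonneg[of w s] that assms(2) rootI[of w s] by (simp add: pos_roots_def)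
    then show ?thesis by (rule pos_root_height)
  qed
  consider "len (w \<otimes> s) = len w + 1" | "len w = len (w \<otimes> s) + 1"
    using len_mult_gen_cases[OF assms(2,1)] by auto
  then show ?thesis
  proof cases
    case 1
    then show ?thesis using pos[OF 1 assms(1)] by simp
  next
    case 2
    then have "0 < height (act (w \<otimes> s) (simple_root s))" using pos[of "w \<otimes> s"] assms by simp
    then show ?thesis using 2 act_descent[OF assms] by simp
  qed
qed

lemma simple_inversion:
  assumes "w \<in> carrier G" "s \<in> S"
  shows "simple_root s \<in> inversions w \<longleftrightarrow> len (s \<otimes> w) < len w"
  using height_act_simple[of "inv w" s] assms len_mult_gen[of s "inv w"]
  by (simp add: inversions_iff simple_pos_root)

lemma inversions_gen_mult:
  assumes s: "s \<in> S" and w: "w \<in> carrier G" and up: "len (s \<otimes> w) = len w + 1"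
  shows "inversions (s \<otimes> w) = insert (simple_root s) (act s ` inversions w)"
proof (intro Set.set_eqI iffI)
  have sw: "simple_root s \<notin> inversions w" using simple_inversion[OF w s] up by simp
  have inv: "inv (s \<otimes> w) = inv w \<otimes> s" using s w by (simp add: inv_mult_group)
  fix \<beta>
  {
    assume b: "\<beta> \<in> inversions (s \<otimes> w)"
    show "\<beta> \<in> insert (simple_root s) (act s ` inversions w)"
    proof (cases "\<beta> = simple_root s")
      case False
      then have "act s \<beta> \<in> pos_roots G S" using gen_permutes_pos_roots[OF inversions_pos[OF b] s] by simp
      then have "act s \<beta> \<in> inversions w"
        using inversions_height[OF b] s w by (intro inversionsI) (simp_all add: inv act_mult)
      then have "act s (act s \<beta>) \<in> act s ` inversions w" by (rule imageI)
      then show ?thesis using s by (simp add: act_gen)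
    qed simp
  next
    assume "\<beta> \<in> insert (simple_root s) (act s ` inversions w)"
    then consider "\<beta> = simple_root s" | \<gamma> where "\<gamma> \<in> inversions w" "\<beta> = act s \<gamma>" by auto
    then show "\<beta> \<in> inversions (s \<otimes> w)"
    proof cases
      case 1
      then show ?thesis using simple_inversion[of "s \<otimes> w" s] s w up by simp
    next
      case 2
      then have "\<gamma> \<noteq> simple_root s" using sw by auto
      then have "\<beta> \<in> pos_roots G S" using 2 gen_permutes_pos_roots[OF inversions_pos s] by simp
      then show ?thesis using inversions_height[OF 2(1)] 2(2) s w
        by (intro inversionsI) (simp_all add: inv act_mult act_gen)
    qed
  }
qed

section \<open>Length as number of inversions, and the weak order as inclusion\<close>

lemma inj_act: "w \<in> carrier G \<Longrightarrow> inj_on (act w) A"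
  by (metis act_inv_act inj_onI)

lemma finite_card_inversions:
  assumes "w \<in> carrier G"
  shows "finite (inversions w) \<and> card (inversions w) = len w"
  using assms
proof (induction "len w" arbitrary: w rule: less_induct)
  case less
  show ?case
  proof (cases "w = \<one>")
    case True
    then show ?thesis by simp
  next
    case False
    then obtain s where s: "s \<in> S" "len w = len (s \<otimes> w) + 1"
      using left_descent_exists[OF less.prems] by blast
    define v where "v = s \<otimes> w"
    have v: "v \<in> carrier G" "w = s \<otimes> v" "len (s \<otimes> v) = len v + 1" "len v < len w"
      using s less.prems by (simp_all add: v_def)
    have IH: "finite (inversions v)" "card (inversions v) = len v" using less.hyps[OF v(4,1)] by auto
    have "simple_root s \<notin> act s ` inversions v"
    proof
      assume "simple_root s \<in> act s ` inversions v"
      then obtain \<gamma> where g: "\<gamma> \<in> inversions v" "simple_root s = act s \<gamma>" by auto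
      then have "act s (simple_root s) = \<gamma>" using s by (simp add: act_gen)
      then have "height \<gamma> = - 1" using s by (auto simp: act_gen srefl_self)
      then show False using pos_root_height[OF inversions_pos[OF g(1)]] by simp
    qed
    then show ?thesis
      using IH v inversions_gen_mult[OF s(1) v(1,3)] inj_act[of s "inversions v"] s
      by (simp add: card_image)
  qed
qed

lemma finite_inversions [simp]: "w \<in> carrier G \<Longrightarrow> finite (inversions w)"
  and card_inversions: "w \<in> carrier G \<Longrightarrow> card (inversions w) = len w"
  using finite_card_inversions by auto

text \<open>An inversion \<xi> of \<open>inv x \<otimes> y\<close> has a sign under
  \<open>x\<close>. If \<open>act x \<xi>\<close> is positive, it is an inversion of
  \<open>y\<close> but not of \<open>x\<close>; if it is negative, its opposite is an inversion of
  \<open>x\<close> but not of \<open>y\<close>. Both assignments are bijections.\<close>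

lemma len_quotient:
  assumes x: "x \<in> carrier G" and y: "y \<in> carrier G"
  shows "len (inv x \<otimes> y) = card (inversions y - inversions x) + card (inversions x - inversions y)"
proof -
  let ?N = "inversions (inv x \<otimes> y)"
  have xi: "inv x \<otimes> y \<in> carrier G" using x y by simp
  have act_z: "act (inv (inv x \<otimes> y)) \<xi> = act (inv y) (act x \<xi>)" for \<xi>
    using x y by (simp add: inv_mult_group act_mult)
  define A where "A = {\<xi> \<in> ?N. 0 < height (act x \<xi>)}"
  define B where "B = {\<xi> \<in> ?N. height (act x \<xi>) < 0}"
  have "?N = A \<union> B"
    using root_height_nonzero[OF act_root[OF pos_root_root[OF inversions_pos] x]]
    unfolding A_def B_def by force
  moreover have fin: "finite A" "finite B" using finite_inversions[OF xi] by (auto simp: A_def B_def)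
  moreover have "A \<inter> B = {}" by (auto simp: A_def B_def)
  ultimately have cN: "len (inv x \<otimes> y) = card A + card B"
    using card_inversions[OF xi] by (simp add: card_Un_disjoint)
  have "act x ` A = inversions y - inversions x"
  proof (intro Set.set_eqI iffI)
    fix \<beta> assume "\<beta> \<in> act x ` A"
    then obtain \<xi> where xi: "\<xi> \<in> ?N" "0 < height (act x \<xi>)" "\<beta> = act x \<xi>" by (auto simp: A_def)
    have p: "\<beta> \<in> pos_roots G S"
      using xi act_root[OF pos_root_root[OF inversions_pos[OF xi(1)]] x] by (simp add: pos_root_iff)
    show "\<beta> \<in> inversions y - inversions x"
      using p xi(3) inversions_height[OF xi(1)] pos_root_height[OF inversions_pos[OF xi(1)]] x
      by (simp add: inversions_iff act_z)
  next
    fix \<beta> assume b: "\<beta> \<in> inversions y - inversions x"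
    from b have p: "\<beta> \<in> pos_roots G S" by (auto simp: inversions_def)
    have h: "0 < height (act (inv x) \<beta>)" using not_inversion_height[OF p x] b by simp
    then have q: "act (inv x) \<beta> \<in> pos_roots G S"
      using act_root[OF pos_root_root[OF p], of "inv x"] x by (simp add: pos_root_iff)
    have "act (inv x) \<beta> \<in> A"
      using q b pos_root_height[OF p] inversions_height[of \<beta> y] x
      by (auto simp: A_def inversions_iff act_z)
    then have "act x (act (inv x) \<beta>) \<in> act x ` A" by (rule imageI)
    then show "\<beta> \<in> act x ` A" using x by simp
  qed
  moreover have "(\<lambda>\<xi> t. - act x \<xi> t) ` B = inversions x - inversions y"
  proof (intro Set.set_eqI iffI)
    fix \<beta> assume "\<beta> \<in> (\<lambda>\<xi> t. - act x \<xi> t) ` B"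
    then obtain \<xi> where xi: "\<xi> \<in> ?N" "height (act x \<xi>) < 0" "\<beta> = (\<lambda>t. - act x \<xi> t)" by (auto simp: B_def)
    have p: "\<beta> \<in> pos_roots G S"
      using xi uminus_root[OF act_root[OF pos_root_root[OF inversions_pos[OF xi(1)]] x]] by (simp add: pos_root_iff)
    show "\<beta> \<in> inversions x - inversions y"
      using p xi(3) inversions_height[OF xi(1)] pos_root_height[OF inversions_pos[OF xi(1)]] x y
      by (simp add: inversions_iff act_z act_uminus)
  next
    fix \<beta> assume b: "\<beta> \<in> inversions x - inversions y"
    from b have p: "\<beta> \<in> pos_roots G S" by (auto simp: inversions_def)
    have h: "0 < height (act (inv y) \<beta>)" using not_inversion_height[OF p y] b by simp
    let ?\<xi> = "\<lambda>t. - act (inv x) \<beta> t"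
    have q: "?\<xi> \<in> pos_roots G S"
      using uminus_root[OF act_root[OF pos_root_root[OF p], of "inv x"]] x b inversions_height[of \<beta> x]
      by (simp add: pos_root_iff)
    have "?\<xi> \<in> B"
      using q h pos_root_height[OF p] x y
      by (simp add: B_def inversions_iff act_z act_uminus)
    then have "(\<lambda>\<xi> t. - act x \<xi> t) ?\<xi> \<in> (\<lambda>\<xi> t. - act x \<xi> t) ` B" by (rule imageI)
    then show "\<beta> \<in> (\<lambda>\<xi> t. - act x \<xi> t) ` B" using x by (simp add: act_uminus)
  qed
  moreover have "inj_on (\<lambda>\<xi> t. - act x \<xi> t) B"
    using inj_act[OF x, of UNIV] by (auto simp: inj_on_def fun_eq_iff)
  ultimately show ?thesis
    using cN card_image[OF inj_act[OF x, of A]] card_image[of "\<lambda>\<xi> t. - act x \<xi> t" B] by simp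
qed

text \<open>The source of all later length criteria: the weak order becomes inclusion of inversion
  sets, and additivity of lengths becomes disjointness.\<close>

lemma len_quotient_inter:
  assumes "x \<in> carrier G" "y \<in> carrier G"
  shows "len (inv x \<otimes> y) + 2 * card (inversions x \<inter> inversions y) = len x + len y"
proof -
  have "len x = card (inversions x - inversions y) + card (inversions x \<inter> inversions y)"
    using card_Int_Diff[of "inversions x" "inversions y"] card_inversions[OF assms(1)] assms by simp
  moreover have "len y = card (inversions y - inversions x) + card (inversions x \<inter> inversions y)"
    using card_Int_Diff[of "inversions y" "inversions x"] card_inversions[OF assms(2)] assms
    by (simp add: Int_commute)
  ultimately show ?thesis using len_quotient[OF assms] by simp
qed

lemma weak_le_iff:
  assumes "x \<in> carrier G" "y \<in> carrier G"
  shows "int (len (inv x \<otimes> y)) = int (len y) - int (len x) \<longleftrightarrow> inversions x \<subseteq> inversions y"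
proof -
  have "int (len (inv x \<otimes> y)) = int (len y) - int (len x) \<longleftrightarrow>
      card (inversions x \<inter> inversions y) = card (inversions x)"
    using len_quotient_inter[OF assms] card_inversions[OF assms(1)] by linarith
  also have "\<dots> \<longleftrightarrow> inversions x \<inter> inversions y = inversions x"
    using card_subset_eq[of "inversions x" "inversions x \<inter> inversions y"] assms by auto
  finally show ?thesis by auto
qed

lemma len_quotient_add_iff:
  assumes "x \<in> carrier G" "y \<in> carrier G"
  shows "len (inv x \<otimes> y) = len x + len y \<longleftrightarrow> inversions x \<inter> inversions y = {}"
proof -
  have "len (inv x \<otimes> y) = len x + len y \<longleftrightarrow> card (inversions x \<inter> inversions y) = 0"
    using len_quotient_inter[OF assms] by linarith
  then show ?thesis using assms by simp
qed

lemma len_mult_add_iff: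
  assumes "x \<in> carrier G" "y \<in> carrier G"
  shows "len (x \<otimes> y) = len x + len y \<longleftrightarrow> inversions (inv x) \<inter> inversions y = {}"
  using len_quotient_add_iff[of "inv x" y] assms by simp

lemma inversions_inj:
  assumes "x \<in> carrier G" "y \<in> carrier G" "inversions x = inversions y"
  shows "x = y"
proof -
  have "inv x \<otimes> y = \<one>" using len_quotient[OF assms(1,2)] assms len_eq_0_iff[of "inv x \<otimes> y"] by simp
  then show ?thesis using assms(1,2) by (metis inv_equality inv_inv inv_closed)
qed

lemma inversions_mult_left:
  assumes "x \<in> carrier G" "y \<in> carrier G" "len (x \<otimes> y) = len x + len y"
  shows "inversions x \<subseteq> inversions (x \<otimes> y)"
  using weak_le_iff[of x "x \<otimes> y"] assms by (simp flip: m_assoc)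

lemma inversions_mult_right:
  assumes "x \<in> carrier G" "y \<in> carrier G" "len (x \<otimes> y) = len x + len y" "\<xi> \<in> inversions y"
  shows "act x \<xi> \<in> inversions (x \<otimes> y)"
proof -
  have p: "\<xi> \<in> pos_roots G S" using assms(4) by (rule inversions_pos)
  have "\<xi> \<notin> inversions (inv x)" using len_mult_add_iff[of x y] assms by auto
  then have "0 < height (act x \<xi>)" using not_inversion_height[OF p, of "inv x"] assms(1) by simp
  then have "act x \<xi> \<in> pos_roots G S"
    using act_root[OF pos_root_root[OF p] assms(1)] by (simp add: pos_root_iff)
  then show ?thesis
    using inversions_height[OF assms(4)] assms(1,2) by (simp add: inversions_iff inv_mult_group act_mult)
qed


section \<open>Reflections\<close>

lemma act_faithful:
  assumes "x \<in> carrier G" "y \<in> carrier G" "\<And>v. act x v = act y v"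
  shows "x = y"
proof -
  have "inversions (inv x) = inversions (inv y)" using assms by (simp add: inversions_def)
  then have "inv x = inv y" using inversions_inj[of "inv x" "inv y"] assms by simp
  then show ?thesis using assms(1,2) by (metis inv_inv)
qed

abbreviation rrefl :: "'a root_vec \<Rightarrow> 'a" where "rrefl \<equiv> root_reflection G S"

lemma act_conjugate:
  assumes "w \<in> carrier G" "s \<in> S"
  shows "act (w \<otimes> s \<otimes> inv w) v =
    (\<lambda>t. v t - 2 * form v (act w (simple_root s)) * act w (simple_root s) t)"
proof -
  let ?u = "act (inv w) v"
  have e: "srefl s ?u = (\<lambda>t. 1 * ?u t + (- 2 * form ?u (simple_root s)) * simple_root s t)"
    by (simp add: simple_refl_def fun_eq_iff)
  have "act (w \<otimes> s \<otimes> inv w) v = act w (srefl s ?u)" using assms by (simp add: act_mult act_gen)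
  also have "\<dots> = (\<lambda>t. 1 * act w ?u t + (- 2 * form ?u (simple_root s)) * act w (simple_root s) t)"
    unfolding e by (rule act_lincomb[OF assms(1)])
  also have "form ?u (simple_root s) = form v (act w (simple_root s))"
    using form_act_left[of "inv w" v "simple_root s"] assms by simp
  finally show ?thesis using assms by (simp add: fun_eq_iff)
qed

text \<open>By \<open>act_conjugate\<close> the action of the conjugate depends only on the root,
  and the action is faithful, so the definite description in \<open>root_reflection\<close> is
  unambiguous.\<close>

lemma root_reflection_conjugate:
  assumes w: "w \<in> carrier G" and s: "s \<in> S"
  shows "rrefl (act w (simple_root s)) = w \<otimes> s \<otimes> inv w"
  unfolding root_reflection_def
proof (rule the_equality)
  show "\<exists>w'\<in>carrier G. \<exists>s'\<in>S. act w (simple_root s) = act w' (simple_root s') \<and> w \<otimes> s \<otimes> inv w = w' \<otimes> s' \<otimes> inv w'"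
    using w s by blast
next
  fix r assume "\<exists>w'\<in>carrier G. \<exists>s'\<in>S. act w (simple_root s) = act w' (simple_root s') \<and> r = w' \<otimes> s' \<otimes> inv w'"
  then obtain w' s' where r: "w' \<in> carrier G" "s' \<in> S" "act w (simple_root s) = act w' (simple_root s')" "r = w' \<otimes> s' \<otimes> inv w'"
    by blast
  show "r = w \<otimes> s \<otimes> inv w"
    by (rule act_faithful) (use w s r act_conjugate[OF w s] act_conjugate[OF r(1,2)] in auto)
qed

lemma inv_mult_cancel [simp]: "w \<in> carrier G \<Longrightarrow> x \<in> carrier G \<Longrightarrow> inv w \<otimes> (w \<otimes> x) = x"
  by (simp flip: m_assoc)

lemma mult_inv_cancel [simp]: "w \<in> carrier G \<Longrightarrow> x \<in> carrier G \<Longrightarrow> w \<otimes> (inv w \<otimes> x) = x"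
  by (simp flip: m_assoc)

lemma rrefl_closed [simp]: "\<beta> \<in> roots G S \<Longrightarrow> rrefl \<beta> \<in> carrier G"
  by (erule rootE) (simp add: root_reflection_conjugate)

lemma rrefl_square [simp]: "\<beta> \<in> roots G S \<Longrightarrow> rrefl \<beta> \<otimes> rrefl \<beta> = \<one>"
  by (erule rootE) (simp add: root_reflection_conjugate m_assoc)

lemma rrefl_inv [simp]: "\<beta> \<in> roots G S \<Longrightarrow> inv (rrefl \<beta>) = rrefl \<beta>"
  by (rule inv_equality) auto

lemma rrefl_rrefl [simp]: "\<beta> \<in> roots G S \<Longrightarrow> w \<in> carrier G \<Longrightarrow> rrefl \<beta> \<otimes> (rrefl \<beta> \<otimes> w) = w"
  by (simp flip: m_assoc)

lemma rrefl_simple [simp]: "s \<in> S \<Longrightarrow> rrefl (simple_root s) = s"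
  using root_reflection_conjugate[of \<one> s] by simp

lemma act_rrefl: "\<beta> \<in> roots G S \<Longrightarrow> act (rrefl \<beta>) v = (\<lambda>t. v t - 2 * form v \<beta> * \<beta> t)"
  by (erule rootE) (simp add: root_reflection_conjugate act_conjugate)

lemma act_rrefl_lincomb: "\<beta> \<in> roots G S \<Longrightarrow> act (rrefl \<beta>) v = (\<lambda>t. 1 * v t + (- 2 * form v \<beta>) * \<beta> t)"
  by (simp add: act_rrefl)

lemma act_rrefl_self: "\<beta> \<in> roots G S \<Longrightarrow> act (rrefl \<beta>) \<beta> = (\<lambda>t. - \<beta> t)"
  by (simp add: act_rrefl root_form)

lemma rrefl_act:
  assumes "\<beta> \<in> roots G S" "x \<in> carrier G"
  shows "rrefl (act x \<beta>) = x \<otimes> rrefl \<beta> \<otimes> inv x"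
proof -
  obtain w s where w: "w \<in> carrier G" "s \<in> S" "\<beta> = act w (simple_root s)" using assms(1) by (rule rootE)
  then show ?thesis
    using root_reflection_conjugate[of "x \<otimes> w" s] assms(2)
    by (simp add: act_mult root_reflection_conjugate inv_mult_group m_assoc)
qed

lemma height_act_rrefl:
  "\<beta> \<in> roots G S \<Longrightarrow> w \<in> carrier G \<Longrightarrow>
    height (act w (act (rrefl \<beta>) v)) = height (act w v) - 2 * form v \<beta> * height (act w \<beta>)"
  by (simp only: act_rrefl_lincomb height_act_lincomb)

text \<open>Strip a left descent \<open>s\<close>. Unless \<beta> is
  \<open>\<alpha>\<^sub>s\<close>, the root \<open>act s \<beta>\<close> is an inversion of the
  shorter \<open>s \<otimes> w\<close>, and restoring \<open>s\<close> on the left costs at most one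
  letter.\<close>

lemma len_rrefl_less:
  assumes "\<beta> \<in> inversions w" "w \<in> carrier G"
  shows "len (rrefl \<beta> \<otimes> w) < len w"
  using assms
proof (induction "len w" arbitrary: w \<beta> rule: less_induct)
  case less
  note w = less.prems(2)
  have bp: "\<beta> \<in> pos_roots G S" using less.prems(1) by (rule inversions_pos)
  have "w \<noteq> \<one>" using less.prems(1) by auto
  then obtain s where s: "s \<in> S" "len w = len (s \<otimes> w) + 1" using left_descent_exists[OF w] by blast
  show ?case
  proof (cases "\<beta> = simple_root s")
    case True
    then show ?thesis using s by simp
  next
    case False
    define v where "v = s \<otimes> w"
    have v: "v \<in> carrier G" "w = s \<otimes> v" "len v < len w" using s w by (simp_all add: v_def)
    have sb: "act s \<beta> \<in> pos_roots G S" using gen_permutes_pos_roots[OF bp s(1) False] .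
    have "act s \<beta> \<in> inversions v"
      using sb inversions_height[OF less.prems(1)] v s by (simp add: inversions_iff inv_mult_group act_mult)
    then have l: "len (rrefl (act s \<beta>) \<otimes> v) < len v" by (rule less.hyps[OF v(3) _ v(1)])
    have "rrefl \<beta> \<otimes> w = s \<otimes> (rrefl (act s \<beta>) \<otimes> v)"
      unfolding v(2) using rrefl_act[OF pos_root_root[OF bp], of s] s(1) pos_root_root[OF bp] v(1)
      by (simp add: m_assoc)
    then have "len (rrefl \<beta> \<otimes> w) \<le> 1 + len (rrefl (act s \<beta>) \<otimes> v)"
      using len_mult_le[of s "rrefl (act s \<beta>) \<otimes> v"] s v pos_root_root[OF sb] by simp
    then show ?thesis using l v(3) by linarith
  qed
qed

lemma inversion_iff_len:
  assumes b: "\<beta> \<in> pos_roots G S" and w: "w \<in> carrier G"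
  shows "\<beta> \<in> inversions w \<longleftrightarrow> len (rrefl \<beta> \<otimes> w) < len w"
proof
  assume l: "len (rrefl \<beta> \<otimes> w) < len w"
  note r = pos_root_root[OF b]
  show "\<beta> \<in> inversions w"
  proof (rule ccontr)
    assume "\<beta> \<notin> inversions w"
    then have "0 < height (act (inv w) \<beta>)" using not_inversion_height[OF b w] by simp
    then have "\<beta> \<in> inversions (rrefl \<beta> \<otimes> w)"
      using b r w by (intro inversionsI) (simp_all add: inv_mult_group act_mult act_rrefl_self act_uminus)
    then have "len (rrefl \<beta> \<otimes> (rrefl \<beta> \<otimes> w)) < len (rrefl \<beta> \<otimes> w)"
      using len_rrefl_less[of \<beta> "rrefl \<beta> \<otimes> w"] r w by simp
    then show False using l r w by simp
  qed
qed (use len_rrefl_less[of \<beta> w] w in simp)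

end

text \<open>The squared norm of \<open>u\<close> falls short of the weighted mean of those of
  \<open>v\<close> and \<open>w\<close> by \<open>l * (1 - l)\<close> times that of their
  difference. If neither endpoint is longer than \<open>u\<close>, this defect vanishes.\<close>

lemma strict_convexity_sum_squares:
  fixes u v w :: "'i \<Rightarrow> real"
  assumes "finite I" "0 < l" "l < 1" "\<And>i. i \<in> I \<Longrightarrow> u i = l * v i + (1 - l) * w i"
    and "(\<Sum>i\<in>I. (v i)\<^sup>2) \<le> (\<Sum>i\<in>I. (u i)\<^sup>2)" "(\<Sum>i\<in>I. (w i)\<^sup>2) \<le> (\<Sum>i\<in>I. (u i)\<^sup>2)" "i \<in> I"
  shows "v i = w i"
proof -
  have "(\<Sum>i\<in>I. (u i)\<^sup>2) = (\<Sum>i\<in>I. l * (v i)\<^sup>2 + (1 - l) * (w i)\<^sup>2 - l * (1 - l) * (v i - w i)\<^sup>2)"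
    by (intro sum.cong refl) (simp add: assms(4) power2_eq_square algebra_simps)
  also have "\<dots> = l * (\<Sum>i\<in>I. (v i)\<^sup>2) + (1 - l) * (\<Sum>i\<in>I. (w i)\<^sup>2) - l * (1 - l) * (\<Sum>i\<in>I. (v i - w i)\<^sup>2)"
    by (simp add: sum.distrib sum_subtractf sum_distrib_left)
  also have "\<dots> \<le> l * (\<Sum>i\<in>I. (u i)\<^sup>2) + (1 - l) * (\<Sum>i\<in>I. (u i)\<^sup>2) - l * (1 - l) * (\<Sum>i\<in>I. (v i - w i)\<^sup>2)"
    using assms(2,3,5,6) by (intro diff_right_mono add_mono mult_left_mono) auto
  finally have "l * (1 - l) * (\<Sum>i\<in>I. (v i - w i)\<^sup>2) \<le> 0" by (simp add: algebra_simps)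
  then have "(\<Sum>i\<in>I. (v i - w i)\<^sup>2) \<le> 0" using assms(2,3) by (simp add: mult_le_0_iff)
  then have "(\<Sum>i\<in>I. (v i - w i)\<^sup>2) = 0" by (simp add: antisym sum_nonneg)
  then show ?thesis using assms(1,7) by (simp add: sum_nonneg_eq_0_iff)
qed

lemma finite_has_max:
  fixes f :: "'i \<Rightarrow> 'b :: linorder"
  assumes "finite A" "A \<noteq> {}"
  obtains x where "x \<in> A" "\<And>y. y \<in> A \<Longrightarrow> f y \<le> f x"
proof -
  have "Max (f ` A) \<in> f ` A" using assms by (intro Max_in) auto
  then obtain x where "x \<in> A" "Max (f ` A) = f x" by auto
  moreover have "f y \<le> Max (f ` A)" if "y \<in> A" for y using that assms by (intro Max_ge) auto
  ultimately show ?thesis using that by simp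
qed

context finite_coxeter_system
begin

section \<open>Spherical roots and cone types\<close>

lemma inversions_gen: "s \<in> S \<Longrightarrow> inversions s = {simple_root s}"
  using inversions_gen_mult[of s \<one>] by simp

text \<open>One inclusion comes from additivity of lengths; counting makes it an equality.\<close>

lemma inversions_mult_gen:
  assumes z: "z \<in> carrier G" and s: "s \<in> S" and up: "len (z \<otimes> s) = len z + 1"
  shows "inversions (z \<otimes> s) = insert (act z (simple_root s)) (inversions z)"
proof -
  have l: "len (z \<otimes> s) = len z + len s" using up s by simp
  have n: "act z (simple_root s) \<notin> inversions z"
    using inversions_height[of "act z (simple_root s)" z] z s by auto
  have "insert (act z (simple_root s)) (inversions z) \<subseteq> inversions (z \<otimes> s)"
    using inversions_mult_left[OF z _ l] inversions_mult_right[OF z _ l, of "simple_root s"] s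
    by (simp add: inversions_gen)
  moreover have "card (insert (act z (simple_root s)) (inversions z)) = card (inversions (z \<otimes> s))"
    using n z s up by (simp add: card_inversions)
  ultimately have "insert (act z (simple_root s)) (inversions z) = inversions (z \<otimes> s)"
    using z s by (intro card_subset_eq) auto
  then show ?thesis ..
qed

text \<open>Serves to read the sign of a root supported on \<open>J\<close> from the signs of the
  transformed simple roots of \<open>J\<close>.\<close>

lemma height_act_expand:
  assumes J: "J \<subseteq> S" and w: "w \<in> carrier G" and off: "\<And>t. t \<notin> J \<Longrightarrow> v t = 0"
  shows "height (act w v) = (\<Sum>j\<in>J. v j * height (act w (simple_root j)))"
proof -
  have fin: "finite J" using J finite_gens finite_subset by auto
  have "v = (\<lambda>t. \<Sum>j\<in>J. v j * simple_root j t)"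
  proof
    fix t
    show "v t = (\<Sum>j\<in>J. v j * simple_root j t)"
      using fin off[of t] by (cases "t \<in> J") (simp_all add: simple_root_def if_distrib[of "\<lambda>x. _ * x"] cong: if_cong)
  qed
  then have "act w v = (\<lambda>t. \<Sum>j\<in>J. v j * act w (simple_root j) t)"
    using act_sum[OF w fin, of v "simple_root"] by simp
  then have "height (act w v) = (\<Sum>s\<in>S. \<Sum>j\<in>J. v j * act w (simple_root j) s)" by (simp add: height_def)
  also have "\<dots> = (\<Sum>j\<in>J. \<Sum>s\<in>S. v j * act w (simple_root j) s)" by (rule sum.swap)
  finally show ?thesis by (simp add: height_def sum_distrib_left)
qed

text \<open>
  A maximal \<open>z\<close> in the finite group \<open>W\<^sub>J\<close> whose inversions avoid those of \<open>g\<close> inverts all the other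
  roots of \<open>W\<^sub>J\<close>.
\<close>

lemma spherical_root_avoiding:
  assumes sph: "\<beta> \<in> spherical_roots G S" and g: "g \<in> carrier G" and bg: "\<beta> \<notin> inversions g"
  obtains z where "z \<in> carrier G" "inversions z \<inter> inversions g = {}" "\<beta> \<in> inversions z"
proof -
  obtain J where J: "J \<subseteq> S" "finite (generate G J)" "{s\<in>S. \<beta> s \<noteq> 0} \<subseteq> J"
    using sph by (auto simp: spherical_roots_def spherical_subset_def)
  have b: "\<beta> \<in> pos_roots G S" using sph by (simp add: spherical_roots_def)
  have gen_sub: "generate G J \<subseteq> carrier G" using generate_incl[of J] J(1) gens_closed by blast
  define Z where "Z = {z \<in> generate G J. inversions z \<inter> inversions g = {}}"
  have "finite Z" "\<one> \<in> Z" using J(2) by (auto simp: Z_def generate.one)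
  then obtain z where z: "z \<in> Z" and zmax: "\<And>y. y \<in> Z \<Longrightarrow> len y \<le> len z"
    using finite_has_max[of Z len] by blast
  have zJ: "z \<in> generate G J" and zc: "z \<in> carrier G" and zg: "inversions z \<inter> inversions g = {}"
    using z gen_sub by (auto simp: Z_def)
  \<comment> \<open>If \<open>act z (simple_root j)\<close> is negative, its opposite is an
    inversion of \<open>z\<close>, hence not of \<open>g\<close>. If it is positive, maximality of
    \<open>z\<close> keeps \<open>z \<otimes> j\<close> out of \<open>Z\<close>, so the new
    inversion belongs to \<open>g\<close>.\<close>
  have neg: "height (act (inv g) (act z (simple_root j))) < 0" if j: "j \<in> J" for j
  proof (cases "height (act z (simple_root j)) < 0")
    case True
    let ?\<xi> = "\<lambda>t. - act z (simple_root j) t"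
    have jS: "j \<in> S" using j J(1) by auto
    have p: "?\<xi> \<in> pos_roots G S"
      using True uminus_root[OF rootI[OF zc jS]] by (simp add: pos_root_iff)
    have "?\<xi> \<in> inversions z"
      using p zc jS by (simp add: inversions_iff act_uminus)
    then have "?\<xi> \<notin> inversions g" using zg by auto
    from not_inversion_height[OF p g this] show ?thesis using g by (simp add: act_uminus)
  next
    case False
    have jS: "j \<in> S" using j J(1) by auto
    have up: "len (z \<otimes> j) = len z + 1"
      using False height_act_simple[OF zc jS] len_mult_gen_cases[OF jS zc] by auto
    have p: "act z (simple_root j) \<in> pos_roots G S"
      using False rootI[OF zc jS] root_height_nonzero[of "act z (simple_root j)"] by (simp add: pos_root_iff)
    have "act z (simple_root j) \<in> inversions g"
    proof (rule ccontr)
      assume "act z (simple_root j) \<notin> inversions g"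
      then have "z \<otimes> j \<in> Z"
        using zJ j zg inversions_mult_gen[OF zc jS up] by (auto simp: Z_def intro: generate.eng generate.incl)
      then show False using zmax up by fastforce
    qed
    then show ?thesis by (rule inversions_height)
  qed
  have "\<beta> \<in> inversions z"
  proof (rule ccontr)
    assume "\<beta> \<notin> inversions z"
    then have h: "0 < height (act (inv z) \<beta>)" using not_inversion_height[OF b zc] by simp
    \<comment> \<open>\<gamma> is a nonnegative combination of simple roots of \<open>J\<close>, all
      of which \<open>inv g \<otimes> z\<close> makes negative. This contradicts the positivity of
      \<open>act (inv g) \<beta>\<close>.\<close>
    define \<gamma> where "\<gamma> = act (inv z) \<beta>"
    have gp: "\<gamma> \<in> pos_roots G S"
      using h act_root[OF pos_root_root[OF b], of "inv z"] zc by (simp add: pos_root_iff \<gamma>_def)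
    have izJ: "inv z \<in> generate G J" using generate_m_inv_closed[OF _ zJ] J(1) gens_closed by blast
    have off: "\<gamma> t = 0" if "t \<notin> J" for t
      using act_off_subset[OF J(1) izJ that, of \<beta>] J(3) that root_off[OF pos_root_root[OF b], of t]
      by (auto simp: \<gamma>_def)
    have "height (act (inv g) \<beta>) = height (act (inv g \<otimes> z) \<gamma>)"
      using g zc by (simp add: act_mult \<gamma>_def)
    also have "\<dots> = (\<Sum>j\<in>J. \<gamma> j * height (act (inv g \<otimes> z) (simple_root j)))"
      using height_act_expand[OF J(1) _ off] g zc by simp
    also have "\<dots> \<le> 0"
      using neg g zc pos_root_nonneg[OF gp]
      by (intro sum_nonpos) (simp add: act_mult mult_nonneg_nonpos less_imp_le)
    finally show False using not_inversion_height[OF b g bg] by simp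
  qed
  then show ?thesis using that zc zg by blast
qed


section \<open>Short inversions\<close>

lemma short_inversion_iff:
  "\<beta> \<in> short_inversions G S w \<longleftrightarrow> \<beta> \<in> pos_roots G S \<and> len (rrefl \<beta> \<otimes> w) + 1 = len w"
  by (auto simp: short_inversions_def)

lemma short_inversion_inversion:
  "w \<in> carrier G \<Longrightarrow> \<beta> \<in> short_inversions G S w \<Longrightarrow> \<beta> \<in> inversions w"
  by (simp add: short_inversion_iff inversion_iff_len)

text \<open>The root \<open>act s \<beta>\<close> is an inversion of \<open>s \<otimes> w\<close>,
  so \<open>s \<otimes> (rrefl \<beta> \<otimes> w)\<close> is shorter than
  \<open>s \<otimes> w\<close>. The latter has the length of
  \<open>rrefl \<beta> \<otimes> w\<close>, because \<beta> is short.\<close>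

lemma short_inversion_descent:
  assumes w: "w \<in> carrier G" and b: "\<beta> \<in> short_inversions G S w"
    and s: "s \<in> S" "simple_root s \<in> inversions w" "\<beta> \<noteq> simple_root s"
  shows "simple_root s \<in> inversions (rrefl \<beta> \<otimes> w)"
proof -
  have bp: "\<beta> \<in> pos_roots G S" and l: "len (rrefl \<beta> \<otimes> w) + 1 = len w" using b by (simp_all add: short_inversion_iff)
  note br = pos_root_root[OF bp]
  have down: "len w = len (s \<otimes> w) + 1"
    using simple_inversion[OF w s(1)] s(2) len_gen_mult_cases[OF s(1) w] by auto
  have "act s \<beta> \<in> pos_roots G S" using gen_permutes_pos_roots[OF bp s(1,3)] .
  then have "act s \<beta> \<in> inversions (s \<otimes> w)"
    using inversions_height[OF short_inversion_inversion[OF w b]] s(1) w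
    by (simp add: inversions_iff inv_mult_group act_mult) (simp add: act_gen)
  then have "len (rrefl (act s \<beta>) \<otimes> (s \<otimes> w)) < len (s \<otimes> w)" using s(1) w by (intro len_rrefl_less) auto
  also have "rrefl (act s \<beta>) \<otimes> (s \<otimes> w) = s \<otimes> (rrefl \<beta> \<otimes> w)"
    using rrefl_act[OF br, of s] s(1) w br by (simp add: m_assoc)
  finally have "len (s \<otimes> (rrefl \<beta> \<otimes> w)) < len (rrefl \<beta> \<otimes> w)" using down l by simp
  then show ?thesis using simple_inversion[of "rrefl \<beta> \<otimes> w" s] br w s(1) by simp
qed

section \<open>Decomposition of short inversions\<close>

text \<open>
  Elements \<open>z\<close> that can be stripped off from the left: \<open>z\<^sup>-\<^sup>1 \<beta>\<close> is then a short inversion of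
  \<open>z\<^sup>-\<^sup>1 w\<close>, and \<open>\<beta>\<close> is lowered along \<open>z\<close>.
\<close>

definition strippable :: "'a \<Rightarrow> 'a root_vec \<Rightarrow> 'a \<Rightarrow> bool" where
  "strippable w \<beta> z \<longleftrightarrow> z \<in> carrier G \<and> inversions z \<inter> inversions w = {} \<and> (\<forall>\<xi>\<in>inversions z. 0 < form \<beta> \<xi>)"

text \<open>Disjointness of inversion sets makes lengths add. The positive pairings with \<beta>
  make the inversions of \<open>z\<close> avoid those of \<open>rrefl \<beta> \<otimes> w\<close> as
  well, so both lengths grow by \<open>len z\<close> and \<beta> stays short. Conversely, a descent
  \<open>p\<close> of \<open>inv z \<otimes> w\<close> costs one letter there, so reflecting
  \<open>w\<close> in \<open>act z (simple_root p)\<close> loses at most one.\<close>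

lemma strippable_facts:
  assumes w: "w \<in> carrier G" and b: "\<beta> \<in> short_inversions G S w" and st: "strippable w \<beta> z"
  shows "len (inv z \<otimes> w) = len z + len w"
    and "inversions (inv z) \<subseteq> inversions (inv z \<otimes> w)"
    and "act (inv z) \<beta> \<in> short_inversions G S (inv z \<otimes> w)"
    and "\<And>p. p \<in> S \<Longrightarrow> simple_root p \<in> inversions (inv z \<otimes> w) \<Longrightarrow> act z (simple_root p) \<in> pos_roots G S \<Longrightarrow>
      act z (simple_root p) \<in> short_inversions G S w"
proof -
  have z: "z \<in> carrier G" and zw: "inversions z \<inter> inversions w = {}"
    and zf: "\<And>\<xi>. \<xi> \<in> inversions z \<Longrightarrow> 0 < form \<beta> \<xi>"
    using st by (auto simp: strippable_def)
  have bp: "\<beta> \<in> pos_roots G S" and bl: "len (rrefl \<beta> \<otimes> w) + 1 = len w" using b by (simp_all add: short_inversion_iff)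
  note br = pos_root_root[OF bp]
  have bw: "\<beta> \<in> inversions w" using short_inversion_inversion[OF w b] .
  show lw: "len (inv z \<otimes> w) = len z + len w" using len_quotient_add_iff[OF z w] zw by simp
  show "inversions (inv z) \<subseteq> inversions (inv z \<otimes> w)"
    using inversions_mult_left[of "inv z" w] lw z w by simp
  have "\<beta> \<notin> inversions z" using bw zw by auto
  then have bzp: "act (inv z) \<beta> \<in> pos_roots G S"
    using not_inversion_height[OF bp z] act_root[OF br, of "inv z"] z by (simp add: pos_root_iff)
  have "inversions z \<inter> inversions (rrefl \<beta> \<otimes> w) = {}"
  proof (rule ccontr)
    assume "\<not> ?thesis"
    then obtain \<xi> where xi: "\<xi> \<in> inversions z" "\<xi> \<in> inversions (rrefl \<beta> \<otimes> w)" by auto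
    have "height (act (inv (rrefl \<beta> \<otimes> w)) \<xi>) = height (act (inv w) \<xi>) - 2 * form \<xi> \<beta> * height (act (inv w) \<beta>)"
      using br w by (simp add: inv_mult_group act_mult height_act_rrefl)
    moreover have "0 < height (act (inv w) \<xi>)" using not_inversion_height[OF inversions_pos[OF xi(1)] w] xi zw by auto
    moreover have "form \<xi> \<beta> * height (act (inv w) \<beta>) < 0"
      using zf[OF xi(1)] inversions_height[OF bw] form_commute[of \<xi> \<beta>] by (simp add: mult_pos_neg)
    ultimately show False using inversions_height[OF xi(2)] by simp
  qed
  then have "len (inv z \<otimes> (rrefl \<beta> \<otimes> w)) = len z + len (rrefl \<beta> \<otimes> w)"
    using len_quotient_add_iff[OF z, of "rrefl \<beta> \<otimes> w"] br w by simp
  moreover have "rrefl (act (inv z) \<beta>) \<otimes> (inv z \<otimes> w) = inv z \<otimes> (rrefl \<beta> \<otimes> w)"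
    using rrefl_act[OF br, of "inv z"] br z w by (simp add: m_assoc)
  ultimately show "act (inv z) \<beta> \<in> short_inversions G S (inv z \<otimes> w)"
    using bzp bl lw by (simp add: short_inversion_iff)
  fix p assume p: "p \<in> S" "simple_root p \<in> inversions (inv z \<otimes> w)" "act z (simple_root p) \<in> pos_roots G S"
  have "act z (simple_root p) \<in> inversions w"
    using inversions_height[OF p(2)] p z w by (simp add: inversions_iff inv_mult_group act_mult)
  then have l1: "len (rrefl (act z (simple_root p)) \<otimes> w) < len w" using w by (intro len_rrefl_less)
  have c: "rrefl (act z (simple_root p)) \<in> carrier G" using rootI[OF z p(1)] by simp
  have "inv z \<otimes> (rrefl (act z (simple_root p)) \<otimes> w) = p \<otimes> (inv z \<otimes> w)"
    using rrefl_act[OF simple_in_roots[OF p(1)] z] p z w by (simp add: m_assoc)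
  moreover have "len (inv z \<otimes> w) = len (p \<otimes> (inv z \<otimes> w)) + 1"
    using simple_inversion[of "inv z \<otimes> w" p] p z w len_gen_mult_cases[of p "inv z \<otimes> w"] by auto
  ultimately have "len w \<le> len (rrefl (act z (simple_root p)) \<otimes> w) + 1"
    using len_mult_le[of "inv z" "rrefl (act z (simple_root p)) \<otimes> w"] lw c z w by simp
  then show "act z (simple_root p) \<in> short_inversions G S w"
    using l1 p(3) by (simp add: short_inversion_iff)
qed

text \<open>The only new inversion is \<open>act z (simple_root p)\<close>. It is no inversion of
  \<open>w\<close> by the assumption on \<open>inv z \<otimes> w\<close>, and it pairs positively
  with \<beta> by invariance of the form.\<close>

lemma strippable_mult_gen:
  assumes w: "w \<in> carrier G" and st: "strippable w \<beta> z" and p: "p \<in> S"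
    and b: "\<beta> \<in> short_inversions G S w"
    and np: "simple_root p \<notin> inversions (inv z \<otimes> w)" and f: "0 < form (act (inv z) \<beta>) (simple_root p)"
  shows "strippable w \<beta> (z \<otimes> p)"
proof -
  have z: "z \<in> carrier G" using st by (simp add: strippable_def)
  note facts = strippable_facts[OF w b st]
  have "simple_root p \<notin> inversions (inv z)" using np facts(2) by auto
  then have h: "0 < height (act z (simple_root p))"
    using not_inversion_height[OF simple_pos_root[OF p], of "inv z"] z by simp
  then have up: "len (z \<otimes> p) = len z + 1"
    using height_act_simple[OF z p] len_mult_gen_cases[OF p z] by auto
  have "0 < height (act (inv (inv z \<otimes> w)) (simple_root p))"
    using not_inversion_height[OF simple_pos_root[OF p] _ np] z w by simp
  then have "act z (simple_root p) \<notin> inversions w"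
    using inversions_height[of "act z (simple_root p)" w] z w by (auto simp: inv_mult_group act_mult)
  moreover have "0 < form \<beta> (act z (simple_root p))"
    using f form_act_left[of "inv z" \<beta> "simple_root p"] z by simp
  ultimately show ?thesis
    using st z p inversions_mult_gen[OF z p up] by (auto simp: strippable_def)
qed

text \<open>
  Strip off \<open>z\<close> with \<open>\<beta>\<^sub>z = z\<^sup>-\<^sup>1 \<beta>\<close> non-simple of least depth and pick \<open>p\<close> with \<open>\<langle>\<beta>\<^sub>z, \<alpha>\<^sub>p\<rangle> > 0\<close>. Either
  \<open>p\<close> is a left descent of \<open>z\<^sup>-\<^sup>1 w\<close> and the plane of \<open>\<beta>\<^sub>z, \<alpha>\<^sub>p\<close> gives the decomposition, or
  \<open>s\<^sub>p \<beta>\<^sub>z = \<alpha>\<^sub>t\<close> is simple and the decomposition is found in the parabolic of type \<open>{p, t}\<close>.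
\<close>

lemma short_inversion_decomposition:
  assumes w: "w \<in> carrier G" and b: "\<beta> \<in> short_inversions G S w" and ns: "\<beta> \<notin> simple_root ` S"
  obtains \<gamma> \<delta> a c where "\<gamma> \<in> short_inversions G S w" "\<delta> \<in> pos_roots G S" "\<delta> \<notin> inversions w"
    "0 < a" "0 < c" "\<beta> = (\<lambda>t. a * \<gamma> t + c * \<delta> t)"
proof -
  have bp: "\<beta> \<in> pos_roots G S" using b by (simp add: short_inversion_iff)
  note br = pos_root_root[OF bp]
  have bw: "\<beta> \<in> inversions w" using short_inversion_inversion[OF w b] .
  define Q where "Q z \<longleftrightarrow> strippable w \<beta> z \<and> act (inv z) \<beta> \<notin> simple_root ` S" for z
  have "Q \<one>" using ns by (simp add: Q_def strippable_def)
  \<comment> \<open>The length of the reflection serves as the depth of the root.\<close>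
  then obtain z where Qz: "Q z" and zmin: "\<And>y. Q y \<Longrightarrow> len (rrefl (act (inv z) \<beta>)) \<le> len (rrefl (act (inv y) \<beta>))"
    using ex_has_least_nat[of Q \<one> "\<lambda>z. len (rrefl (act (inv z) \<beta>))"] by blast
  have st: "strippable w \<beta> z" using Qz by (simp add: Q_def)
  have z: "z \<in> carrier G" and zw: "inversions z \<inter> inversions w = {}"
    and zf: "\<And>\<xi>. \<xi> \<in> inversions z \<Longrightarrow> 0 < form \<beta> \<xi>"
    using st by (auto simp: strippable_def)
  note facts = strippable_facts[OF w b st]
  define bz where "bz = act (inv z) \<beta>"
  define wz where "wz = inv z \<otimes> w"
  have wz: "wz \<in> carrier G" using z w by (simp add: wz_def)
  have bzs: "bz \<in> short_inversions G S wz" using facts(3) by (simp add: bz_def wz_def)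
  then have bzp: "bz \<in> pos_roots G S" by (simp add: short_inversion_iff)
  note bzr = pos_root_root[OF bzp]
  have act_bz: "act z bz = \<beta>" using z by (simp add: bz_def)
  have height_wz: "height (act (inv wz) v) = height (act (inv w) (act z v))" for v
    using z w by (simp add: wz_def inv_mult_group act_mult)
  have form_z: "form \<beta> (act z v) = form bz v" for v
    using form_act_left[of "inv z" \<beta> v] z by (simp add: bz_def)
  \<comment> \<open>The norm 1 of \<open>bz\<close> is the sum of its nonnegative coefficients times
    its pairings with the simple roots, so some pairing is positive.\<close>
  have "\<exists>p\<in>S. 0 < form bz (simple_root p)"
  proof (rule ccontr)
    assume "\<not> ?thesis"
    then have "form bz bz \<le> 0"
      using pos_root_nonneg[OF bzp] unfolding form_expand[of bz bz]
      by (intro sum_nonpos) (auto simp: mult_nonneg_nonpos not_less)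
    then show False using root_form[OF bzr] by simp
  qed
  then obtain p where p: "p \<in> S" and cpos: "0 < form bz (simple_root p)" by blast
  define c where "c = form bz (simple_root p)"
  have c: "0 < c" using cpos by (simp add: c_def)
  have bz_neq: "bz \<noteq> simple_root p" using Qz p by (auto simp: Q_def bz_def)
  obtain q where q: "q \<in> S" "q \<noteq> p" "0 < bz q" using pos_root_other_coeff[OF bzp p bz_neq] .
  \<comment> \<open>In the plane of \<open>bz\<close> and \<open>\<alpha>\<^sub>p\<close>, the root
    \<delta>0 puts \<open>bz\<close> between itself and \<open>\<alpha>\<^sub>p\<close>. Its
    coefficient at \<open>q\<close>, inherited from \<open>bz\<close>, shows that it is
    positive.\<close>
  define \<delta>0 where "\<delta>0 = (\<lambda>t. - act (rrefl bz) (simple_root p) t)"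
  have d0: "\<delta>0 = (\<lambda>t. (2 * c) * bz t + (- 1) * simple_root p t)"
    using bzr form_commute[of "simple_root p" bz] by (simp add: \<delta>0_def act_rrefl c_def fun_eq_iff)
  have d0q: "0 < \<delta>0 q" using q c by (simp add: d0 simple_root_def)
  have d0r: "\<delta>0 \<in> roots G S"
    using uminus_root[OF act_root[OF simple_in_roots[OF p], of "rrefl bz"]] bzr by (simp add: \<delta>0_def)
  have d0p: "\<delta>0 \<in> pos_roots G S" using pos_root_posI[OF d0r q(1) d0q] .
  show ?thesis
  proof (cases "simple_root p \<in> inversions wz")
    case True
    \<comment> \<open>The descent \<open>p\<close> survives the reflection in \<open>bz\<close>, so
      \<delta>0 is not inverted by \<open>wz\<close>. Transporting
      \<open>2 * c * bz = simple_root p + \<delta>0\<close> by \<open>z\<close> gives the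
      decomposition.\<close>
    have "simple_root p \<in> inversions (rrefl bz \<otimes> wz)"
      using short_inversion_descent[OF wz bzs p True bz_neq] .
    from inversions_height[OF this] have "0 < height (act (inv wz) \<delta>0)"
      using bzr wz by (simp add: inv_mult_group act_mult \<delta>0_def act_uminus)
    then have hd: "0 < height (act (inv w) (act z \<delta>0))" by (simp add: height_wz)
    have "\<delta>0 \<notin> inversions wz" using \<open>0 < height (act (inv wz) \<delta>0)\<close> inversions_height[of \<delta>0 wz] by auto
    then have "\<delta>0 \<notin> inversions (inv z)" using facts(2) by (auto simp: wz_def)
    then have dp: "act z \<delta>0 \<in> pos_roots G S"
      using not_inversion_height[OF d0p, of "inv z"] act_root[OF d0r z] z by (simp add: pos_root_iff)
    have dn: "act z \<delta>0 \<notin> inversions w" using hd inversions_height[of "act z \<delta>0" w] by auto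
    \<comment> \<open>Otherwise the opposite root is an inversion of \<open>z\<close>, so it pairs
      positively with \<beta>; but the pairing is \<open>- c\<close>.\<close>
    have gp: "act z (simple_root p) \<in> pos_roots G S"
    proof (rule ccontr)
      assume "act z (simple_root p) \<notin> pos_roots G S"
      then have n: "height (act z (simple_root p)) < 0"
        using rootI[OF z p] root_height_nonzero[of "act z (simple_root p)"] by (simp add: pos_root_iff)
      let ?\<xi> = "\<lambda>t. - act z (simple_root p) t"
      have "?\<xi> \<in> pos_roots G S" using n uminus_root[OF rootI[OF z p]] by (simp add: pos_root_iff)
      then have "?\<xi> \<in> inversions z" using z p by (simp add: inversions_iff act_uminus)
      then have "0 < form \<beta> ?\<xi>" by (rule zf)
      moreover have "form \<beta> ?\<xi> = - c"
        using form_lincomb_right[of \<beta> "- 1" "act z (simple_root p)" 0 "act z (simple_root p)"] form_z[of "simple_root p"]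
        by (simp add: c_def)
      ultimately show False using c by simp
    qed
    have gs: "act z (simple_root p) \<in> short_inversions G S w"
      using facts(4)[OF p _ gp] True by (simp add: wz_def)
    have "act z \<delta>0 = (\<lambda>t. (2 * c) * \<beta> t + (- 1) * act z (simple_root p) t)"
      unfolding d0 act_lincomb[OF z] act_bz ..
    then have "\<beta> = (\<lambda>t. (1 / (2 * c)) * act z (simple_root p) t + (1 / (2 * c)) * act z \<delta>0 t)"
      using c by (simp add: fun_eq_iff field_simps)
    then show ?thesis using that[OF gs dp dn, of "1 / (2 * c)" "1 / (2 * c)"] c by simp
  next
    case False
    \<comment> \<open>Now \<open>z \<otimes> p\<close> can be stripped off too and gives a root of
      smaller depth, so by minimality that root is simple.\<close>
    have stp: "strippable w \<beta> (z \<otimes> p)"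
      using strippable_mult_gen[OF w st p b] False cpos by (simp add: wz_def bz_def)
    have "act (inv (z \<otimes> p)) \<beta> = act p bz"
      using z p by (simp add: inv_mult_group act_mult bz_def)
    moreover have "len (rrefl (act p bz)) < len (rrefl bz)"
    proof -
      have rc: "rrefl bz \<in> carrier G" using bzr by simp
      have e: "act (rrefl bz) (simple_root p) = (\<lambda>t. - \<delta>0 t)" by (simp add: \<delta>0_def)
      have "len (rrefl bz \<otimes> p) < len (rrefl bz)"
        using height_act_simple[OF rc p] pos_root_height[OF d0p] by (simp add: e)
      then have l1: "len (p \<otimes> rrefl bz) < len (rrefl bz)"
        using len_mult_gen[OF p rc] bzr by simp
      have "\<delta>0 \<noteq> simple_root p" using d0q q(2) by (auto simp: simple_root_def)
      then have "act p \<delta>0 \<in> pos_roots G S" by (rule gen_permutes_pos_roots[OF d0p p])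
      then have "height (act (p \<otimes> rrefl bz) (simple_root p)) < 0"
        using pos_root_height[of "act p \<delta>0"] p rc by (simp add: act_mult e act_uminus)
      then have "len (p \<otimes> rrefl bz \<otimes> p) < len (p \<otimes> rrefl bz)"
        using height_act_simple[of "p \<otimes> rrefl bz" p] p rc by simp
      then show ?thesis using l1 rrefl_act[OF bzr, of p] p by simp
    qed
    ultimately have "act p bz \<in> simple_root ` S"
      using zmin[of "z \<otimes> p"] stp by (auto simp: Q_def bz_def[symmetric] not_le)
    then obtain t where t: "t \<in> S" "act p bz = simple_root t" by auto
    have bz_t: "bz = srefl p (simple_root t)"
      using arg_cong[OF t(2), of "act p"] p by (simp add: act_gen)
    have tp: "t \<noteq> p"
    proof
      assume "t = p"
      then have "height bz = - 1" using bz_t p by (simp add: srefl_self)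
      then show False using pos_root_height[OF bzp] by simp
    qed
    have bz_e: "bz = (\<lambda>x. simple_root t x - 2 * gram t p * simple_root p x)"
      using bz_t srefl_simple[OF p t(1)] by simp
    have "c = - gram t p"
      unfolding c_def bz_t using form_srefl_self[OF p] form_simple_simple[OF t(1) p] by simp
    then have bz_p: "bz p = 2 * c" using tp by (simp add: bz_e simple_root_def)
    define J where "J = {p, t}"
    have J: "J \<subseteq> S" using p t by (simp add: J_def)
    \<comment> \<open>A shortest \<open>z'\<close> with \<open>K z'\<close> keeps the simple roots
      of \<open>J\<close> positive and is strippable like \<open>z\<close>. Since
      \<open>inv z' \<otimes> z\<close> lies in \<open>W\<^sub>J\<close>, the root \<open>b'\<close>
      is a combination of the two simple roots of \<open>J\<close>.\<close>
    define K where "K z' \<longleftrightarrow> z' \<in> carrier G \<and> inversions z' \<subseteq> inversions z \<and> inv z' \<otimes> z \<in> generate G J" for z'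
    have "K z" using z by (simp add: K_def generate.one)
    then obtain z' where Kz': "K z'" and z'min: "\<And>y. K y \<Longrightarrow> len z' \<le> len y"
      using ex_has_least_nat[of K z len] by blast
    have z': "z' \<in> carrier G" and z'sub: "inversions z' \<subseteq> inversions z" and yJ: "inv z' \<otimes> z \<in> generate G J"
      using Kz' by (auto simp: K_def)
    have st': "strippable w \<beta> z'" using st z' z'sub by (auto simp: strippable_def)
    note facts' = strippable_facts[OF w b st']
    have posJ: "act z' (simple_root j) \<in> pos_roots G S" if j: "j \<in> J" for j
    proof (rule ccontr)
      assume np: "act z' (simple_root j) \<notin> pos_roots G S"
      have jS: "j \<in> S" using j J by auto
      have "height (act z' (simple_root j)) < 0"
        using np rootI[OF z' jS] root_height_nonzero[of "act z' (simple_root j)"] by (simp add: pos_root_iff)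
      then have l: "len z' = len (z' \<otimes> j) + 1"
        using height_act_simple[OF z' jS] len_mult_gen_cases[OF jS z'] by auto
      have "inversions (z' \<otimes> j) \<subseteq> inversions z'"
        using inversions_mult_left[of "z' \<otimes> j" j] l z' jS by simp
      moreover have "inv (z' \<otimes> j) \<otimes> z \<in> generate G J"
        using generate.eng[OF generate.incl[OF j] yJ] z z' jS by (simp add: inv_mult_group m_assoc)
      ultimately have "K (z' \<otimes> j)" using z' jS z'sub by (auto simp: K_def)
      then show False using z'min l by fastforce
    qed
    define y where "y = inv z' \<otimes> z"
    have y: "y \<in> carrier G" "y \<in> generate G J" "z = z' \<otimes> y" using z z' yJ by (simp_all add: y_def)
    have ly: "len (z' \<otimes> y) = len z' + len y"
    proof -
      have "int (len (inv z' \<otimes> z)) = int (len z) - int (len z')" using weak_le_iff[OF z' z] z'sub by blast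
      then have "len z = len z' + len y" unfolding y_def by linarith
      then show ?thesis unfolding y(3)[symmetric] .
    qed
    define b' where "b' = act (inv z') \<beta>"
    define H where "H j = height (act (inv w) (act z' (simple_root j)))" for j
    have b'p: "b' \<in> pos_roots G S" using facts'(3) by (simp add: short_inversion_iff b'_def)
    have act_b': "act z' b' = \<beta>" using z' by (simp add: b'_def)
    have "b' = act y bz" using z z' by (simp add: b'_def bz_def y_def act_mult)
    then have b'off: "b' x = 0" if "x \<notin> J" for x
      using act_off_subset[OF J y(2) that, of bz] that by (simp add: bz_e simple_root_def J_def)
    have b'_e: "b' = (\<lambda>x. b' p * simple_root p x + b' t * simple_root t x)"
      using b'off tp by (auto simp: simple_root_def J_def fun_eq_iff)
    have b'H: "b' p * H p + b' t * H t < 0"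
    proof -
      have "\<beta> = (\<lambda>x. b' p * act z' (simple_root p) x + b' t * act z' (simple_root t) x)"
        using arg_cong[OF b'_e, of "act z'"] act_lincomb[OF z'] act_b' by simp
      then have "height (act (inv w) \<beta>) = b' p * H p + b' t * H t"
        using height_act_lincomb[of "inv w" "b' p" "act z' (simple_root p)" "b' t" "act z' (simple_root t)"] w
        by (simp add: H_def)
      then show ?thesis using inversions_height[OF bw] by simp
    qed
    \<comment> \<open>If \<open>z' = z\<close>, then \<open>h = p\<close> works. Otherwise take a
      left descent \<open>j\<close> of \<open>y\<close>: the root
      \<open>act z' (simple_root j)\<close> is an inversion of \<open>z\<close>, hence not of
      \<open>w\<close>, and it pairs positively with \<beta>. As distinct simple roots pair
      nonpositively, the coefficient of \<open>b'\<close> at \<open>j\<close> is positive.\<close>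
    have "\<exists>g h. {g, h} = J \<and> 0 < H h \<and> 0 < b' h"
    proof (cases "y = \<one>")
      case True
      then have zz: "z' = z" using y z' by simp
      then have "b' = bz" by (simp add: b'_def bz_def)
      moreover have "0 < H p"
        using not_inversion_height[OF simple_pos_root[OF p] wz False] height_wz[of "simple_root p"] by (simp add: H_def zz)
      ultimately show ?thesis using bz_p c by (intro exI[of _ t] exI[of _ p]) (auto simp: J_def)
    next
      case False
      obtain j where j: "j \<in> S" "len y = len (j \<otimes> y) + 1" using left_descent_exists[OF y(1) False] .
      have jy: "simple_root j \<in> inversions y" using simple_inversion[OF y(1) j(1)] j(2) by simp
      have jJ: "j \<in> J"
      proof (rule ccontr)
        assume nj: "j \<notin> J"
        have "inv y \<in> generate G J" using generate_m_inv_closed[OF _ y(2)] J gens_closed by blast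
        from act_off_subset[OF J this nj, of "simple_root j"]
        have "0 < act (inv y) (simple_root j) j" by (simp add: simple_root_def)
        then have "act (inv y) (simple_root j) \<in> pos_roots G S"
          using pos_root_posI[OF rootI[of "inv y" j] j(1)] y j by simp
        then show False using inversions_height[OF jy] pos_root_height by fastforce
      qed
      have jz: "act z' (simple_root j) \<in> inversions z"
        using inversions_mult_right[OF z' y(1) ly jy] y(3) by simp
      then have "act z' (simple_root j) \<notin> inversions w" using zw by auto
      then have Hj: "0 < H j"
        using not_inversion_height[OF posJ[OF jJ] w] by (simp add: H_def)
      have "0 < form \<beta> (act z' (simple_root j))" using zf[OF jz] .
      then have fj: "0 < form b' (simple_root j)"
        using form_act_left[of "inv z'" \<beta> "simple_root j"] z' by (simp add: b'_def)
      obtain g where g: "{g, j} = J" "g \<in> S" "g \<noteq> j" using jJ tp p t by (auto simp: J_def)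
      have "b' = (\<lambda>x. b' g * simple_root g x + b' j * simple_root j x)"
        using b'off g tp by (auto simp: simple_root_def fun_eq_iff)
      then have "form b' (simple_root j) = b' g * gram g j + b' j"
        using form_lincomb_left[of "b' g" "simple_root g" "b' j" "simple_root j" "simple_root j"] g j
        by (simp add: form_simple_simple)
      moreover have "b' g * gram g j \<le> 0"
        using pos_root_nonneg[OF b'p, of g] gram_nonpos[OF g(2) j(1) g(3)] by (simp add: mult_nonneg_nonpos)
      ultimately have "0 < b' j" using fj by simp
      then show ?thesis using g(1) Hj by blast
    qed
    then obtain g h where gh: "{g, h} = J" "0 < H h" "0 < b' h" by blast
    have ghS: "g \<in> S" "h \<in> S" "g \<in> J" "h \<in> J" "g \<noteq> h" using gh(1) J tp by (auto simp: J_def doubleton_eq_iff)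
    \<comment> \<open>\<beta> is an inversion of \<open>w\<close>, so the total is negative while
      the share of \<open>h\<close> is positive. Hence \<open>g\<close> supplies the short inversion
      and \<open>h\<close> the root outside the inversions.\<close>
    have sum_gh: "b' g * H g + b' h * H h < 0"
      using b'H gh(1) tp by (auto simp: J_def doubleton_eq_iff)
    moreover have "0 < b' h * H h" using gh by simp
    ultimately have neg: "b' g * H g < 0" by simp
    have "0 \<le> b' g" using pos_root_nonneg[OF b'p] .
    then have bg: "0 < b' g" and Hg: "H g < 0"
      using neg by (auto simp: mult_less_0_iff)
    have "simple_root g \<in> inversions (inv z' \<otimes> w)"
      using Hg ghS z' w by (simp add: inversions_iff simple_pos_root inv_mult_group act_mult H_def)
    then have gs: "act z' (simple_root g) \<in> short_inversions G S w"
      using facts'(4)[OF ghS(1) _ posJ[OF ghS(3)]] by simp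
    have hn: "act z' (simple_root h) \<notin> inversions w"
      using gh(2) inversions_height[of "act z' (simple_root h)" w] by (auto simp: H_def)
    have "b' = (\<lambda>x. b' g * simple_root g x + b' h * simple_root h x)"
      using b'off gh(1) ghS(5) by (auto simp: simple_root_def fun_eq_iff)
    then have "\<beta> = (\<lambda>x. b' g * act z' (simple_root g) x + b' h * act z' (simple_root h) x)"
      using act_lincomb[OF z', of "b' g" "simple_root g" "b' h" "simple_root h"] act_b' by simp
    then show ?thesis using that[OF gs posJ[OF ghS(4)] hn bg gh(3)] by simp
  qed
qed

text \<open>Among the short inversions whose image under \<open>inv w\<close> has at least the
  support of that of \<beta>, take one that maximises the ratio \<open>f\<close>. If it were not
  simple, its decomposition would give another candidate: the second summand has a nonnegative
  image, so it cannot supply the negative coefficients, and it lowers \<open>f\<close>.\<close>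

lemma short_inversion_support:
  assumes w: "w \<in> carrier G" and b: "\<beta> \<in> short_inversions G S w"
  obtains s where "s \<in> S" "simple_root s \<in> inversions w"
    "\<And>t. t \<in> S \<Longrightarrow> act (inv w) \<beta> t \<noteq> 0 \<Longrightarrow> act (inv w) (simple_root s) t \<noteq> 0"
proof -
  define P where "P \<gamma> \<longleftrightarrow> (\<forall>t\<in>S. act (inv w) \<beta> t \<noteq> 0 \<longrightarrow> act (inv w) \<gamma> t \<noteq> 0)" for \<gamma>
  define A where "A = {\<gamma> \<in> short_inversions G S w. P \<gamma>}"
  define f where "f \<gamma> = - height (act (inv w) \<gamma>) / height \<gamma>" for \<gamma>
  have "A \<subseteq> inversions w" using short_inversion_inversion[OF w] by (auto simp: A_def)
  then have "finite A" using finite_inversions[OF w] finite_subset by blast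
  moreover have "A \<noteq> {}" using b by (auto simp: A_def P_def)
  ultimately obtain \<gamma> where g: "\<gamma> \<in> A" and gmax: "\<And>\<gamma>'. \<gamma>' \<in> A \<Longrightarrow> f \<gamma>' \<le> f \<gamma>"
    using finite_has_max[of A f] by blast
  have gs: "\<gamma> \<in> short_inversions G S w" and gP: "P \<gamma>" using g by (auto simp: A_def)
  have neg: "act (inv w) \<xi> t \<le> 0" if "\<xi> \<in> inversions w" "t \<in> S" for \<xi> t
  proof -
    have "act (inv w) \<xi> \<in> roots G S" using act_root[OF pos_root_root[OF inversions_pos[OF that(1)]]] w by simp
    then show ?thesis
      using pos_root_posI[of "act (inv w) \<xi>" t] that(2) inversions_height[OF that(1)] pos_root_height[of "act (inv w) \<xi>"]
      by (metis less_asym not_le)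
  qed
  have "\<gamma> \<in> simple_root ` S"
  proof (rule ccontr)
    assume "\<gamma> \<notin> simple_root ` S"
    then obtain \<gamma>' \<delta> a c where d: "\<gamma>' \<in> short_inversions G S w" "\<delta> \<in> pos_roots G S" "\<delta> \<notin> inversions w"
      "0 < a" "0 < c" "\<gamma> = (\<lambda>t. a * \<gamma>' t + c * \<delta> t)"
      using short_inversion_decomposition[OF w gs] by blast
    have iw: "inv w \<in> carrier G" using w by simp
    have hd: "0 < height (act (inv w) \<delta>)" using not_inversion_height[OF d(2) w d(3)] .
    have dp: "act (inv w) \<delta> \<in> pos_roots G S"
      using hd act_root[OF pos_root_root[OF d(2)] iw] by (simp add: pos_root_iff)
    have ag: "act (inv w) \<gamma> t = a * act (inv w) \<gamma>' t + c * act (inv w) \<delta> t" for t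
      unfolding d(6) act_lincomb[OF iw] ..
    have "act (inv w) \<gamma>' t \<noteq> 0" if "t \<in> S" "act (inv w) \<gamma> t \<noteq> 0" for t
    proof
      assume "act (inv w) \<gamma>' t = 0"
      then have "0 \<le> act (inv w) \<gamma> t" using ag[of t] d(5) pos_root_nonneg[OF dp, of t] by simp
      then show False using neg[OF short_inversion_inversion[OF w gs] that(1)] that(2) by simp
    qed
    then have "\<gamma>' \<in> A" using d(1) gP by (auto simp: A_def P_def)
    then have "f \<gamma>' \<le> f \<gamma>" by (rule gmax)
    moreover have "f \<gamma> < f \<gamma>'"
    proof -
      define X Y h k where "X = - height (act (inv w) \<gamma>')" and "Y = height (act (inv w) \<delta>)"
        and "h = height \<gamma>'" and "k = height \<delta>"
      have pos: "0 < X" "0 < Y" "0 < h" "0 < k"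
        using inversions_height[OF short_inversion_inversion[OF w d(1)]] hd d(1,2)
        by (auto simp: X_def Y_def h_def k_def short_inversion_iff pos_root_height)
      have "height (act (inv w) \<gamma>) = a * (- X) + c * Y" "height \<gamma> = a * h + c * k"
        unfolding d(6) by (simp_all add: height_act_lincomb[OF iw] height_lincomb X_def Y_def h_def k_def)
      then have fg: "f \<gamma> = (a * X - c * Y) / (a * h + c * k)" by (simp add: f_def)
      have "(a * X - c * Y) * h < X * (a * h + c * k)"
        using pos d(4,5) by (simp add: algebra_simps add_pos_pos)
      then have "(a * X - c * Y) / (a * h + c * k) < X / h"
        using pos d(4,5) by (simp add: divide_simps add_pos_pos)
      then show ?thesis by (simp add: fg) (simp add: f_def X_def h_def)
    qed
    ultimately show False by simp
  qed
  then obtain s where s: "s \<in> S" "\<gamma> = simple_root s" by auto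
  show ?thesis
    using that[OF s(1)] short_inversion_inversion[OF w gs] gP s by (auto simp: P_def)
qed

text \<open>The map \<open>i\<close>, the negative of the reflection in \<beta>, permutes the
  inversions of that reflection, and \<xi> plus \<open>i \<xi>\<close> is a multiple of \<beta>. If
  no \<xi> other than \<beta> had both \<xi> and \<open>i \<xi>\<close> among the inversions of
  \<open>x\<close>, counting would show that reflecting \<open>x\<close> loses at most one letter,
  so \<beta> would be short.\<close>

lemma inversion_decomposition:
  assumes x: "x \<in> carrier G" and b: "\<beta> \<in> inversions x" and nb: "\<beta> \<notin> short_inversions G S x"
  obtains \<xi> \<eta> c where "\<xi> \<in> inversions x" "\<eta> \<in> inversions x" "\<xi> \<noteq> \<beta>" "0 < c" "\<And>t. c * \<beta> t = \<xi> t + \<eta> t"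
proof -
  have bp: "\<beta> \<in> pos_roots G S" using b by (rule inversions_pos)
  note br = pos_root_root[OF bp]
  define r where "r = rrefl \<beta>"
  have r: "r \<in> carrier G" "inv r = r" using br by (simp_all add: r_def)
  define i where "i \<xi> = (\<lambda>t. - act r \<xi> t)" for \<xi>
  have i_e: "i \<xi> = (\<lambda>t. 2 * form \<xi> \<beta> * \<beta> t - \<xi> t)" for \<xi>
    using br by (simp add: i_def r_def act_rrefl fun_eq_iff)
  have i_i: "i (i \<xi>) = \<xi>" for \<xi>
  proof -
    have "act r (act r \<xi>) = \<xi>" using act_inv_act[OF r(1), of \<xi>] r(2) by simp
    then show ?thesis using act_uminus[OF r(1), of "act r \<xi>"] by (simp add: i_def)
  qed
  have iN: "i \<xi> \<in> inversions r" if "\<xi> \<in> inversions r" for \<xi>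
  proof -
    have "i \<xi> \<in> roots G S" using uminus_root[OF act_root[OF pos_root_root[OF inversions_pos[OF that]] r(1)]] by (simp add: i_def)
    moreover have "0 < height (i \<xi>)" using inversions_height[OF that] r(2) by (simp add: i_def)
    moreover have "act r (i \<xi>) = (\<lambda>t. - \<xi> t)" using i_i[of \<xi>] by (simp add: i_def fun_eq_iff) (metis minus_equation_iff)
    ultimately show ?thesis
      using pos_root_height[OF inversions_pos[OF that]] r(2) by (simp add: inversions_def pos_root_iff)
  qed
  have "\<exists>\<xi>\<in>inversions r \<inter> inversions x. \<xi> \<noteq> \<beta> \<and> i \<xi> \<in> inversions x"
  proof (rule ccontr)
    assume no: "\<not> ?thesis"
    let ?C = "inversions r \<inter> inversions x"
    have "i ` (?C - {\<beta>}) \<subseteq> inversions r - inversions x" using no iN by auto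
    then have "card (i ` (?C - {\<beta>})) \<le> card (inversions r - inversions x)" using r(1) by (intro card_mono) auto
    moreover have "inj_on i (?C - {\<beta>})" by (metis i_i inj_onI)
    ultimately have c1: "card (?C - {\<beta>}) \<le> card (inversions r - inversions x)" by (simp add: card_image)
    have fin: "finite ?C" using x by simp
    have "card ?C \<le> card (?C - {\<beta>}) + 1"
    proof (cases "\<beta> \<in> ?C")
      case True
      then show ?thesis using card_Suc_Diff1[OF fin True] by linarith
    next
      case False
      then have "?C - {\<beta>} = ?C" by auto
      then show ?thesis by simp
    qed
    moreover have "len r = card (inversions r - inversions x) + card ?C"
      using card_Int_Diff[of "inversions r" "inversions x"] card_inversions[OF r(1)] r(1) by simp
    ultimately have "2 * card ?C \<le> len r + 1" using c1 by linarith
    then have "len x \<le> len (r \<otimes> x) + 1" using len_quotient_inter[OF r(1) x] r(2) by simp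
    then show False using nb bp inversion_iff_len[OF bp x] b by (simp add: short_inversion_iff r_def)
  qed
  then obtain \<xi> where xi: "\<xi> \<in> inversions r" "\<xi> \<in> inversions x" "\<xi> \<noteq> \<beta>" "i \<xi> \<in> inversions x" by auto
  have "0 < height (i \<xi>)" using iN[OF xi(1)] inversions_pos pos_root_height by blast
  moreover have "height (i \<xi>) = 2 * form \<xi> \<beta> * height \<beta> - height \<xi>"
    using height_lincomb[of "2 * form \<xi> \<beta>" \<beta> "- 1" \<xi>] by (simp add: i_e)
  moreover have "0 < height \<xi>" using xi(1) inversions_pos pos_root_height by blast
  ultimately have "0 < 2 * form \<xi> \<beta> * height \<beta>" by linarith
  then have "0 < 2 * form \<xi> \<beta>" using pos_root_height[OF bp] zero_less_mult_pos2 by blast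
  then show ?thesis by (intro that[OF xi(2,4,3), of "2 * form \<xi> \<beta>"]) (simp_all add: i_e)
qed

text \<open>
  The short inversions span the extreme rays of the cone of \<open>\<Phi>(x)\<close>: an inversion outside \<open>\<Phi>(g)\<close>
  that is extremal for the functional \<open>g\<^sup>-\<^sup>1\<close>, with ties broken by a strictly convex function, is short.
\<close>

lemma inversions_subset_if_short:
  assumes x: "x \<in> carrier G" and g: "g \<in> carrier G" and short: "short_inversions G S x \<subseteq> inversions g"
  shows "inversions x \<subseteq> inversions g"
proof (rule ccontr)
  assume ns: "\<not> inversions x \<subseteq> inversions g"
  define D where "D = inversions x - inversions g"
  define F where "F \<beta> = height (act (inv g) \<beta>)" for \<beta>
  \<comment> \<open>Dividing by the height restricts the functional to the slice of height 1 of the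
    cone.\<close>
  define \<phi> where "\<phi> \<beta> = F \<beta> / height \<beta>" for \<beta>
  have D: "finite D" "D \<noteq> {}" using ns x by (auto simp: D_def)
  then obtain \<beta>0 where b0: "\<beta>0 \<in> D" and b0max: "\<And>\<beta>. \<beta> \<in> D \<Longrightarrow> \<phi> \<beta> \<le> \<phi> \<beta>0"
    using finite_has_max[of D \<phi>] by blast
  define m where "m = \<phi> \<beta>0"
  define A where "A = {\<beta> \<in> D. \<phi> \<beta> = m}"
  \<comment> \<open>The squared norm on that slice. A maximiser among the ties cannot lie strictly
    between two distinct tied points.\<close>
  define q where "q \<beta> = (\<Sum>s\<in>S. (\<beta> s / height \<beta>)\<^sup>2)" for \<beta>
  have "finite A" "A \<noteq> {}" using D(1) b0 by (auto simp: A_def m_def)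
  then obtain \<beta> where b: "\<beta> \<in> A" and bmax: "\<And>\<gamma>. \<gamma> \<in> A \<Longrightarrow> q \<gamma> \<le> q \<beta>"
    using finite_has_max[of A q] by blast
  have bD: "\<beta> \<in> D" and bm: "\<phi> \<beta> = m" using b by (auto simp: A_def)
  have bx: "\<beta> \<in> inversions x" and bg: "\<beta> \<notin> inversions g" using bD by (auto simp: D_def)
  have hpos: "0 < height \<xi>" if "\<xi> \<in> inversions x" for \<xi> using that inversions_pos pos_root_height by blast
  have FD: "0 < F \<xi>" if "\<xi> \<in> D" for \<xi>
    using that not_inversion_height[OF inversions_pos[of \<xi> x] g] by (simp add: D_def F_def)
  have m: "0 < m" using FD[OF b0] hpos b0 by (simp add: m_def \<phi>_def D_def)
  have "\<beta> \<notin> short_inversions G S x" using bg short by auto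
  then obtain \<xi> \<eta> c where d: "\<xi> \<in> inversions x" "\<eta> \<in> inversions x" "\<xi> \<noteq> \<beta>" "0 < c" "\<And>t. c * \<beta> t = \<xi> t + \<eta> t"
    using inversion_decomposition[OF x bx] by blast
  have le: "F \<gamma> \<le> m * height \<gamma>" if "\<gamma> \<in> inversions x" for \<gamma>
  proof (cases "\<gamma> \<in> D")
    case True
    then have "\<phi> \<gamma> \<le> m" using b0max by (simp add: m_def)
    then show ?thesis using hpos[OF that] by (simp add: \<phi>_def divide_simps split: if_splits)
  next
    case False
    then have "F \<gamma> < 0" using that inversions_height[of \<gamma> g] by (simp add: D_def F_def)
    moreover have "0 < m * height \<gamma>" using m hpos[OF that] by simp
    ultimately show ?thesis by simp
  qed
  have cb: "(\<lambda>t. c * \<beta> t + 0 * \<beta> t) = (\<lambda>t. 1 * \<xi> t + 1 * \<eta> t)" using d(5) by simp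
  have hsum: "c * height \<beta> = height \<xi> + height \<eta>"
    using arg_cong[OF cb, of height] unfolding height_lincomb by simp
  have ig: "inv g \<in> carrier G" using g by simp
  have Fsum: "c * F \<beta> = F \<xi> + F \<eta>"
    using arg_cong[OF cb, of "\<lambda>v. height (act (inv g) v)"] unfolding height_act_lincomb[OF ig] by (simp add: F_def)
  have "F \<beta> = m * height \<beta>" using bm hpos[OF bx] by (simp add: \<phi>_def field_simps)
  then have "F \<xi> + F \<eta> = m * height \<xi> + m * height \<eta>"
    using Fsum hsum by (metis distrib_left mult.left_commute)
  \<comment> \<open>Neither summand exceeds the bound in \<open>le\<close> and their sum attains it,
    so both attain it.\<close>
  then have eq: "F \<xi> = m * height \<xi>" "F \<eta> = m * height \<eta>" using le[OF d(1)] le[OF d(2)] by linarith+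
  have inA: "\<gamma> \<in> A" if "\<gamma> \<in> inversions x" "F \<gamma> = m * height \<gamma>" for \<gamma>
  proof -
    have "0 < F \<gamma>" using that m hpos by simp
    then have "\<gamma> \<notin> inversions g" using inversions_height[of \<gamma> g] by (auto simp: F_def)
    moreover have "\<phi> \<gamma> = m" using that hpos[OF that(1)] by (simp add: \<phi>_def)
    ultimately show ?thesis using that(1) by (simp add: A_def D_def)
  qed
  have qle: "q \<xi> \<le> q \<beta>" "q \<eta> \<le> q \<beta>" using bmax inA d eq by auto
  define l where "l = height \<xi> / (c * height \<beta>)"
  have h: "0 < height \<xi>" "0 < height \<eta>" "0 < height \<beta>" using hpos d bx by auto
  have l: "0 < l" "l < 1" using h hsum d(4) by (simp_all add: l_def)
  have l1: "1 - l = height \<eta> / (c * height \<beta>)" using h d(4) hsum by (simp add: l_def field_simps)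
  have "\<beta> s / height \<beta> = l * (\<xi> s / height \<xi>) + (1 - l) * (\<eta> s / height \<eta>)" for s
  proof -
    have "l * (\<xi> s / height \<xi>) + (1 - l) * (\<eta> s / height \<eta>) = (\<xi> s + \<eta> s) / (c * height \<beta>)"
      unfolding l1 using h by (simp add: l_def add_divide_distrib)
    also have "\<dots> = \<beta> s / height \<beta>" using d(4,5) by (simp flip: d(5))
    finally show ?thesis by simp
  qed
  \<comment> \<open>The rescaled \<beta> lies strictly between the rescaled \<xi> and \<eta>, so
    these coincide. Then \<xi> is proportional to \<beta>, which is excluded.\<close>
  then have veq: "\<xi> s / height \<xi> = \<eta> s / height \<eta>" if "s \<in> S" for s
    using strict_convexity_sum_squares[OF finite_gens l, of "\<lambda>s. \<beta> s / height \<beta>" "\<lambda>s. \<xi> s / height \<xi>" "\<lambda>s. \<eta> s / height \<eta>"]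
      qle that by (simp add: q_def)
  have "\<xi> = \<beta>"
  proof (rule pos_root_proportional[where c = "c * (height \<xi> / (height \<xi> + height \<eta>))"])
    fix s assume s: "s \<in> S"
    have "\<eta> s = \<xi> s / height \<xi> * height \<eta>" using veq[OF s] h by (simp add: field_simps)
    then have "c * \<beta> s = \<xi> s * ((height \<xi> + height \<eta>) / height \<xi>)" using d(5)[of s] h by (simp add: field_simps)
    then show "\<xi> s = c * (height \<xi> / (height \<xi> + height \<eta>)) * \<beta> s" using h by (simp add: field_simps)
  qed (use d bx inversions_pos in auto)
  with d(3) show False by simp
qed

section \<open>Joins in the weak order\<close>

lemma carrier_weak_order [simp]: "carrier (weak_order G S) = carrier G"
  by (simp add: weak_order_def)

lemma weak_order_le_iff:
  "x \<in> carrier G \<Longrightarrow> y \<in> carrier G \<Longrightarrow> x \<sqsubseteq>\<^bsub>weak_order G S\<^esub> y \<longleftrightarrow> inversions x \<subseteq> inversions y"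
  by (simp add: weak_order_def weak_le_iff)

text \<open>The quotient of \<open>s \<otimes> x\<close> and \<open>s \<otimes> y\<close> is that of
  \<open>x\<close> and \<open>y\<close>, and both lengths grow by one.\<close>

lemma inversions_subset_gen_mult:
  assumes s: "s \<in> S" and x: "x \<in> carrier G" and y: "y \<in> carrier G"
    and sx: "simple_root s \<notin> inversions x" and sy: "simple_root s \<notin> inversions y"
  shows "inversions (s \<otimes> x) \<subseteq> inversions (s \<otimes> y) \<longleftrightarrow> inversions x \<subseteq> inversions y"
proof -
  have "len (s \<otimes> x) = len x + 1" "len (s \<otimes> y) = len y + 1"
    using simple_inversion[OF x s] simple_inversion[OF y s] sx sy len_gen_mult_cases[OF s x] len_gen_mult_cases[OF s y]
    by auto
  moreover have "inv (s \<otimes> x) \<otimes> (s \<otimes> y) = inv x \<otimes> y"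
    using s x y by (simp add: inv_mult_group m_assoc)
  ultimately show ?thesis
    using weak_le_iff[OF x y] weak_le_iff[of "s \<otimes> x" "s \<otimes> y"] s x y by simp
qed

lemma simple_inversion_flip:
  assumes "s \<in> S" "x \<in> carrier G"
  shows "simple_root s \<in> inversions (s \<otimes> x) \<longleftrightarrow> simple_root s \<notin> inversions x"
  using simple_inversion[of x s] simple_inversion[of "s \<otimes> x" s] assms len_gen_mult_cases[of s x] by auto

text \<open>\<open>x\<close> and \<open>y\<close> invert every positive root supported on
  \<open>J\<close>. A longest \<open>c\<close> in \<open>W\<^sub>J\<close> below both therefore has
  every element of \<open>J\<close> as a right descent. If it did not invert some
  \<open>\<alpha>\<^sub>j\<close>, then writing that root as the image under \<open>c\<close> of a
  positive root supported on \<open>J\<close> would make its height nonpositive.\<close>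

lemma gen_join:
  assumes s: "s \<in> S" and t: "t \<in> S" and x: "x \<in> carrier G" and y: "y \<in> carrier G"
    and sub: "{simple_root s, simple_root t} \<subseteq> inversions x \<inter> inversions y"
  obtains c where "c \<in> carrier G" "inversions c \<subseteq> inversions x \<inter> inversions y"
    "simple_root s \<in> inversions c" "simple_root t \<in> inversions c"
proof -
  define J where "J = {s, t}"
  have J: "J \<subseteq> S" using s t by (simp add: J_def)
  have gen_sub: "generate G J \<subseteq> carrier G" using generate_incl[of J] J gens_closed by blast
  have in_inv: "\<xi> \<in> inversions w" if "\<xi> \<in> pos_roots G S" "\<And>t. t \<notin> J \<Longrightarrow> \<xi> t = 0" "w = x \<or> w = y" for \<xi> w
  proof (rule ccontr)
    have w: "w \<in> carrier G" using that(3) x y by auto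
    assume "\<xi> \<notin> inversions w"
    then have "0 < height (act (inv w) \<xi>)" using not_inversion_height[OF that(1) w] by simp
    moreover have "height (act (inv w) \<xi>) = (\<Sum>j\<in>J. \<xi> j * height (act (inv w) (simple_root j)))"
      using height_act_expand[OF J _ that(2)] w by simp
    moreover have "height (act (inv w) (simple_root j)) < 0" if "j \<in> J" for j
      using that \<open>w = x \<or> w = y\<close> sub by (intro inversions_height) (auto simp: J_def)
    then have "(\<Sum>j\<in>J. \<xi> j * height (act (inv w) (simple_root j))) \<le> 0"
      using pos_root_nonneg[OF that(1)] by (intro sum_nonpos) (simp add: mult_nonneg_nonpos less_imp_le)
    ultimately show False by simp
  qed
  define K where "K c \<longleftrightarrow> c \<in> generate G J \<and> inversions c \<subseteq> inversions x \<inter> inversions y" for c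
  have "K \<one>" by (simp add: K_def generate.one)
  moreover have "len c < len x + 1" if "K c" for c
  proof -
    have "c \<in> carrier G" "inversions c \<subseteq> inversions x" using that gen_sub by (auto simp: K_def)
    then show ?thesis using card_mono[of "inversions x" "inversions c"] x by (simp add: card_inversions less_Suc_eq_le)
  qed
  ultimately obtain c where Kc: "K c" and cmax: "\<And>c'. K c' \<Longrightarrow> len c' \<le> len c"
    using ex_has_greatest_nat[of K \<one> len "len x + 1"] by blast
  have c: "c \<in> carrier G" "c \<in> generate G J" using Kc gen_sub by (auto simp: K_def)
  have neg: "height (act c (simple_root j)) < 0" if j: "j \<in> J" for j
  proof (rule ccontr)
    have jS: "j \<in> S" using j J by auto
    assume n: "\<not> height (act c (simple_root j)) < 0"
    then have up: "len (c \<otimes> j) = len c + 1"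
      using height_act_simple[OF c(1) jS] len_mult_gen_cases[OF jS c(1)] by auto
    have "act c (simple_root j) \<in> pos_roots G S"
      using n rootI[OF c(1) jS] root_height_nonzero[of "act c (simple_root j)"] by (simp add: pos_root_iff)
    moreover have "act c (simple_root j) t = 0" if "t \<notin> J" for t
      using act_off_subset[OF J c(2) that] that j by (auto simp: simple_root_def)
    ultimately have "act c (simple_root j) \<in> inversions x \<inter> inversions y" using in_inv by blast
    then have "K (c \<otimes> j)"
      using Kc j inversions_mult_gen[OF c(1) jS up] by (auto simp: K_def intro: generate.eng generate.incl)
    then show False using cmax up by fastforce
  qed
  have "simple_root j \<in> inversions c" if j: "j \<in> J" for j
  proof (rule ccontr)
    have jS: "j \<in> S" using j J by auto
    assume "simple_root j \<notin> inversions c"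
    then have h: "0 < height (act (inv c) (simple_root j))"
      using not_inversion_height[OF simple_pos_root[OF jS] c(1)] by simp
    define \<eta> where "\<eta> = act (inv c) (simple_root j)"
    have ep: "\<eta> \<in> pos_roots G S"
      using h rootI[of "inv c" j] c(1) jS by (simp add: pos_root_iff \<eta>_def)
    have icJ: "inv c \<in> generate G J" using generate_m_inv_closed[OF _ c(2)] J gens_closed by blast
    have off: "\<eta> t = 0" if "t \<notin> J" for t
      using act_off_subset[OF J icJ that] that j by (auto simp: \<eta>_def simple_root_def)
    have "1 = height (act c \<eta>)" using c(1) jS by (simp add: \<eta>_def)
    also have "\<dots> = (\<Sum>j\<in>J. \<eta> j * height (act c (simple_root j)))"
      by (rule height_act_expand[OF J c(1) off])
    also have "\<dots> \<le> 0"
      using neg pos_root_nonneg[OF ep] by (intro sum_nonpos) (simp add: mult_nonneg_nonpos less_imp_le)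
    finally show False by simp
  qed
  then show ?thesis using that c(1) Kc by (auto simp: K_def J_def)
qed

section \<open>Meets of pairs\<close>

text \<open>
  The candidates \<open>s (s x \<and> s y)\<close>, one for each common left descent \<open>s\<close>, all coincide by \<open>gen_join\<close>.
\<close>

lemma meet_exists:
  assumes "x \<in> carrier G" "y \<in> carrier G"
  shows "\<exists>m\<in>carrier G. inversions m \<subseteq> inversions x \<inter> inversions y \<and>
    (\<forall>p\<in>carrier G. inversions p \<subseteq> inversions x \<inter> inversions y \<longrightarrow> inversions p \<subseteq> inversions m)"
  using assms
proof (induction "len x" arbitrary: x y rule: less_induct)
  case less
  note x = less.prems(1) and y = less.prems(2)
  let ?I = "inversions x \<inter> inversions y"
  define D where "D = {s \<in> S. simple_root s \<in> ?I}"
  \<comment> \<open>A nontrivial common lower bound has a left descent, which is then one of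
    \<open>x\<close> and of \<open>y\<close>.\<close>
  have desc: "p = \<one> \<or> (\<exists>t\<in>D. simple_root t \<in> inversions p)" if p: "p \<in> carrier G" "inversions p \<subseteq> ?I" for p
  proof (cases "p = \<one>")
    case False
    then obtain t where t: "t \<in> S" "len p = len (t \<otimes> p) + 1" using left_descent_exists[OF p(1)] by blast
    then have "simple_root t \<in> inversions p" using simple_inversion[OF p(1) t(1)] by simp
    then show ?thesis using p(2) t(1) by (auto simp: D_def)
  qed simp
  \<comment> \<open>The largest common lower bound with descent \<open>s\<close> is \<open>s\<close>
    times the meet of \<open>s \<otimes> x\<close> and \<open>s \<otimes> y\<close>, given by
    induction.\<close>
  have "\<forall>s\<in>D. \<exists>m. m \<in> carrier G \<and> inversions m \<subseteq> ?I \<and> simple_root s \<in> inversions m \<and>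
      (\<forall>p\<in>carrier G. simple_root s \<in> inversions p \<longrightarrow> inversions p \<subseteq> ?I \<longrightarrow> inversions p \<subseteq> inversions m)"
  proof
    fix s assume "s \<in> D"
    then have s: "s \<in> S" "simple_root s \<in> inversions x" "simple_root s \<in> inversions y" by (auto simp: D_def)
    have lt: "len (s \<otimes> x) < len x" using simple_inversion[OF x s(1)] s(2) by simp
    have c: "s \<otimes> x \<in> carrier G" "s \<otimes> y \<in> carrier G" using s(1) x y by auto
    obtain m where m: "m \<in> carrier G" "inversions m \<subseteq> inversions (s \<otimes> x) \<inter> inversions (s \<otimes> y)"
      and mg: "\<And>p. p \<in> carrier G \<Longrightarrow> inversions p \<subseteq> inversions (s \<otimes> x) \<inter> inversions (s \<otimes> y) \<Longrightarrow> inversions p \<subseteq> inversions m"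
      using less.hyps[OF lt c] by blast
    have nsx: "simple_root s \<notin> inversions (s \<otimes> x)" "simple_root s \<notin> inversions (s \<otimes> y)"
      using simple_inversion_flip[OF s(1)] x y s by auto
    then have nsm: "simple_root s \<notin> inversions m" using m(2) by auto
    have shift: "inversions (s \<otimes> p) \<subseteq> ?I \<longleftrightarrow> inversions p \<subseteq> inversions (s \<otimes> x) \<inter> inversions (s \<otimes> y)"
      if "p \<in> carrier G" "simple_root s \<notin> inversions p" for p
      using inversions_subset_gen_mult[OF s(1) that(1) _ that(2) nsx(1)]
        inversions_subset_gen_mult[OF s(1) that(1) _ that(2) nsx(2)] s(1) x y by simp
    have "inversions p \<subseteq> inversions (s \<otimes> m)"
      if p: "p \<in> carrier G" "simple_root s \<in> inversions p" "inversions p \<subseteq> ?I" for p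
    proof -
      have q: "s \<otimes> p \<in> carrier G" "simple_root s \<notin> inversions (s \<otimes> p)"
        using p s(1) simple_inversion_flip[OF s(1) p(1)] by auto
      have "inversions (s \<otimes> p) \<subseteq> inversions m" using mg[OF q(1)] shift[OF q] p s(1) by simp
      then show ?thesis using inversions_subset_gen_mult[OF s(1) q(1) m(1) q(2) nsm] p s(1) by simp
    qed
    then show "\<exists>m. m \<in> carrier G \<and> inversions m \<subseteq> ?I \<and> simple_root s \<in> inversions m \<and>
      (\<forall>p\<in>carrier G. simple_root s \<in> inversions p \<longrightarrow> inversions p \<subseteq> ?I \<longrightarrow> inversions p \<subseteq> inversions m)"
      using shift[OF m(1) nsm] m s(1) simple_inversion_flip[OF s(1) m(1)] nsm
      by (intro exI[of _ "s \<otimes> m"]) simp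
  qed
  from bchoice[OF this] obtain M where M': "\<forall>s\<in>D. M s \<in> carrier G \<and> inversions (M s) \<subseteq> ?I \<and>
      simple_root s \<in> inversions (M s) \<and>
      (\<forall>p\<in>carrier G. simple_root s \<in> inversions p \<longrightarrow> inversions p \<subseteq> ?I \<longrightarrow> inversions p \<subseteq> inversions (M s))" ..
  have M: "M s \<in> carrier G" "inversions (M s) \<subseteq> ?I" "simple_root s \<in> inversions (M s)" if "s \<in> D" for s
    using M' that by auto
  have Mg: "inversions p \<subseteq> inversions (M s)"
    if "s \<in> D" "p \<in> carrier G" "simple_root s \<in> inversions p" "inversions p \<subseteq> ?I" for s p
    using bspec[OF M' that(1)] that by simp
  show ?case
  proof (cases "D = {}")
    case True
    then have "p = \<one>" if "p \<in> carrier G" "inversions p \<subseteq> ?I" for p using desc that by auto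
    then show ?thesis by (intro bexI[of _ \<one>]) auto
  next
    case False
    then obtain s where s: "s \<in> D" by auto
    have "inversions p \<subseteq> inversions (M s)" if p: "p \<in> carrier G" "inversions p \<subseteq> ?I" for p
    proof (cases "p = \<one>")
      case False
      then obtain t where t: "t \<in> D" "simple_root t \<in> inversions p" using desc[OF p] by auto
      obtain c where c: "c \<in> carrier G" "inversions c \<subseteq> ?I" "simple_root s \<in> inversions c" "simple_root t \<in> inversions c"
        using gen_join[of s t x y] s t x y by (auto simp: D_def)
      \<comment> \<open>\<open>c\<close> has the descent \<open>t\<close>, so it lies below
        \<open>M t\<close>, which thereby inherits the descent \<open>s\<close> and lies below
        \<open>M s\<close>.\<close>
      have "simple_root s \<in> inversions (M t)" using Mg[OF t(1) c(1,4,2)] c(3) by auto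
      then have "inversions (M t) \<subseteq> inversions (M s)" using Mg[OF s] M t(1) by blast
      then show ?thesis using Mg[OF t(1) p(1) t(2) p(2)] by blast
    qed simp
    then show ?thesis using M[OF s] by blast
  qed
qed

section \<open>Joins of bounded sets\<close>

lemma Upper_weak_order:
  assumes "A \<subseteq> carrier G"
  shows "Upper (weak_order G S) A = {u \<in> carrier G. \<forall>x\<in>A. inversions x \<subseteq> inversions u}"
  using assms by (auto simp: Upper_def weak_order_le_iff subset_iff)

text \<open>A shortest upper bound is the least one: its meet with another upper bound is still an
  upper bound, hence no shorter, hence equal to it.\<close>

lemma join_properties:
  assumes A: "A \<subseteq> carrier G" and u0: "u0 \<in> carrier G" "\<forall>x\<in>A. inversions x \<subseteq> inversions u0"
  defines "j \<equiv> \<Squnion>\<^bsub>weak_order G S\<^esub> A"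
  shows "j \<in> carrier G" and "\<And>x. x \<in> A \<Longrightarrow> inversions x \<subseteq> inversions j"
    and "\<And>u. u \<in> carrier G \<Longrightarrow> \<forall>x\<in>A. inversions x \<subseteq> inversions u \<Longrightarrow> inversions j \<subseteq> inversions u"
proof -
  define U where "U u \<longleftrightarrow> u \<in> carrier G \<and> (\<forall>x\<in>A. inversions x \<subseteq> inversions u)" for u
  have Upper: "Upper (weak_order G S) A = {u. U u}"
    using Upper_weak_order[OF A] by (simp add: U_def)
  have "U u0" using u0 by (simp add: U_def)
  then obtain u where u: "U u" and umin: "\<And>v. U v \<Longrightarrow> len u \<le> len v"
    using ex_has_least_nat[of U u0 len] by blast
  have uc: "u \<in> carrier G" using u by (simp add: U_def)
  have "inversions u \<subseteq> inversions v" if v: "U v" for v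
  proof -
    have vc: "v \<in> carrier G" using v by (simp add: U_def)
    obtain m where m: "m \<in> carrier G" "inversions m \<subseteq> inversions u \<inter> inversions v"
      and mg: "\<And>p. p \<in> carrier G \<Longrightarrow> inversions p \<subseteq> inversions u \<inter> inversions v \<Longrightarrow> inversions p \<subseteq> inversions m"
      using meet_exists[OF uc vc] by blast
    have "U m" using m(1) mg u v A by (auto simp: U_def subset_iff)
    then have "card (inversions u) \<le> card (inversions m)" using umin uc m(1) by (simp add: card_inversions)
    then have "inversions m = inversions u" using m(2) uc by (intro card_seteq) auto
    then show ?thesis using m(2) by auto
  qed
  then have "least (weak_order G S) u (Upper (weak_order G S) A)"
    unfolding least_def Upper using u uc by (auto simp: U_def weak_order_le_iff)
  then have "least (weak_order G S) j (Upper (weak_order G S) A)"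
    unfolding j_def Lattice.sup_def by (rule someI)
  then have j: "U j" "\<And>v. U v \<Longrightarrow> j \<sqsubseteq>\<^bsub>weak_order G S\<^esub> v"
    unfolding least_def Upper by auto
  show "j \<in> carrier G" "\<And>x. x \<in> A \<Longrightarrow> inversions x \<subseteq> inversions j" using j(1) by (auto simp: U_def)
  fix v assume v: "v \<in> carrier G" "\<forall>x\<in>A. inversions x \<subseteq> inversions v"
  then have "U v" by (simp add: U_def)
  then show "inversions j \<subseteq> inversions v" using j weak_order_le_iff[of j v] by (auto simp: U_def)
qed

section \<open>Gates lie in every Garside shadow\<close>

lemma cone_type_inv: "w \<in> carrier G \<Longrightarrow> cone_type G S (inv w) = {y \<in> carrier G. inversions w \<inter> inversions y = {}}"
  by (auto simp: cone_type_def len_quotient_add_iff)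

lemma gate_properties:
  assumes "T \<in> cone_types G S"
  shows "gate G S T \<in> carrier G" "cone_type G S (inv (gate G S T)) = T"
    and "\<And>w. w \<in> carrier G \<Longrightarrow> cone_type G S (inv w) = T \<Longrightarrow> len (gate G S T) \<le> len w"
proof -
  obtain x where "x \<in> carrier G" "T = cone_type G S x" using assms by (auto simp: cone_types_def)
  then have x: "inv x \<in> cone_class G S T" by (simp add: cone_class_def)
  have "gate G S T \<in> cone_class G S T"
    unfolding gate_def arg_min_on_def by (rule arg_min_natI[of "\<lambda>x. x \<in> cone_class G S T", OF x])
  then show "gate G S T \<in> carrier G" "cone_type G S (inv (gate G S T)) = T" by (auto simp: cone_class_def)
  fix w assume "w \<in> carrier G" "cone_type G S (inv w) = T"
  then have "w \<in> cone_class G S T" by (simp add: cone_class_def)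
  then show "len (gate G S T) \<le> len w"
    unfolding gate_def arg_min_on_def by (rule arg_min_nat_le)
qed

text \<open>Moving \<open>s\<close> across leaves the quotient and the sum of the two lengths
  unchanged, so additivity of lengths is preserved.\<close>

lemma disjoint_gen_mult:
  assumes s: "s \<in> S" and w: "w \<in> carrier G" and y: "y \<in> carrier G"
    and sw: "simple_root s \<notin> inversions w" and sy: "simple_root s \<in> inversions y"
  shows "inversions w \<inter> inversions y = {} \<longleftrightarrow> inversions (s \<otimes> w) \<inter> inversions (s \<otimes> y) = {}"
proof -
  have "len (s \<otimes> w) = len w + 1" "len y = len (s \<otimes> y) + 1"
    using simple_inversion[OF w s] simple_inversion[OF y s] sw sy len_gen_mult_cases[OF s w] len_gen_mult_cases[OF s y]
    by auto
  moreover have "inv (s \<otimes> w) \<otimes> (s \<otimes> y) = inv w \<otimes> y"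
    using s w y by (simp add: inv_mult_group m_assoc)
  ultimately show ?thesis
    using len_quotient_add_iff[OF w y] len_quotient_add_iff[of "s \<otimes> w" "s \<otimes> y"] s w y by simp
qed

text \<open>
  The projection \<open>\<pi>\<close> of \<open>W\<close> to the largest element of a Garside shadow below it satisfies
  \<open>\<pi> (s w) = \<pi> (s \<pi>(w))\<close> for \<open>s w > w\<close>, and hence preserves cone types.
\<close>

lemma gates_subset_garside_shadow:
  assumes B: "garside_shadow G S B"
  shows "gates G S \<subseteq> B"
proof -
  have Bc: "B \<subseteq> carrier G" and SB: "S \<subseteq> B"
    and Bjoin: "\<And>A. A \<subseteq> B \<Longrightarrow> Upper (weak_order G S) A \<noteq> {} \<Longrightarrow> \<Squnion>\<^bsub>weak_order G S\<^esub> A \<in> B"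
    and Bsuf: "\<And>w u. w \<in> B \<Longrightarrow> u \<in> carrier G \<Longrightarrow> is_suffix G S u w \<Longrightarrow> u \<in> B"
    using B by (auto simp: garside_shadow_def)
  define below where "below w = {b \<in> B. inversions b \<subseteq> inversions w}" for w
  define \<pi> where "\<pi> w = \<Squnion>\<^bsub>weak_order G S\<^esub> (below w)" for w
  have belowc: "below w \<subseteq> carrier G" for w using Bc by (auto simp: below_def)
  have \<pi>c: "\<pi> w \<in> carrier G" and \<pi>B: "\<pi> w \<in> B" and \<pi>le: "inversions (\<pi> w) \<subseteq> inversions w"
    and \<pi>max: "\<And>b. b \<in> B \<Longrightarrow> inversions b \<subseteq> inversions w \<Longrightarrow> inversions b \<subseteq> inversions (\<pi> w)"
    if w: "w \<in> carrier G" for w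
  proof -
    have bd: "\<forall>x\<in>below w. inversions x \<subseteq> inversions w" by (simp add: below_def)
    note j = join_properties[OF belowc w bd, folded \<pi>_def]
    show "\<pi> w \<in> carrier G" using j(1) .
    show "inversions (\<pi> w) \<subseteq> inversions w" using j(3)[OF w bd] .
    show "inversions b \<subseteq> inversions (\<pi> w)" if "b \<in> B" "inversions b \<subseteq> inversions w" for b
      using j(2)[of b] that by (simp add: below_def)
    have "Upper (weak_order G S) (below w) \<noteq> {}" using w bd by (auto simp: Upper_weak_order[OF belowc])
    then show "\<pi> w \<in> B" unfolding \<pi>_def by (intro Bjoin) (auto simp: below_def)
  qed
  \<comment> \<open>The generators belong to \<open>B\<close>, so the projection keeps all left
    descents.\<close>
  have \<pi>desc: "simple_root s \<in> inversions (\<pi> w) \<longleftrightarrow> simple_root s \<in> inversions w" if "s \<in> S" "w \<in> carrier G" for s w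
    using \<pi>le[OF that(2)] \<pi>max[OF that(2), of s] that(1) SB inversions_gen[OF that(1)] by auto
  have \<pi>step: "\<pi> (s \<otimes> w) = \<pi> (s \<otimes> \<pi> w)"
    if s: "s \<in> S" and w: "w \<in> carrier G" and sw: "simple_root s \<notin> inversions w" for s w
  proof -
    have sw': "simple_root s \<notin> inversions (\<pi> w)" using \<pi>desc[OF s w] sw by simp
    have c: "s \<otimes> w \<in> carrier G" "s \<otimes> \<pi> w \<in> carrier G" using s w \<pi>c[OF w] by auto
    have "inversions (s \<otimes> \<pi> w) \<subseteq> inversions (s \<otimes> w)"
      using inversions_subset_gen_mult[OF s \<pi>c[OF w] w sw' sw] \<pi>le[OF w] by simp
    then have "inversions (\<pi> (s \<otimes> \<pi> w)) \<subseteq> inversions (\<pi> (s \<otimes> w))"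
      using \<pi>max[OF c(1) \<pi>B[OF c(2)]] \<pi>le[OF c(2)] by simp
    moreover have "inversions (\<pi> (s \<otimes> w)) \<subseteq> inversions (\<pi> (s \<otimes> \<pi> w))"
    proof -
      let ?b = "\<pi> (s \<otimes> w)"
      have b: "?b \<in> carrier G" "?b \<in> B" using \<pi>c[OF c(1)] \<pi>B[OF c(1)] by auto
      have sb: "simple_root s \<in> inversions ?b"
        using \<pi>desc[OF s c(1)] simple_inversion_flip[OF s w] sw by simp
      then have nsb: "simple_root s \<notin> inversions (s \<otimes> ?b)" using simple_inversion_flip[OF s b(1)] by simp
      have "len ?b = len (s \<otimes> ?b) + 1"
        using simple_inversion[OF b(1) s] sb len_gen_mult_cases[OF s b(1)] by auto
      \<comment> \<open>Closure under suffixes puts \<open>s \<otimes> ?b\<close> into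
        \<open>B\<close>. It lies below \<open>w\<close>, hence below \<open>\<pi> w\<close>;
        multiplying by \<open>s\<close> puts \<open>?b\<close> below
        \<open>s \<otimes> \<pi> w\<close>.\<close>
      then have "is_suffix G S (s \<otimes> ?b) ?b"
        using s b(1) by (simp add: is_suffix_def inv_mult_group flip: m_assoc)
      then have "s \<otimes> ?b \<in> B" using Bsuf[OF b(2)] s b(1) by simp
      moreover have sbc: "s \<otimes> ?b \<in> carrier G" using s b(1) by simp
      moreover have "inversions (s \<otimes> ?b) \<subseteq> inversions w"
        using inversions_subset_gen_mult[OF s sbc w nsb sw] \<pi>le[OF c(1)] s b(1) by simp
      ultimately have "inversions (s \<otimes> ?b) \<subseteq> inversions (\<pi> w)" using \<pi>max[OF w] by simp
      then have "inversions ?b \<subseteq> inversions (s \<otimes> \<pi> w)"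
        using inversions_subset_gen_mult[OF s sbc \<pi>c[OF w] nsb sw'] s b(1) by simp
      then show ?thesis using \<pi>max[OF c(2) b(2)] by simp
    qed
    ultimately show ?thesis using inversions_inj[OF \<pi>c[OF c(1)] \<pi>c[OF c(2)]] by simp
  qed
  \<comment> \<open>Strip a left descent \<open>s\<close> of \<open>y\<close>. If \<open>w\<close>
    has it too, both intersections contain \<open>\<alpha>\<^sub>s\<close>; otherwise
    \<open>s\<close> moves over to \<open>w\<close> and \<open>\<pi>step\<close> joins two uses of
    the induction hypothesis.\<close>
  have disj: "inversions w \<inter> inversions y = {} \<longleftrightarrow> inversions (\<pi> w) \<inter> inversions y = {}"
    if "w \<in> carrier G" "y \<in> carrier G" for w y
    using that
  proof (induction "len y" arbitrary: w y rule: less_induct)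
    case less
    note w = less.prems(1) and y = less.prems(2)
    show ?case
    proof (cases "y = \<one>")
      case False
      then obtain s where s: "s \<in> S" "len y = len (s \<otimes> y) + 1" using left_descent_exists[OF y] by blast
      have sy: "simple_root s \<in> inversions y" using simple_inversion[OF y s(1)] s(2) by simp
      show ?thesis
      proof (cases "simple_root s \<in> inversions w")
        case True
        then show ?thesis using \<pi>desc[OF s(1) w] sy by auto
      next
        case sw: False
        then have sw': "simple_root s \<notin> inversions (\<pi> w)" using \<pi>desc[OF s(1) w] by simp
        have c: "s \<otimes> w \<in> carrier G" "s \<otimes> \<pi> w \<in> carrier G" "s \<otimes> y \<in> carrier G" "len (s \<otimes> y) < len y"
          using s w y \<pi>c[OF w] by auto
        have "inversions w \<inter> inversions y = {} \<longleftrightarrow> inversions (s \<otimes> w) \<inter> inversions (s \<otimes> y) = {}"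
          by (rule disjoint_gen_mult[OF s(1) w y sw sy])
        also have "\<dots> \<longleftrightarrow> inversions (\<pi> (s \<otimes> w)) \<inter> inversions (s \<otimes> y) = {}"
          by (rule less.hyps[OF c(4,1,3)])
        also have "\<dots> \<longleftrightarrow> inversions (s \<otimes> \<pi> w) \<inter> inversions (s \<otimes> y) = {}"
          unfolding \<pi>step[OF s(1) w sw] by (rule less.hyps[OF c(4,2,3), symmetric])
        also have "\<dots> \<longleftrightarrow> inversions (\<pi> w) \<inter> inversions y = {}"
          by (rule disjoint_gen_mult[OF s(1) \<pi>c[OF w] y sw' sy, symmetric])
        finally show ?thesis .
      qed
    qed simp
  qed
  show ?thesis
  proof
    fix g assume "g \<in> gates G S"
    then obtain T where T: "T \<in> cone_types G S" "g = gate G S T" by (auto simp: gates_def)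
    note gate = gate_properties[OF T(1), folded T(2)]
    have "cone_type G S (inv (\<pi> g)) = T"
      using gate(2) disj[OF gate(1)] gate(1) \<pi>c[OF gate(1)] by (auto simp: cone_type_inv)
    \<comment> \<open>The projection lies below the gate and has the same cone type, so minimality
      of length makes them equal.\<close>
    then have "len g \<le> len (\<pi> g)" using gate(3)[OF \<pi>c[OF gate(1)]] by simp
    then have "inversions (\<pi> g) = inversions g"
      using \<pi>le[OF gate(1)] gate(1) \<pi>c[OF gate(1)] by (intro card_seteq) (auto simp: card_inversions)
    then have "\<pi> g = g" by (rule inversions_inj[OF \<pi>c[OF gate(1)] gate(1)])
    then show "g \<in> B" using \<pi>B[OF gate(1)] by simp
  qed
qed


section \<open>Elements with spherical final roots\<close>

text \<open>For a right descent \<open>s\<close>, the root \<open>- w \<alpha>\<^sub>s\<close> is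
  the one inversion lost on passing from \<open>w\<close> to \<open>w \<otimes> s\<close>.\<close>

definition spherical_final :: "'a set" where
  "spherical_final = {w \<in> carrier G. \<forall>s\<in>S. len (w \<otimes> s) < len w \<longrightarrow>
     (\<lambda>t. - act w (simple_root s) t) \<in> spherical_roots G S}"

lemma dominates_iff:
  assumes "\<alpha> \<in> pos_roots G S" "\<beta> \<in> pos_roots G S"
  shows "dominates G S \<beta> \<alpha> \<longleftrightarrow> (\<forall>z\<in>carrier G. \<beta> \<in> inversions z \<longrightarrow> \<alpha> \<in> inversions z)"
  using assms by (auto simp: dominates_def neg_root_inversions)

lemma final_root_inversion:
  assumes w: "w \<in> carrier G" and s: "s \<in> S" "len (w \<otimes> s) < len w"
  shows "(\<lambda>t. - act w (simple_root s) t) \<in> inversions w"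
proof -
  have "height (act w (simple_root s)) < 0" using height_act_simple[OF w s(1)] s(2) by simp
  then have "(\<lambda>t. - act w (simple_root s) t) \<in> pos_roots G S"
    using uminus_root[OF rootI[OF w s(1)]] by (simp add: pos_root_iff)
  then show ?thesis using w s(1) by (simp add: inversions_iff act_uminus)
qed

lemma rrefl_uminus:
  assumes "\<gamma> \<in> roots G S"
  shows "rrefl (\<lambda>t. - \<gamma> t) = rrefl \<gamma>"
proof (rule act_faithful)
  fix v
  have "form v (\<lambda>t. - \<gamma> t) = - form v \<gamma>" using form_lincomb_right[of v "- 1" \<gamma> 0 \<gamma>] by simp
  then show "act (rrefl (\<lambda>t. - \<gamma> t)) v = act (rrefl \<gamma>) v"
    using assms uminus_root[OF assms] by (simp add: act_rrefl)
qed (use assms uminus_root[OF assms] in simp_all)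

text \<open>Inverting \<open>x\<close> turns \<beta> into the short inversion
  \<open>\<beta>'\<close> of \<open>inv x\<close>. The left descent of \<open>inv x\<close> found by
  \<open>short_inversion_support\<close> is a right descent of \<open>x\<close>, whose final root
  contains the support of \<beta>.\<close>

lemma spherical_final_short_inversions:
  assumes x: "x \<in> spherical_final"
  shows "short_inversions G S x \<subseteq> spherical_roots G S"
proof
  fix \<beta> assume b: "\<beta> \<in> short_inversions G S x"
  have xc: "x \<in> carrier G" using x by (simp add: spherical_final_def)
  have bp: "\<beta> \<in> pos_roots G S" and bl: "len (rrefl \<beta> \<otimes> x) + 1 = len x" using b by (simp_all add: short_inversion_iff)
  note br = pos_root_root[OF bp]
  define \<beta>' where "\<beta>' = (\<lambda>t. - act (inv x) \<beta> t)"
  have r': "act (inv x) \<beta> \<in> roots G S" using act_root[OF br] xc by simp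
  have p': "\<beta>' \<in> pos_roots G S"
    using uminus_root[OF r'] inversions_height[OF short_inversion_inversion[OF xc b]] by (simp add: pos_root_iff \<beta>'_def)
  have "rrefl \<beta>' \<otimes> inv x = inv (rrefl \<beta> \<otimes> x)"
    using rrefl_act[OF br, of "inv x"] rrefl_uminus[OF r'] br xc by (simp add: \<beta>'_def inv_mult_group m_assoc)
  then have "len (rrefl \<beta>' \<otimes> inv x) = len (rrefl \<beta> \<otimes> x)" using br xc len_inv[of "rrefl \<beta> \<otimes> x"] by simp
  then have "\<beta>' \<in> short_inversions G S (inv x)" using p' bl xc by (simp add: short_inversion_iff)
  then obtain s where s: "s \<in> S" "simple_root s \<in> inversions (inv x)"
    and supp: "\<And>t. t \<in> S \<Longrightarrow> act x \<beta>' t \<noteq> 0 \<Longrightarrow> act x (simple_root s) t \<noteq> 0"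
    using short_inversion_support[of "inv x" \<beta>'] xc by (metis inv_closed inv_inv)
  have "len (x \<otimes> s) < len x"
    using simple_inversion[of "inv x" s] s xc len_mult_gen[OF s(1) xc] by simp
  then have "(\<lambda>t. - act x (simple_root s) t) \<in> spherical_roots G S"
    using x s(1) by (simp add: spherical_final_def)
  then obtain J where J: "spherical_subset G S J" "{t\<in>S. - act x (simple_root s) t \<noteq> 0} \<subseteq> J"
    by (auto simp: spherical_roots_def)
  have "act x \<beta>' = (\<lambda>t. - \<beta> t)" using xc by (simp add: \<beta>'_def act_uminus)
  then have "{t\<in>S. \<beta> t \<noteq> 0} \<subseteq> J" using J(2) supp by auto
  then show "\<beta> \<in> spherical_roots G S" using bp J(1) by (auto simp: spherical_roots_def)
qed

lemma gen_in_spherical_final: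
  assumes s: "s \<in> S"
  shows "s \<in> spherical_final"
proof -
  have "x \<in> {\<one>, s}" if "x \<in> generate G {s}" for x
    using that by induction (use s in auto)
  then have "finite (generate G {s})" using finite_subset[of "generate G {s}" "{\<one>, s}"] by auto
  then have "simple_root s \<in> spherical_roots G S"
    using s simple_pos_root[OF s] unfolding spherical_roots_def spherical_subset_def
    by (auto simp: simple_root_def intro!: exI[of _ "{s}"])
  moreover have "r = s" if "r \<in> S" "len (s \<otimes> r) < len s" for r
  proof -
    have "s \<otimes> r = \<one>" using that s len_eq_0_iff[of "s \<otimes> r"] by simp
    then have "inv r = s" using that s by (intro inv_equality) auto
    then show ?thesis using that(1) by simp
  qed
  ultimately have "(\<lambda>t. - act s (simple_root r) t) \<in> spherical_roots G S"
    if "r \<in> S" "len (s \<otimes> r) < len s" for r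
    using that s by (metis (no_types, lifting) act_gen ext minus_minus srefl_self)
  then show ?thesis using s by (simp add: spherical_final_def)
qed

section \<open>Consequences of the equality of elementary and spherical roots\<close>

context
  assumes elementary_spherical: "elementary_roots G S = spherical_roots G S"
begin

text \<open>With \<open>w = v \<otimes> u\<close> and lengths adding, \<open>act v\<close> sends a
  final root \<beta> of \<open>u\<close> to one of \<open>w\<close>, which is elementary. A root
  \<mu> dominated by \<beta> is an inversion of \<open>u\<close>, so \<open>act v \<mu>\<close> is
  positive and would be dominated by \<open>act v \<beta>\<close>.\<close>

lemma spherical_final_suffix:
  assumes w: "w \<in> spherical_final" and u: "u \<in> carrier G" and suf: "is_suffix G S u w"
  shows "u \<in> spherical_final"
proof -
  have wc: "w \<in> carrier G" using w by (simp add: spherical_final_def)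
  define v where "v = w \<otimes> inv u"
  have v: "v \<in> carrier G" using wc u by (simp add: v_def)
  have wv: "w = v \<otimes> u" using wc u by (simp add: v_def m_assoc)
  have l: "len (v \<otimes> u) = len v + len u" using suf by (simp add: is_suffix_def flip: v_def wv)
  have "(\<lambda>t. - act u (simple_root s) t) \<in> elementary_roots G S" if s: "s \<in> S" "len (u \<otimes> s) < len u" for s
  proof -
    define \<beta> where "\<beta> = (\<lambda>t. - act u (simple_root s) t)"
    have bu: "\<beta> \<in> inversions u" unfolding \<beta>_def by (rule final_root_inversion[OF u s])
    have bp: "\<beta> \<in> pos_roots G S" using bu by (rule inversions_pos)
    have "len (w \<otimes> s) \<le> len v + len (u \<otimes> s)" using len_mult_le[OF v, of "u \<otimes> s"] u v s wv by (simp add: m_assoc)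
    then have "len (w \<otimes> s) < len w" using s(2) l wv by simp
    then have "(\<lambda>t. - act w (simple_root s) t) \<in> elementary_roots G S"
      using w s(1) elementary_spherical by (simp add: spherical_final_def)
    moreover have "(\<lambda>t. - act w (simple_root s) t) = act v \<beta>"
      using u v by (simp add: wv act_mult \<beta>_def act_uminus)
    ultimately have vb: "act v \<beta> \<in> elementary_roots G S" by simp
    have vbp: "act v \<beta> \<in> pos_roots G S" using vb by (simp add: elementary_roots_def)
    have "\<not> dominates G S \<beta> \<mu>" if m: "\<mu> \<in> pos_roots G S" "\<mu> \<noteq> \<beta>" for \<mu>
    proof
      assume "dominates G S \<beta> \<mu>"
      then have dom: "\<And>z. z \<in> carrier G \<Longrightarrow> \<beta> \<in> inversions z \<Longrightarrow> \<mu> \<in> inversions z"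
        using dominates_iff[OF m(1) bp] by blast
      have vm: "act v \<mu> \<in> pos_roots G S"
        using inversions_mult_right[OF v u l dom[OF u bu]] by (rule inversions_pos)
      have "act v \<mu> \<in> inversions z" if z: "z \<in> carrier G" "act v \<beta> \<in> inversions z" for z
      proof -
        have e: "act (inv (inv v \<otimes> z)) \<xi> = act (inv z) (act v \<xi>)" for \<xi>
          using v z by (simp add: inv_mult_group act_mult)
        have "\<beta> \<in> inversions (inv v \<otimes> z)" using inversions_height[OF z(2)] bp by (simp add: inversions_iff e)
        then have "\<mu> \<in> inversions (inv v \<otimes> z)" using dom[of "inv v \<otimes> z"] v z by simp
        then show ?thesis using inversions_height[of \<mu> "inv v \<otimes> z"] vm by (simp add: inversions_iff e)
      qed
      then have "dominates G S (act v \<beta>) (act v \<mu>)" using dominates_iff[OF vm vbp] by blast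
      moreover have "act v \<mu> \<noteq> act v \<beta>" using m(2) inj_act[OF v, of UNIV] by (auto dest: injD)
      ultimately show False using vb vm by (auto simp: elementary_roots_def)
    qed
    then show ?thesis using bp unfolding \<beta>_def[symmetric] by (auto simp: elementary_roots_def)
  qed
  then show ?thesis using u elementary_spherical by (simp add: spherical_final_def)
qed

text \<open>For a right descent \<open>s\<close> the shorter \<open>j \<otimes> s\<close> is no
  upper bound, so the final root \<beta> is an inversion of some \<open>x\<close> in
  \<open>A\<close>. Reflecting \<open>j\<close> in \<beta> loses one letter, so reflecting its
  prefix \<open>x\<close> cannot lose more. Thus \<beta> is short for \<open>x\<close>, hence
  spherical.\<close>

lemma spherical_final_join:
  assumes A: "A \<subseteq> spherical_final" and bounded: "Upper (weak_order G S) A \<noteq> {}"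
  shows "\<Squnion>\<^bsub>weak_order G S\<^esub> A \<in> spherical_final"
proof -
  define j where "j = \<Squnion>\<^bsub>weak_order G S\<^esub> A"
  have Ac: "A \<subseteq> carrier G" using A by (auto simp: spherical_final_def)
  obtain u where u: "u \<in> carrier G" "\<forall>x\<in>A. inversions x \<subseteq> inversions u"
    using bounded by (auto simp: Upper_weak_order[OF Ac])
  note jp = join_properties[OF Ac u, folded j_def]
  have "(\<lambda>t. - act j (simple_root s) t) \<in> spherical_roots G S" if s: "s \<in> S" "len (j \<otimes> s) < len j" for s
  proof -
    define k where "k = j \<otimes> s"
    have k: "k \<in> carrier G" "k \<otimes> s = j" using jp(1) s(1) by (simp_all add: k_def)
    have lk: "len (k \<otimes> s) = len k + 1" using s len_mult_gen_cases[OF s(1) jp(1)] k by (simp add: k_def)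
    define \<beta> where "\<beta> = act k (simple_root s)"
    have b: "\<beta> = (\<lambda>t. - act j (simple_root s) t)"
      using act_descent[OF jp(1) s(1)] by (simp add: \<beta>_def k_def)
    have invj: "inversions j = insert \<beta> (inversions k)"
      using inversions_mult_gen[OF k(1) s(1) lk] k(2) by (simp add: \<beta>_def)
    obtain x where x: "x \<in> A" "\<not> inversions x \<subseteq> inversions k"
    proof (rule ccontr)
      assume "\<not> thesis"
      then have "inversions j \<subseteq> inversions k" using jp(3)[OF k(1)] that by blast
      then have "card (inversions j) \<le> card (inversions k)" using k(1) by (intro card_mono) auto
      then show False using lk k jp(1) by (simp add: card_inversions)
    qed
    have xc: "x \<in> carrier G" using x Ac by auto
    have bx: "\<beta> \<in> inversions x" using x jp(2)[OF x(1)] invj by auto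
    have bp: "\<beta> \<in> pos_roots G S" using bx by (rule inversions_pos)
    note br = pos_root_root[OF bp]
    have rk: "rrefl \<beta> \<otimes> j = k"
      unfolding k(2)[symmetric] \<beta>_def using root_reflection_conjugate[OF k(1) s(1)] k(1) s(1) by (simp add: m_assoc)
    define y where "y = inv x \<otimes> j"
    have y: "y \<in> carrier G" "j = x \<otimes> y" using xc jp(1) by (simp_all add: y_def)
    have ly: "len j = len x + len y" using weak_le_iff[OF xc jp(1)] jp(2)[OF x(1)] by (simp add: y_def)
    have "len k \<le> len (rrefl \<beta> \<otimes> x) + len y"
      using len_mult_le[of "rrefl \<beta> \<otimes> x" y] br xc y rk by (simp add: m_assoc)
    then have "len x \<le> len (rrefl \<beta> \<otimes> x) + 1" using ly lk k(2) by simp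
    then have "\<beta> \<in> short_inversions G S x"
      using len_rrefl_less[OF bx xc] bp by (simp add: short_inversion_iff)
    then show ?thesis using spherical_final_short_inversions[of x] x A b by auto
  qed
  then show ?thesis using jp(1) by (simp add: spherical_final_def j_def[symmetric])
qed

lemma garside_shadow_spherical_final: "garside_shadow G S spherical_final"
  unfolding garside_shadow_def
  using gen_in_spherical_final spherical_final_suffix spherical_final_join
  by (auto simp: spherical_final_def subset_iff)

lemma low_elements_subset_gates: "low_elements G S \<subseteq> gates G S"
proof
  fix x assume "x \<in> low_elements G S"
  then have x: "x \<in> carrier G" and sx: "short_inversions G S x \<subseteq> spherical_roots G S"
    using elementary_spherical by (auto simp: low_elements_def)
  define T where "T = cone_type G S (inv x)"
  have T: "T \<in> cone_types G S" using x by (simp add: T_def cone_types_def)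
  define g where "g = gate G S T"
  note gate = gate_properties[OF T, folded g_def]
  have same: "inversions g \<inter> inversions z = {} \<longleftrightarrow> inversions x \<inter> inversions z = {}" if "z \<in> carrier G" for z
    using gate(2) that cone_type_inv[OF x] cone_type_inv[OF gate(1)] unfolding T_def by blast
  have "short_inversions G S x \<subseteq> inversions g"
  proof
    fix \<beta> assume b: "\<beta> \<in> short_inversions G S x"
    show "\<beta> \<in> inversions g"
    proof (rule ccontr)
      assume "\<beta> \<notin> inversions g"
      then obtain z where z: "z \<in> carrier G" "inversions z \<inter> inversions g = {}" "\<beta> \<in> inversions z"
        using spherical_root_avoiding[OF _ gate(1)] b sx by blast
      then show False using same[OF z(1)] short_inversion_inversion[OF x b] by auto
    qed
  qed
  then have "inversions x \<subseteq> inversions g" by (rule inversions_subset_if_short[OF x gate(1)])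
  moreover have "len g \<le> len x" using gate(3)[OF x] by (simp add: T_def)
  \<comment> \<open>The gate is shortest in its class, so the inclusion of inversion sets is an
    equality.\<close>
  ultimately have "inversions x = inversions g"
    using x gate(1) by (intro card_seteq) (auto simp: card_inversions)
  then have "x = g" by (rule inversions_inj[OF x gate(1)])
  then show "x \<in> gates G S" using T by (auto simp: gates_def g_def)
qed

end
end

theorem theorem6:
  fixes G :: "('a, 'b) monoid_scheme" and S :: "'a set"
  assumes "coxeter_system G S"
    and "finite S"
    and "elementary_roots G S = spherical_roots G S"
  shows "gates G S = smallest_garside_shadow G S
    \<and> smallest_garside_shadow G S = low_elements G S
    \<and> garside_shadow G S (gates G S)"
proof -
  interpret finite_coxeter_system G S
    using assms(1,2) by (simp add: finite_coxeter_system_def finite_coxeter_system_axioms_def)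
  note final = garside_shadow_spherical_final[OF assms(3)]
  have "gates G S \<subseteq> smallest_garside_shadow G S"
    using gates_subset_garside_shadow by (auto simp: smallest_garside_shadow_def)
  moreover have "smallest_garside_shadow G S \<subseteq> spherical_final"
    using final by (auto simp: smallest_garside_shadow_def)
  moreover have "spherical_final \<subseteq> low_elements G S"
    using spherical_final_short_inversions assms(3) by (auto simp: low_elements_def spherical_final_def)
  ultimately have "smallest_garside_shadow G S = gates G S" "low_elements G S = gates G S" "spherical_final = gates G S"
    using low_elements_subset_gates[OF assms(3)] by auto
  then show ?thesis using final by simp
qed

end
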